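(* Let $0<\alpha<\frac19$, let $\beta_1,\beta_2,\dots\in(0,\alpha]$, let $\phi\in C^1([0,1])$, and put $S_n=\sum_{k=1}^n\phi_k\circ\mathcal T^k$ and $\sigma_n^2=\int S_n^2\,dm$. Suppose there are $c>0$ and $\beta>\frac{1}{2(1-2\alpha)}$ such that $\sigma_n^2\ge c\,n^\beta$ for all sufficiently large $n$. Then $S_n/\sigma_n$ converges in distribution (with respect to $m$) to the standard normal law, i.e. $m\big(\{x: S_n(x)/\sigma_n\le t\}\big)\to\frac{1}{\sqrt{2\pi}}\int_{-\infty}^te^{-s^2/2}ds$ for every $t\in\mathbb R$.
   Context: For $0<\gamma<1$ let $T_\gamma(x)=x+2^\gamma x^{1+\gamma}$ on $[0,1/2]$ and $T_\gamma(x)=2x-1$ on $(1/2,1]$. $m$ is Lebesgue measure on $[0,1]$. For a sequence $\beta_k$ write $T_k=T_{\beta_k}$ and $\mathcal T^n=T_n\circ\cdots\circ T_1$. For $\phi\in C^1([0,1])$ put $\phi_k=\phi-\int\phi\circ\mathcal T^k\,dm$ for $k\ge1$. *)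

theory Defs
  imports "HOL-Analysis.Analysis"
begin

definition LSV :: "real \<Rightarrow> real \<Rightarrow> real" where
  "LSV \<gamma> x = (if x \<le> 1/2 then x + 2 powr \<gamma> * x powr (1 + \<gamma>) else 2 * x - 1)"

abbreviation unitm :: "real measure" where
  "unitm \<equiv> lebesgue_on {0..1}"

fun compT :: "(nat \<Rightarrow> real) \<Rightarrow> nat \<Rightarrow> real \<Rightarrow> real" where
  "compT \<beta> 0 = id"
| "compT \<beta> (Suc n) = LSV (\<beta> (Suc n)) \<circ> compT \<beta> n"

definition centered :: "(nat \<Rightarrow> real) \<Rightarrow> (real \<Rightarrow> real) \<Rightarrow> nat \<Rightarrow> real \<Rightarrow> real" where
  "centered \<beta> \<phi> k x = \<phi> x - (\<integral>y. \<phi> (compT \<beta> k y) \<partial>unitm)"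

definition birkS :: "(nat \<Rightarrow> real) \<Rightarrow> (real \<Rightarrow> real) \<Rightarrow> nat \<Rightarrow> real \<Rightarrow> real" where
  "birkS \<beta> \<phi> n x = (\<Sum>k=1..n. centered \<beta> \<phi> k (compT \<beta> k x))"

definition sigma2 :: "(nat \<Rightarrow> real) \<Rightarrow> (real \<Rightarrow> real) \<Rightarrow> nat \<Rightarrow> real" where
  "sigma2 \<beta> \<phi> n = (\<integral>x. (birkS \<beta> \<phi> n x)\<^sup>2 \<partial>unitm)"

definition C1_on_unit :: "(real \<Rightarrow> real) \<Rightarrow> bool" where
  "C1_on_unit \<phi> \<longleftrightarrow> (\<exists>\<phi>'. continuous_on {0..1} \<phi>' \<and>
      (\<forall>x\<in>{0..1}. (\<phi> has_real_derivative \<phi>' x) (at x within {0..1})))"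

definition Phi :: "real \<Rightarrow> real" where
  "Phi t = (LBINT s:{..t}. exp (- s\<^sup>2 / 2)) / sqrt (2 * pi)"

end

(* The transfer operators of the maps preserve nonincreasing densities bounded by A x^(-alpha).
   A density in this cone exceeds, after n steps, a constant proportional to its mass M, up to
   the mass O(n^(1 - 1/alpha)) that never left the left branch.  Two densities of equal mass
   can therefore be coupled by subtracting the same constant from both; iterating this p times
   with blocks of length about p gives L^1 loss of memory O(m^(-kappa/2)) after m = p^2 steps,
   where kappa = 1/alpha - 1 > 8.

   With F_k generated by the k-th iterate, X_k the k-th centred observable and
   H_k = E(X_1 + ... + X_(k-1) | F_k), the variables D_k = X_k + H_k - H_(k+1) are reverse
   martingale differences.  In the telescoping expansion of the characteristic function the term
   E(e_(k+1) (D_k^2 - E D_k^2)) splits into covariances of e_(k+1) with products X_i X_k and a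
   difference H_k^2 - H_(k+1)^2 that is summed by parts.  Decorrelating increments
   e_j - e_(j+1), whose size is |D_j|, costs the sum of the L^2 norms of the D_j, which is at
   most sqrt n * sigma_n.  All errors are thus O(sqrt n / sigma_n^2), and sigma_n^2 >= c n^beta
   with beta > 1/2 suffices.  L^4 bounds on H_k and this summation need the fourth root of the
   decay rate to be summable, that is kappa / 8 > 1, or alpha < 1/9. *)
theory Submission
  imports Defs "HOL-Probability.Probability"
begin

section \<open>Reverse martingale central limit theorem\<close>

text \<open>The maps are not invertible and vary with time, so the algebras \<open>F k\<close>
  decrease and only conditional expectations of earlier observables given a later position are under
  control. This forces a reverse martingale, and the exponentials of the telescoping are those of
  the tails D_k + ... + D_(n-1), which are measurable with respect to \<open>F k\<close>. Since
  \<sigma>_n^2 may grow more slowly than n, errors bounded by a constant per step would be too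
  large; every error is arranged to carry a factor \<open>s k\<close>, the L^2 norm of
  \<open>D k\<close>, or its square. Decay is only polynomial and only in L^1, tested on sets of the
  later algebra. Interpolation with the sup norm passes to L^2 and L^4 at the cost of square and
  fourth roots, which is why the mixing rates are written as fourth powers of a summable sequence.
  In the coupling the cone constant B stays the same while the mass shrinks, so subtraction becomes
  impossible once the mass is comparable to the mass still stuck near 0. At that moment the mass
  itself is an adequate bound, so this error enters once and not once per block.\<close>

lemmas bochner_cong = Bochner_Integration.integral_cong

text \<open>This class is closed under all operations needed below and consists of integrable
  functions on a finite measure space, so integrability of each product follows from the rules
  \<open>bm_intros\<close>. With a bound everywhere on \<open>space N\<close>, passing from a
  sub-algebra to \<open>M\<close> involves no null sets.\<close>

definition bdd_meas ::
    "'a measure \<Rightarrow> ('a \<Rightarrow> 'b::{second_countable_topology, real_normed_field, banach}) \<Rightarrow> bool" where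
  "bdd_meas N f \<longleftrightarrow> f \<in> borel_measurable N \<and> (\<exists>c. \<forall>x\<in>space N. norm (f x) \<le> c)"

named_theorems bm_intros

lemma bm_const [bm_intros]: "bdd_meas N (\<lambda>x. c)"
  unfolding bdd_meas_def by auto

lemma bm_add [bm_intros]:
  assumes "bdd_meas N f" "bdd_meas N g"
  shows "bdd_meas N (\<lambda>x. f x + g x)"
proof -
  from assms obtain c d where "\<forall>x\<in>space N. norm (f x) \<le> c" "\<forall>x\<in>space N. norm (g x) \<le> d"
    unfolding bdd_meas_def by auto
  then have "\<forall>x\<in>space N. norm (f x + g x) \<le> c + d"
    by (meson add_mono norm_triangle_ineq order_trans)
  then show ?thesis using assms unfolding bdd_meas_def by auto
qed

lemma bm_mult [bm_intros]:
  assumes "bdd_meas N f" "bdd_meas N g"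
  shows "bdd_meas N (\<lambda>x. f x * g x)"
proof -
  from assms obtain c d where "\<forall>x\<in>space N. norm (f x) \<le> c" "\<forall>x\<in>space N. norm (g x) \<le> d"
    unfolding bdd_meas_def by auto
  then have "\<forall>x\<in>space N. norm (f x * g x) \<le> c * d"
    by (auto simp: norm_mult intro!: mult_mono')
  then show ?thesis using assms unfolding bdd_meas_def by auto
qed

lemma bm_diff [bm_intros]:
  assumes "bdd_meas N f" "bdd_meas N g"
  shows "bdd_meas N (\<lambda>x. f x - g x)"
  using bm_add[OF assms(1) bm_mult[OF bm_const[of N "-1"] assms(2)]] by simp

lemma bm_power [bm_intros]:
  assumes "bdd_meas N f"
  shows "bdd_meas N (\<lambda>x. f x ^ n)"
  by (induction n) (auto intro!: bm_intros assms)

lemma bm_sum [bm_intros]: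
  assumes "\<And>i. i \<in> I \<Longrightarrow> bdd_meas N (f i)"
  shows "bdd_meas N (\<lambda>x. \<Sum>i\<in>I. f i x)"
  using assms by (induction I rule: infinite_finite_induct) (auto intro!: bm_intros)

lemma bm_norm [bm_intros]:
  assumes "bdd_meas N f"
  shows "bdd_meas N (\<lambda>x. norm (f x))"
  using assms unfolding bdd_meas_def by auto

lemma bm_abs [bm_intros]:
  fixes f :: "'a \<Rightarrow> real"
  assumes "bdd_meas N f"
  shows "bdd_meas N (\<lambda>x. \<bar>f x\<bar>)"
  using bm_norm[OF assms] by simp

lemma bm_of_real [bm_intros]:
  assumes "bdd_meas N f"
  shows "bdd_meas N (\<lambda>x. complex_of_real (f x))"
  using assms unfolding bdd_meas_def by auto

lemma bm_iexp [bm_intros]: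
  fixes f :: "'a \<Rightarrow> real"
  assumes "bdd_meas N f"
  shows "bdd_meas N (\<lambda>x. iexp (f x))"
  using assms unfolding bdd_meas_def by (auto intro!: exI[of _ 1])

lemma bm_Re:
  assumes "bdd_meas N f"
  shows "bdd_meas N (\<lambda>x. Re (f x))"
proof -
  from assms obtain c where "\<forall>x\<in>space N. norm (f x) \<le> c"
    unfolding bdd_meas_def by auto
  then have "\<forall>x\<in>space N. norm (Re (f x)) \<le> c"
    using abs_Re_le_cmod order_trans by fastforce
  then show ?thesis using assms unfolding bdd_meas_def by auto
qed

lemma bm_Im:
  assumes "bdd_meas N f"
  shows "bdd_meas N (\<lambda>x. Im (f x))"
proof -
  from assms obtain c where "\<forall>x\<in>space N. norm (f x) \<le> c"
    unfolding bdd_meas_def by auto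
  then have "\<forall>x\<in>space N. norm (Im (f x)) \<le> c"
    using abs_Im_le_cmod order_trans by fastforce
  then show ?thesis using assms unfolding bdd_meas_def by auto
qed

lemma bm_indicator [bm_intros]:
  assumes "A \<in> sets N"
  shows "bdd_meas N (indicator A :: _ \<Rightarrow> real)"
  using assms unfolding bdd_meas_def
  by (auto intro!: exI[of _ 1] simp: indicator_def)

lemma bm_subalgebra:
  assumes "subalgebra M F" "bdd_meas F f"
  shows "bdd_meas M f"
  using assms measurable_from_subalg unfolding bdd_meas_def subalgebra_def by metis

lemma (in finite_measure) bm_integrable:
  assumes "bdd_meas M f"
  shows "integrable M f"
  using assms unfolding bdd_meas_def
  by (auto intro!: integrable_const_bound)

text \<open>Discriminant argument for a nonnegative polynomial in \<open>l\<close>; the case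
  \<open>b = 0\<close> is separate because the minimiser c / b does not exist there.\<close>

lemma abs_le_of_quadratic:
  fixes a b c :: real
  assumes "\<And>l. a - 2 * l * c + l^2 * b \<ge> 0" "b \<ge> 0" "c \<ge> 0"
  shows "c \<le> sqrt a * sqrt b"
proof (cases "b = 0")
  case True
  have "c = 0"
  proof (rule ccontr)
    assume "c \<noteq> 0"
    \<comment> \<open>With b = 0 the polynomial is affine in \<open>l\<close>, and at this point its
      value is -1.\<close>
    then show False using assms(1)[of "(a+1)/(2*c)"] True by simp
  qed
  then show ?thesis using assms(1)[of 0] by (simp add: assms)
next
  case False
  then have b: "b > 0" using assms by simp
  have "a - 2 * (c/b) * c + (c/b)^2 * b \<ge> 0" by (rule assms)
  then have "c^2 \<le> a * b" using b by (simp add: field_simps power2_eq_square)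
  then have "sqrt (c^2) \<le> sqrt (a * b)" by (rule real_sqrt_le_mono)
  then show ?thesis using assms by (simp add: real_sqrt_mult)
qed

lemma (in finite_measure) bm_Cauchy_Schwarz:
  fixes f g :: "'a \<Rightarrow> real"
  assumes f: "bdd_meas M f" and g: "bdd_meas M g"
  shows "(\<integral>x. \<bar>f x\<bar> * \<bar>g x\<bar> \<partial>M) \<le> sqrt (\<integral>x. (f x)^2 \<partial>M) * sqrt (\<integral>x. (g x)^2 \<partial>M)"
proof (rule abs_le_of_quadratic)
  fix l :: real
  have "0 \<le> (\<integral>x. (\<bar>f x\<bar> - l * \<bar>g x\<bar>)^2 \<partial>M)" by simp
  also have "\<dots> = (\<integral>x. (f x)^2 - 2 * l * (\<bar>f x\<bar> * \<bar>g x\<bar>) + l^2 * (g x)^2 \<partial>M)"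
    by (simp add: power2_eq_square algebra_simps flip: abs_mult)
  also have "\<dots> = (\<integral>x. (f x)^2 \<partial>M) - 2 * l * (\<integral>x. \<bar>f x\<bar> * \<bar>g x\<bar> \<partial>M) + l^2 * (\<integral>x. (g x)^2 \<partial>M)"
    by (subst Bochner_Integration.integral_add Bochner_Integration.integral_diff;
        (intro bm_integrable bm_intros f g)?)+ simp
  finally show "0 \<le> (\<integral>x. (f x)^2 \<partial>M) - 2 * l * (\<integral>x. \<bar>f x\<bar> * \<bar>g x\<bar> \<partial>M) + l^2 * (\<integral>x. (g x)^2 \<partial>M)" .
qed simp_all

text \<open>Truncating the conditional expectation makes the bound hold everywhere and not only almost
  everywhere, so that all functions in the martingale argument are bounded and measurable.\<close>
definition bounded_cond_exp :: "'a measure \<Rightarrow> 'a measure \<Rightarrow> real \<Rightarrow> ('a \<Rightarrow> real) \<Rightarrow> 'a \<Rightarrow> real" where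
  "bounded_cond_exp M F c f x = max (- c) (min c (real_cond_exp M F f x))"

context prob_space
begin

lemma subalgebra_sigma_finite:
  assumes "subalgebra M F"
  shows "sigma_finite_subalgebra M F"
proof -
  interpret finite_measure_subalgebra M F
    by standard (rule assms)
  show ?thesis by standard
qed

lemma bounded_cond_exp_abs_le: "c \<ge> 0 \<Longrightarrow> \<bar>bounded_cond_exp M F c f x\<bar> \<le> c"
  unfolding bounded_cond_exp_def by auto

lemma bm_bounded_cond_exp:
  assumes "c \<ge> 0"
  shows "bdd_meas F (bounded_cond_exp M F c f)"
proof -
  have "bounded_cond_exp M F c f \<in> borel_measurable F"
    unfolding bounded_cond_exp_def by measurable
  then show ?thesis unfolding bdd_meas_def
    using bounded_cond_exp_abs_le[OF assms] by auto
qed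

lemma bounded_cond_exp_AE:
  assumes "subalgebra M F" "f \<in> borel_measurable M" "\<And>x. x \<in> space M \<Longrightarrow> \<bar>f x\<bar> \<le> c"
  shows "AE x in M. bounded_cond_exp M F c f x = real_cond_exp M F f x"
proof -
  interpret sigma_finite_subalgebra M F by (rule subalgebra_sigma_finite[OF assms(1)])
  have [measurable]: "f \<in> borel_measurable M" by fact
  have "integrable M f" using assms by (auto intro!: integrable_const_bound[of _ c])
  then have "AE x in M. real_cond_exp M F f x \<ge> - c" "AE x in M. real_cond_exp M F f x \<le> c"
    using assms(3) by (intro real_cond_exp_ge_c real_cond_exp_le_c; force intro: AE_I2 simp: abs_le_iff minus_le_iff)+
  then show ?thesis by eventually_elim (auto simp: bounded_cond_exp_def)
qed

lemma integral_bounded_cond_exp_real: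
  fixes g :: "'a \<Rightarrow> real"
  assumes F: "subalgebra M F" and f: "f \<in> borel_measurable M" "\<And>x. x \<in> space M \<Longrightarrow> \<bar>f x\<bar> \<le> c"
    and g: "bdd_meas F g"
  shows "(\<integral>x. g x * bounded_cond_exp M F c f x \<partial>M) = (\<integral>x. g x * f x \<partial>M)"
proof -
  interpret sigma_finite_subalgebra M F by (rule subalgebra_sigma_finite[OF F])
  have [measurable]: "f \<in> borel_measurable M" "g \<in> borel_measurable F" "g \<in> borel_measurable M"
    using f g bm_subalgebra[OF F g] unfolding bdd_meas_def by auto
  have "bdd_meas M f" unfolding bdd_meas_def using f by auto
  then have "integrable M (\<lambda>x. g x * f x)" using bm_subalgebra[OF F g] by (intro bm_integrable bm_intros)
  then have "(\<integral>x. g x * f x \<partial>M) = (\<integral>x. g x * real_cond_exp M F f x \<partial>M)"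
    by (intro real_cond_exp_intg(2)[symmetric]) auto
  also have "\<dots> = (\<integral>x. g x * bounded_cond_exp M F c f x \<partial>M)"
    using bounded_cond_exp_AE[OF assms(1-3)]
    by (intro integral_cong_AE) (auto simp: bounded_cond_exp_def)
  finally show ?thesis by simp
qed

text \<open>The test functions of the characteristic function argument are complex while the
  conditional expectation is real, so the identity is checked on real and imaginary parts.\<close>

lemma integral_bounded_cond_exp:
  fixes g :: "'a \<Rightarrow> complex"
  assumes F: "subalgebra M F" and f: "f \<in> borel_measurable M" "\<And>x. x \<in> space M \<Longrightarrow> \<bar>f x\<bar> \<le> c" "c \<ge> 0"
    and g: "bdd_meas F g"
  shows "(\<integral>x. g x * of_real (bounded_cond_exp M F c f x) \<partial>M) = (\<integral>x. g x * of_real (f x) \<partial>M)"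
proof -
  have bf: "bdd_meas M f" unfolding bdd_meas_def using f by auto
  have gM: "bdd_meas M g" by (rule bm_subalgebra[OF F g])
  have cM: "bdd_meas M (bounded_cond_exp M F c f)"
    by (rule bm_subalgebra[OF F bm_bounded_cond_exp[OF f(3)]])
  have i: "integrable M (\<lambda>x. g x * of_real (bounded_cond_exp M F c f x))"
       "integrable M (\<lambda>x. g x * of_real (f x))"
    by (intro bm_integrable bm_intros bf gM cM)+
  show ?thesis
  proof (rule complex_eqI)
    show "Re (\<integral>x. g x * of_real (bounded_cond_exp M F c f x) \<partial>M) = Re (\<integral>x. g x * of_real (f x) \<partial>M)"
      using integral_bounded_cond_exp_real[OF F f(1,2) bm_Re[OF g]]
      by (simp add: integral_Re[OF i(1), symmetric] integral_Re[OF i(2), symmetric])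
    show "Im (\<integral>x. g x * of_real (bounded_cond_exp M F c f x) \<partial>M) = Im (\<integral>x. g x * of_real (f x) \<partial>M)"
      using integral_bounded_cond_exp_real[OF F f(1,2) bm_Im[OF g]]
      by (simp add: integral_Im[OF i(1), symmetric] integral_Im[OF i(2), symmetric])
  qed
qed

text \<open>The \<open>L\<^sup>1\<close> norm of a conditional expectation only needs to be tested on the two events where it
  is nonnegative resp. negative.\<close>
lemma bounded_cond_exp_L1:
  assumes F: "subalgebra M F" and f: "f \<in> borel_measurable M" "\<And>x. x \<in> space M \<Longrightarrow> \<bar>f x\<bar> \<le> c" "c \<ge> 0"
    and d: "\<And>B. B \<in> sets F \<Longrightarrow> \<bar>\<integral>x. indicator B x * f x \<partial>M\<bar> \<le> d"
  shows "(\<integral>x. \<bar>bounded_cond_exp M F c f x\<bar> \<partial>M) \<le> 2 * d"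
proof -
  let ?h = "bounded_cond_exp M F c f"
  have bh: "bdd_meas F ?h" by (rule bm_bounded_cond_exp[OF f(3)])
  then have m[measurable]: "?h \<in> borel_measurable F" unfolding bdd_meas_def by simp
  have hM: "bdd_meas M ?h" by (rule bm_subalgebra[OF F bh])
  define P where "P = {x\<in>space F. ?h x \<ge> 0}"
  define N where "N = {x\<in>space F. ?h x < 0}"
  have PN: "P \<in> sets F" "N \<in> sets F" unfolding P_def N_def by measurable
  then have PNM: "P \<in> sets M" "N \<in> sets M" using F unfolding subalgebra_def by auto
  have sp: "space F = space M" using F unfolding subalgebra_def by simp
  have "(\<integral>x. \<bar>?h x\<bar> \<partial>M) = (\<integral>x. indicator P x * ?h x - indicator N x * ?h x \<partial>M)"
    by (intro bochner_cong) (auto simp: P_def N_def sp indicator_def)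
  also have "\<dots> = (\<integral>x. indicator P x * ?h x \<partial>M) - (\<integral>x. indicator N x * ?h x \<partial>M)"
    by (intro Bochner_Integration.integral_diff bm_integrable bm_mult bm_indicator PNM hM)
  also have "\<dots> = (\<integral>x. indicator P x * f x \<partial>M) - (\<integral>x. indicator N x * f x \<partial>M)"
    using PN by (simp add: integral_bounded_cond_exp_real[OF F f(1,2)] bm_indicator)
  also have "\<dots> \<le> 2 * d" using d[OF PN(1)] d[OF PN(2)] by linarith
  finally show ?thesis .
qed

text \<open>Interpolation with the sup norm: |h|^n is at most c^(n-1) |h|. It turns an L^1 bound of
  order \<eta>^4 into an L^2 norm of order \<eta>^2 and an L^4 norm of order \<eta>.\<close>

lemma integral_power_le_of_L1:
  fixes h :: "'a \<Rightarrow> real"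
  assumes h: "bdd_meas M h" "\<And>x. x \<in> space M \<Longrightarrow> \<bar>h x\<bar> \<le> c" and d: "(\<integral>x. \<bar>h x\<bar> \<partial>M) \<le> d"
    and c: "c \<ge> 0" and n: "n > 0" "even n"
  shows "(\<integral>x. h x ^ n \<partial>M) \<le> c ^ (n - 1) * d"
proof -
  obtain m where m: "n = Suc m" using n by (cases n) auto
  have "(\<integral>x. h x ^ n \<partial>M) \<le> (\<integral>x. c ^ m * \<bar>h x\<bar> \<partial>M)"
  proof (intro integral_mono bm_integrable bm_intros h(1))
    fix x assume "x \<in> space M"
    then have "\<bar>h x\<bar> ^ m \<le> c ^ m" using h(2) by (intro power_mono) auto
    then have "\<bar>h x\<bar> ^ n \<le> c ^ m * \<bar>h x\<bar>" unfolding m by (simp add: mult.commute mult_left_mono)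
    then show "h x ^ n \<le> c ^ m * \<bar>h x\<bar>" using n(2) by (simp add: power_even_abs)
  qed
  also have "\<dots> = c ^ m * (\<integral>x. \<bar>h x\<bar> \<partial>M)" by simp
  also have "\<dots> \<le> c ^ m * d" using d c by (intro mult_left_mono) auto
  finally show ?thesis using m by simp
qed

end

text \<open>Cauchy-Schwarz twice with the weights \<open>e\<close>. With the decay rate as weight it
  takes the place of Minkowski in L^4: a term with fourth moment of order e^4 contributes only e to
  the last sum.\<close>

lemma sum_power4_le_weighted:
  fixes a e :: "'i \<Rightarrow> real"
  assumes pos: "\<And>i. i \<in> I \<Longrightarrow> e i > 0"
  shows "(\<Sum>i\<in>I. a i) ^ 4 \<le> (\<Sum>i\<in>I. e i) ^ 3 * (\<Sum>i\<in>I. (a i) ^ 4 / (e i) ^ 3)"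
proof -
  define E A2 A4 where "E = (\<Sum>i\<in>I. e i)" and "A2 = (\<Sum>i\<in>I. (a i)^2 / e i)"
    and "A4 = (\<Sum>i\<in>I. (a i)^4 / (e i)^3)"
  have E0: "E \<ge> 0" unfolding E_def by (rule sum_nonneg, rule less_imp_le, erule pos)
  have 1: "(\<Sum>i\<in>I. a i)^2 \<le> E * A2"
  proof -
    have "(\<Sum>i\<in>I. a i) = (\<Sum>i\<in>I. sqrt (e i) * (a i / sqrt (e i)))"
      by (rule sum.cong[OF refl]) (use pos in force)
    moreover have "(\<Sum>i\<in>I. (sqrt (e i))^2) = E"
      unfolding E_def by (rule sum.cong[OF refl]) (use pos in force)
    moreover have "(\<Sum>i\<in>I. (a i / sqrt (e i))^2) = A2"
      unfolding A2_def by (rule sum.cong[OF refl]) (use pos in \<open>force simp: power_divide\<close>)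
    ultimately show ?thesis
      using Cauchy_Schwarz_ineq_sum[of "\<lambda>i. sqrt (e i)" "\<lambda>i. a i / sqrt (e i)" I] by simp
  qed
  have 2: "A2^2 \<le> E * A4"
  proof -
    have "A2 = (\<Sum>i\<in>I. sqrt (e i) * ((a i)^2 / e i / sqrt (e i)))"
      unfolding A2_def by (rule sum.cong[OF refl]) (use pos in force)
    moreover have "(\<Sum>i\<in>I. (sqrt (e i))^2) = E"
      unfolding E_def by (rule sum.cong[OF refl]) (use pos in force)
    moreover have "((a i)^2 / e i / sqrt (e i))^2 = (a i)^4 / (e i)^3" if "i \<in> I" for i
    proof -
      have "(sqrt (e i))^2 = e i" using pos[OF that] by simp
      then have "((a i)^2 / e i / sqrt (e i))^2 = ((a i)^2)^2 / (e i)^2 / e i"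
        by (simp add: power_divide power_mult_distrib)
      also have "\<dots> = (a i)^4 / (e i)^3"
        by (simp add: power_mult_distrib power2_eq_square power3_eq_cube power4_eq_xxxx)
      finally show ?thesis .
    qed
    then have "(\<Sum>i\<in>I. ((a i)^2 / e i / sqrt (e i))^2) = A4"
      unfolding A4_def by (rule sum.cong[OF refl])
    ultimately show ?thesis
      using Cauchy_Schwarz_ineq_sum[of "\<lambda>i. sqrt (e i)" "\<lambda>i. (a i)^2 / e i / sqrt (e i)" I] by simp
  qed
  have "(\<Sum>i\<in>I. a i) ^ 4 = ((\<Sum>i\<in>I. a i)^2)^2" by simp
  also have "\<dots> \<le> (E * A2)^2" by (rule power_mono[OF 1]) simp
  also have "\<dots> = E^2 * A2^2" by (rule power_mult_distrib)
  also have "\<dots> \<le> E^2 * (E * A4)" by (rule mult_left_mono[OF 2]) simp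
  also have "\<dots> = E ^ 3 * A4" by (simp add: power2_eq_square power3_eq_cube)
  finally show ?thesis unfolding E_def A4_def .
qed

text \<open>The algebras decrease. Testing on sets of \<open>F j\<close> is the weak form in which
  decay of densities is available; it controls L^1 norms of conditional expectations given
  \<open>F j\<close>. The rate in \<open>mix2\<close> depends only on the gap after the second
  factor, and the fourth power makes \<eta> itself the rate in L^4.\<close>

locale reverse_mixing = prob_space M for M :: "'a measure" +
  fixes F :: "nat \<Rightarrow> 'a measure" and X :: "nat \<Rightarrow> 'a \<Rightarrow> real" and K :: real and \<eta> :: "nat \<Rightarrow> real"
  assumes sub: "\<And>k. subalgebra M (F k)"
    and sub_Suc: "\<And>k. subalgebra (F k) (F (Suc k))"
    and X_meas: "\<And>k. X k \<in> borel_measurable (F k)"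
    and X_bound: "\<And>k x. x \<in> space M \<Longrightarrow> \<bar>X k x\<bar> \<le> K"
    and K_ge_1: "K \<ge> 1"
    and eta_pos: "\<And>m. \<eta> m > 0"
    and eta_decseq: "decseq \<eta>"
    and eta_summable: "summable \<eta>"
    and mix1: "\<And>k j A. k < j \<Longrightarrow> A \<in> sets (F j) \<Longrightarrow> \<bar>\<integral>x. indicator A x * X k x \<partial>M\<bar> \<le> \<eta> (j - k) ^ 4"
    and mix2: "\<And>i k j A. i \<le> k \<Longrightarrow> k < j \<Longrightarrow> A \<in> sets (F j) \<Longrightarrow>
        \<bar>\<integral>x. indicator A x * (X i x * X k x - (\<integral>y. X i y * X k y \<partial>M)) \<partial>M\<bar> \<le> \<eta> (j - k) ^ 4"
begin

section \<open>Conditional expectations given later algebras, and their moments\<close>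

definition G :: "nat \<Rightarrow> nat \<Rightarrow> 'a \<Rightarrow> real" where
  "G i k = bounded_cond_exp M (F k) K (X i)"

definition Xc :: "nat \<Rightarrow> nat \<Rightarrow> 'a \<Rightarrow> real" where
  "Xc i k x = X i x * X k x - (\<integral>y. X i y * X k y \<partial>M)"

definition V :: "nat \<Rightarrow> nat \<Rightarrow> nat \<Rightarrow> 'a \<Rightarrow> real" where
  "V i k j = bounded_cond_exp M (F j) (2 * K^2) (Xc i k)"

definition H :: "nat \<Rightarrow> 'a \<Rightarrow> real" where
  "H k x = (\<Sum>i<k. G i k x)"

definition D :: "nat \<Rightarrow> 'a \<Rightarrow> real" where
  "D k x = X k x + H k x - H (Suc k) x"

definition s2 :: "nat \<Rightarrow> real" where
  "s2 k = (\<integral>x. (D k x)^2 \<partial>M)"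

abbreviation XX :: "nat \<Rightarrow> nat \<Rightarrow> 'a \<Rightarrow> real" where
  "XX i k \<equiv> \<lambda>x. X i x * X k x"

definition cov :: "('a \<Rightarrow> complex) \<Rightarrow> ('a \<Rightarrow> real) \<Rightarrow> complex" where
  "cov g f = (\<integral>x. g x * of_real (f x) \<partial>M) - (\<integral>x. g x \<partial>M) * of_real (\<integral>x. f x \<partial>M)"

definition \<Lambda> :: real where "\<Lambda> = suminf \<eta>"

text \<open>A common bound for the fourth moments of all \<open>H k\<close> and \<open>D k\<close>:
  27 comes from \<open>power4_add3\<close>, and 4 * K^3 * \<Lambda>^4 is twice the bound in
  \<open>integral_H_power4_le\<close>, once for \<open>H k\<close> and once for
  \<open>H (Suc k)\<close>.\<close>

definition Q :: real where "Q = 27 * (K^4 + 4 * K^3 * \<Lambda>^4)"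

lemma K_nonneg: "K \<ge> 0" using K_ge_1 by simp

lemma sub_le: "k \<le> j \<Longrightarrow> subalgebra (F k) (F j)"
proof (induction j rule: dec_induct)
  case base then show ?case by (simp add: subalgebra_def)
next
  case (step j) then show ?case using sub_Suc[of j] unfolding subalgebra_def by auto
qed

lemma bm_le: "k \<le> j \<Longrightarrow> bdd_meas (F j) f \<Longrightarrow> bdd_meas (F k) f"
  using bm_subalgebra[OF sub_le] by blast

lemma bm_of_F: "bdd_meas (F j) f \<Longrightarrow> bdd_meas M f"
  using bm_subalgebra[OF sub] by blast

lemma space_F: "space (F k) = space M" using sub[of k] unfolding subalgebra_def by simp

lemma bm_X: "bdd_meas (F k) (X k)"
  unfolding bdd_meas_def using X_meas X_bound space_F by auto

lemma bm_G: "bdd_meas (F k) (G i k)"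
  unfolding G_def by (rule bm_bounded_cond_exp[OF K_nonneg])

lemma bm_H: "bdd_meas (F k) (H k)"
  unfolding H_def by (intro bm_intros bm_G)

lemma bm_D: "bdd_meas (F k) (D k)"
  unfolding D_def by (intro bm_intros bm_X bm_H bm_le[OF _ bm_H]) simp

lemma bm_Xc: "i \<le> k \<Longrightarrow> bdd_meas M (Xc i k)"
  unfolding Xc_def by (intro bm_intros bm_of_F[OF bm_X])

lemma bm_V: "bdd_meas (F j) (V i k j)"
  unfolding V_def by (rule bm_bounded_cond_exp) simp

lemmas bm_M = bm_of_F[OF bm_X] bm_of_F[OF bm_G] bm_of_F[OF bm_H] bm_of_F[OF bm_D] bm_of_F[OF bm_V]

lemma X_measM: "X k \<in> borel_measurable M"
  using bm_M(1) unfolding bdd_meas_def by simp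

lemma G_abs: "\<bar>G i k x\<bar> \<le> K" unfolding G_def by (rule bounded_cond_exp_abs_le[OF K_nonneg])

lemma V_abs: "\<bar>V i k j x\<bar> \<le> 2 * K^2" unfolding V_def by (rule bounded_cond_exp_abs_le) simp

lemma Xc_abs: assumes "x \<in> space M" shows "\<bar>Xc i k x\<bar> \<le> 2 * K^2"
proof -
  have p: "\<bar>X i x * X k x\<bar> \<le> K^2" if "x \<in> space M" for x
    unfolding abs_mult power2_eq_square using X_bound[OF that] by (intro mult_mono K_nonneg) auto
  have "\<bar>\<integral>x. X i x * X k x \<partial>M\<bar> \<le> (\<integral>x. \<bar>X i x * X k x\<bar> \<partial>M)" by (rule integral_abs_bound)
  also have "\<dots> \<le> (\<integral>x. K^2 \<partial>M)"
    by (intro integral_mono bm_integrable bm_intros bm_M p)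
  finally have "\<bar>\<integral>x. X i x * X k x \<partial>M\<bar> \<le> K^2" by (simp add: prob_space)
  with p[OF assms] show ?thesis unfolding Xc_def by linarith
qed

lemma integral_G:
  fixes g :: "'a \<Rightarrow> complex"
  assumes "bdd_meas (F k) g"
  shows "(\<integral>x. g x * of_real (G i k x) \<partial>M) = (\<integral>x. g x * of_real (X i x) \<partial>M)"
  unfolding G_def by (rule integral_bounded_cond_exp[OF sub X_measM X_bound K_nonneg assms])

lemma integral_V:
  fixes g :: "'a \<Rightarrow> complex"
  assumes "bdd_meas (F j) g" "i \<le> k"
  shows "(\<integral>x. g x * of_real (V i k j x) \<partial>M) = (\<integral>x. g x * of_real (Xc i k x) \<partial>M)"
  unfolding V_def using bm_Xc[OF assms(2)] Xc_abs
  by (intro integral_bounded_cond_exp[OF sub _ _ _ assms(1)]) (auto simp: bdd_meas_def)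

lemma integral_abs_G: "i < k \<Longrightarrow> (\<integral>x. \<bar>G i k x\<bar> \<partial>M) \<le> 2 * \<eta> (k - i) ^ 4"
  unfolding G_def by (rule bounded_cond_exp_L1[OF sub X_measM X_bound K_nonneg mix1])

lemma integral_G_square: assumes "i < k" shows "(\<integral>x. (G i k x)^2 \<partial>M) \<le> 2 * K * \<eta> (k - i) ^ 4"
  using integral_power_le_of_L1[OF bm_M(2) G_abs integral_abs_G[OF assms] K_nonneg, of 2]
  by simp

lemma integral_G_power4: assumes "i < k" shows "(\<integral>x. (G i k x)^4 \<partial>M) \<le> 2 * K^3 * \<eta> (k - i) ^ 4"
  using integral_power_le_of_L1[OF bm_M(2) G_abs integral_abs_G[OF assms] K_nonneg, of 4]
  by simp

lemma integral_V_square: assumes "i \<le> k" "k < j" shows "(\<integral>x. (V i k j x)^2 \<partial>M) \<le> 4 * K^2 * \<eta> (j - k) ^ 4"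
proof -
  have "(\<integral>x. \<bar>V i k j x\<bar> \<partial>M) \<le> 2 * \<eta> (j - k) ^ 4"
    unfolding V_def using bm_Xc[OF assms(1)] Xc_abs mix2[OF assms]
    by (intro bounded_cond_exp_L1[OF sub]) (auto simp: bdd_meas_def Xc_def)
  from integral_power_le_of_L1[OF bm_M(5) V_abs this, of 2] show ?thesis
    by (simp add: ac_simps)
qed

lemma Lambda_nonneg: "\<Lambda> \<ge> 0"
  unfolding \<Lambda>_def by (intro suminf_nonneg eta_summable less_imp_le eta_pos)

lemma sum_eta_le:
  assumes "finite I" "inj_on f I"
  shows "(\<Sum>i\<in>I. \<eta> (f i)) \<le> \<Lambda>"
proof -
  have "(\<Sum>i\<in>I. \<eta> (f i)) = sum \<eta> (f ` I)" by (simp add: sum.reindex[OF assms(2)])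
  also have "\<dots> \<le> \<Lambda>" unfolding \<Lambda>_def
    by (intro sum_le_suminf eta_summable) (auto simp: assms less_imp_le eta_pos)
  finally show ?thesis .
qed

text \<open>The weights in \<open>sum_power4_le_weighted\<close> are \<eta> (k - i). Each fourth
  moment, of order \<eta>^4, is divided by \<eta>^3 and leaves a summable \<eta>, so the bound is
  uniform in \<open>k\<close>.\<close>

lemma integral_H_power4_le: "(\<integral>x. (H k x)^4 \<partial>M) \<le> 2 * K^3 * \<Lambda>^4"
proof -
  let ?e = "\<lambda>i. \<eta> (k - i)"
  have S: "(\<Sum>i<k. ?e i) \<le> \<Lambda>" by (rule sum_eta_le) (auto simp: inj_on_def)
  have S0: "(\<Sum>i<k. ?e i) \<ge> 0" by (intro sum_nonneg less_imp_le eta_pos)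
  have "(\<integral>x. (H k x)^4 \<partial>M) \<le> (\<integral>x. (\<Sum>i<k. ?e i)^3 * (\<Sum>i<k. inverse (?e i ^ 3) * (G i k x)^4) \<partial>M)"
    unfolding H_def using sum_power4_le_weighted[of "{..<k}" ?e, OF eta_pos]
    by (intro integral_mono bm_integrable bm_intros bm_M) (simp add: field_simps)
  also have "\<dots> = (\<Sum>i<k. ?e i)^3 * (\<Sum>i<k. inverse (?e i ^ 3) * (\<integral>x. (G i k x)^4 \<partial>M))"
    by (simp add: bm_integrable bm_intros bm_M)
  also have "\<dots> \<le> (\<Sum>i<k. ?e i)^3 * (\<Sum>i<k. inverse (?e i ^ 3) * (2 * K^3 * ?e i ^ 4))"
    using S0 eta_pos by (intro mult_left_mono sum_mono integral_G_power4) (auto simp: less_imp_le)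
  also have "(\<Sum>i<k. inverse (?e i ^ 3) * (2 * K^3 * ?e i ^ 4)) = (\<Sum>i<k. 2 * K^3 * ?e i)"
    using eta_pos by (intro sum.cong) (auto simp: field_simps power4_eq_xxxx power3_eq_cube less_imp_neq[THEN not_sym])
  also have "(\<Sum>i<k. ?e i)^3 * (\<Sum>i<k. 2 * K^3 * ?e i) = 2 * K^3 * (\<Sum>i<k. ?e i)^4"
    by (simp add: sum_distrib_left[symmetric] power4_eq_xxxx power3_eq_cube)
  also have "\<dots> \<le> 2 * K^3 * \<Lambda>^4"
    using S S0 K_nonneg by (intro mult_left_mono power_mono) auto
  finally show ?thesis .
qed

lemma Q_ge_1: "Q \<ge> 1"
proof -
  have "K^4 \<ge> 1" using K_ge_1 by simp
  moreover have "K^3 * \<Lambda>^4 \<ge> 0" using K_nonneg Lambda_nonneg by simp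
  ultimately show ?thesis unfolding Q_def by simp
qed

lemma integral_H_power4: "(\<integral>x. (H k x)^4 \<partial>M) \<le> Q"
proof -
  have "K^4 \<ge> 0" "K^3 * \<Lambda>^4 \<ge> 0" using K_nonneg Lambda_nonneg by auto
  with integral_H_power4_le[of k] show ?thesis unfolding Q_def distrib_left mult.assoc by linarith
qed

lemma power4_add3:
  fixes a b c :: real
  shows "(a + b - c)^4 \<le> 27 * (a^4 + b^4 + c^4)"
proof -
  have sq: "(x + y - z)^2 \<le> 3 * (x^2 + y^2 + z^2)" for x y z :: real
    using zero_le_power2[of "x - y"] zero_le_power2[of "x + z"] zero_le_power2[of "y + z"]
    by (simp add: power2_eq_square algebra_simps)
  have sq': "(x + y + z)^2 \<le> 3 * (x^2 + y^2 + z^2)" for x y z :: real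
    using sq[of x y "-z"] by simp
  have "(a + b - c)^4 = ((a + b - c)^2)^2" by simp
  also have "\<dots> \<le> (3 * (a^2 + b^2 + c^2))^2" by (intro power_mono sq) simp
  also have "\<dots> = 9 * (a^2 + b^2 + c^2)^2" by (simp only: power_mult_distrib) simp
  also have "\<dots> \<le> 9 * (3 * ((a^2)^2 + (b^2)^2 + (c^2)^2))" by (intro mult_left_mono sq') simp
  finally show ?thesis by simp
qed

lemma integral_D_power4: "(\<integral>x. (D k x)^4 \<partial>M) \<le> Q"
proof -
  have "(\<integral>x. (D k x)^4 \<partial>M) \<le> (\<integral>x. 27 * (K^4 + (H k x)^4 + (H (Suc k) x)^4) \<partial>M)"
  proof (intro integral_mono bm_integrable bm_intros bm_M)
    fix x assume "x \<in> space M"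
    then have "\<bar>X k x\<bar>^4 \<le> K^4" by (intro power_mono X_bound) auto
    then show "(D k x)^4 \<le> 27 * (K^4 + (H k x)^4 + (H (Suc k) x)^4)"
      using power4_add3[of "X k x" "H k x" "H (Suc k) x"] unfolding D_def by simp
  qed
  also have "\<dots> = 27 * (K^4 + (\<integral>x. (H k x)^4 \<partial>M) + (\<integral>x. (H (Suc k) x)^4 \<partial>M))"
    by (simp add: bm_integrable bm_intros bm_M prob_space)
  also have "\<dots> \<le> Q" using integral_H_power4_le[of k] integral_H_power4_le[of "Suc k"] unfolding Q_def by simp
  finally show ?thesis .
qed

lemma L2_le_L4:
  fixes f :: "'a \<Rightarrow> real"
  assumes f: "bdd_meas M f" and 4: "(\<integral>x. (f x)^4 \<partial>M) \<le> Q"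
  shows "(\<integral>x. (f x)^2 \<partial>M) \<le> sqrt Q"
proof -
  have "(\<integral>x. (f x)^2 \<partial>M) = (\<integral>x. \<bar>(f x)^2\<bar> * \<bar>1\<bar> \<partial>M)" by simp
  also have "\<dots> \<le> sqrt (\<integral>x. ((f x)^2)^2 \<partial>M) * sqrt (\<integral>x. 1^2 \<partial>M)"
    by (intro bm_Cauchy_Schwarz bm_intros f)
  also have "\<dots> \<le> sqrt Q" using 4 by (simp add: prob_space)
  finally show ?thesis .
qed

lemmas integral_H_square_le = L2_le_L4[OF bm_M(3) integral_H_power4]

lemma s2_le: "s2 k \<le> sqrt Q" unfolding s2_def by (rule L2_le_L4[OF bm_M(4) integral_D_power4])

lemma s2_nonneg: "s2 k \<ge> 0" unfolding s2_def by simp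

text \<open>Cauchy-Schwarz in the form needed for increments of exponentials: when \<open>g\<close>
  is dominated by a multiple of some \<open>D j\<close>, the bound contains the factor
  \<open>s j\<close> in place of a constant.\<close>

lemma norm_integral_mult_le:
  fixes g :: "'a \<Rightarrow> complex" and f d :: "'a \<Rightarrow> real"
  assumes g: "bdd_meas M g" "\<And>x. x \<in> space M \<Longrightarrow> norm (g x) \<le> c * \<bar>d x\<bar>" "c \<ge> 0"
    and d: "bdd_meas M d" and f: "bdd_meas M f"
  shows "norm (\<integral>x. g x * of_real (f x) \<partial>M) \<le> c * (sqrt (\<integral>x. (d x)^2 \<partial>M) * sqrt (\<integral>x. (f x)^2 \<partial>M))"
proof -
  have "norm (\<integral>x. g x * of_real (f x) \<partial>M) \<le> (\<integral>x. norm (g x * of_real (f x)) \<partial>M)"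
    by (rule integral_norm_bound)
  also have "\<dots> \<le> (\<integral>x. c * (\<bar>d x\<bar> * \<bar>f x\<bar>) \<partial>M)"
  proof (intro integral_mono bm_integrable bm_intros g(1) d f)
    fix x assume "x \<in> space M"
    from mult_right_mono[OF g(2)[OF this], of "\<bar>f x\<bar>"]
    show "norm (g x * of_real (f x)) \<le> c * (\<bar>d x\<bar> * \<bar>f x\<bar>)" by (simp add: norm_mult mult.assoc)
  qed
  also have "\<dots> = c * (\<integral>x. \<bar>d x\<bar> * \<bar>f x\<bar> \<partial>M)" by simp
  also have "\<dots> \<le> c * (sqrt (\<integral>x. (d x)^2 \<partial>M) * sqrt (\<integral>x. (f x)^2 \<partial>M))"
    by (intro mult_left_mono bm_Cauchy_Schwarz d f g(3))
  finally show ?thesis .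
qed

lemma norm_integral_le_L2:
  fixes g :: "'a \<Rightarrow> complex" and d :: "'a \<Rightarrow> real"
  assumes g: "bdd_meas M g" "\<And>x. x \<in> space M \<Longrightarrow> norm (g x) \<le> c * \<bar>d x\<bar>" "c \<ge> 0"
    and d: "bdd_meas M d"
  shows "norm (\<integral>x. g x \<partial>M) \<le> c * sqrt (\<integral>x. (d x)^2 \<partial>M)"
  using norm_integral_mult_le[OF assms bm_const[of M 1]] by (simp add: prob_space)

text \<open>A test function measurable for \<open>F (Suc k)\<close> is also measurable for
  \<open>F k\<close>, so both \<open>G i k\<close> and \<open>G i (Suc k)\<close> may be replaced by
  \<open>X i\<close> under the integral; then \<open>X k\<close> and the two sums cancel.\<close>

lemma D_orthogonal:
  fixes g :: "'a \<Rightarrow> complex"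
  assumes g: "bdd_meas (F (Suc k)) g"
  shows "(\<integral>x. g x * of_real (D k x) \<partial>M) = 0"
proof -
  have gk: "bdd_meas (F k) g" by (rule bm_le[OF _ g]) simp
  note gM = bm_of_F[OF g]
  have int: "integrable M (\<lambda>x. g x * of_real (X k x))" "\<And>i j. integrable M (\<lambda>x. g x * of_real (G i j x))"
    by (intro bm_integrable bm_intros bm_M gM)+
  have "(\<integral>x. g x * of_real (D k x) \<partial>M) = (\<integral>x. g x * of_real (X k x) +
      (\<Sum>i<k. g x * of_real (G i k x)) - (\<Sum>i<Suc k. g x * of_real (G i (Suc k) x)) \<partial>M)"
    unfolding D_def H_def by (simp add: algebra_simps sum_distrib_left)
  also have "\<dots> = (\<integral>x. g x * of_real (X k x) \<partial>M) + (\<Sum>i<k. \<integral>x. g x * of_real (G i k x) \<partial>M)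
      - (\<Sum>i<Suc k. \<integral>x. g x * of_real (G i (Suc k) x) \<partial>M)"
    using int by (subst Bochner_Integration.integral_diff Bochner_Integration.integral_add
        Bochner_Integration.integral_sum; auto simp del: sum.lessThan_Suc)+
  also have "\<dots> = 0" by (simp add: integral_G[OF g] integral_G[OF gk])
  finally show ?thesis .
qed

text \<open>Squaring D k + H (Suc k) = X k + H k isolates the square of \<open>D k\<close>. The
  mixed term with \<open>H (Suc k)\<close> vanishes by orthogonality, and X k * H k becomes a sum of
  products of observables because g * X k is measurable for \<open>F k\<close>.\<close>

lemma integral_D_square:
  fixes g :: "'a \<Rightarrow> complex"
  assumes g: "bdd_meas (F (Suc k)) g"
  shows "(\<integral>x. g x * of_real ((D k x)^2) \<partial>M) = (\<integral>x. g x * of_real (X k x * X k x) \<partial>M)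
      + 2 * (\<Sum>i<k. \<integral>x. g x * of_real (X i x * X k x) \<partial>M)
      + (\<integral>x. g x * of_real ((H k x)^2) \<partial>M) - (\<integral>x. g x * of_real ((H (Suc k) x)^2) \<partial>M)"
proof -
  have lincomb: "(\<integral>x. a x + 2 * (\<Sum>i<k. b i x) + c x - d x - 2 * e x \<partial>M) =
      (\<integral>x. a x \<partial>M) + 2 * (\<Sum>i<k. \<integral>x. b i x \<partial>M) + (\<integral>x. c x \<partial>M) - (\<integral>x. d x \<partial>M) - 2 * (\<integral>x. e x \<partial>M)"
    if "integrable M a" "\<And>i. integrable M (b i)" "integrable M c" "integrable M d" "integrable M e"
    for a c d e :: "'a \<Rightarrow> complex" and b
    using that by simp
  have gk: "bdd_meas (F k) g" by (rule bm_le[OF _ g]) simp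
  note gM = bm_of_F[OF g]
  have i1: "integrable M (\<lambda>x. g x * of_real (X k x * X k x))"
    and i2: "\<And>i. integrable M (\<lambda>x. (g x * of_real (X k x)) * of_real (G i k x))"
    and i3: "\<And>k. integrable M (\<lambda>x. g x * of_real ((H k x)^2))"
    and i4: "integrable M (\<lambda>x. (g x * of_real (H (Suc k) x)) * of_real (D k x))"
    by (intro bm_integrable bm_intros bm_M gM)+
  have "(\<integral>x. g x * of_real ((D k x)^2) \<partial>M) = (\<integral>x. g x * of_real (X k x * X k x)
      + 2 * (\<Sum>i<k. (g x * of_real (X k x)) * of_real (G i k x))
      + g x * of_real ((H k x)^2) - g x * of_real ((H (Suc k) x)^2)
      - 2 * ((g x * of_real (H (Suc k) x)) * of_real (D k x)) \<partial>M)"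
  proof (rule bochner_cong[OF refl])
    fix x
    have e1: "(\<Sum>i<k. (g x * of_real (X k x)) * of_real (G i k x)) = g x * of_real (X k x * H k x)"
      unfolding H_def by (simp add: sum_distrib_left algebra_simps)
    have e2: "(D k x)^2 = X k x * X k x + 2 * (X k x * H k x) + (H k x)^2 - (H (Suc k) x)^2
        - 2 * (H (Suc k) x * D k x)"
      unfolding D_def by (simp add: power2_eq_square algebra_simps)
    show "g x * of_real ((D k x)^2) = g x * of_real (X k x * X k x)
      + 2 * (\<Sum>i<k. (g x * of_real (X k x)) * of_real (G i k x))
      + g x * of_real ((H k x)^2) - g x * of_real ((H (Suc k) x)^2)
      - 2 * ((g x * of_real (H (Suc k) x)) * of_real (D k x))"
      unfolding e1 e2 by (simp add: algebra_simps)
  qed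
  also have "\<dots> = (\<integral>x. g x * of_real (X k x * X k x) \<partial>M)
      + 2 * (\<Sum>i<k. \<integral>x. (g x * of_real (X k x)) * of_real (G i k x) \<partial>M)
      + (\<integral>x. g x * of_real ((H k x)^2) \<partial>M) - (\<integral>x. g x * of_real ((H (Suc k) x)^2) \<partial>M)
      - 2 * (\<integral>x. (g x * of_real (H (Suc k) x)) * of_real (D k x) \<partial>M)"
    by (rule lincomb) (use i1 i2 i3 i4 in auto)
  also have "(\<integral>x. (g x * of_real (H (Suc k) x)) * of_real (D k x) \<partial>M) = 0"
    by (intro D_orthogonal bm_intros g bm_H)
  also have "(\<Sum>i<k. \<integral>x. (g x * of_real (X k x)) * of_real (G i k x) \<partial>M) =
      (\<Sum>i<k. \<integral>x. g x * of_real (X i x * X k x) \<partial>M)"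
    by (subst integral_G) (auto intro!: bm_intros gk bm_X simp: ac_simps)
  finally show ?thesis by simp
qed

text \<open>The expansion of the second moment is used for \<open>g\<close> and for the constant 1,
  and the two are combined linearly.\<close>

lemma cov_D_square:
  assumes g: "bdd_meas (F (Suc k)) g"
  shows "cov g (\<lambda>x. (D k x)^2) = cov g (XX k k) + 2 * (\<Sum>i<k. cov g (XX i k))
      + cov g (\<lambda>x. (H k x)^2) - cov g (\<lambda>x. (H (Suc k) x)^2)"
proof -
  have r: "(\<integral>x. 1 * complex_of_real (f x) \<partial>M) = of_real (\<integral>x. f x \<partial>M)" for f by simp
  show ?thesis
    unfolding cov_def integral_D_square[OF g]
      integral_D_square[OF bm_const[of _ 1], unfolded r]
    by (simp add: algebra_simps sum_distrib_left sum_distrib_right sum_subtractf)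
qed

lemma cov_one: "cov (\<lambda>x. 1) f = 0"
  unfolding cov_def by (simp add: prob_space)

lemma cov_diff:
  assumes "bdd_meas M g" "bdd_meas M h" "bdd_meas M f"
  shows "cov (\<lambda>x. g x - h x) f = cov g f - cov h f"
proof -
  have "integrable M (\<lambda>x. g x * of_real (f x))" "integrable M (\<lambda>x. h x * of_real (f x))"
    "integrable M g" "integrable M h"
    by (intro bm_integrable bm_intros assms)+
  then show ?thesis unfolding cov_def by (simp add: algebra_simps)
qed

definition s :: "nat \<Rightarrow> real" where "s k = sqrt (s2 k)"

lemma s_nonneg: "s k \<ge> 0" unfolding s_def using s2_nonneg by simp

text \<open>As \<open>g\<close> is measurable for \<open>F j\<close>, the centred product may be
  replaced by its conditional expectation \<open>V i k j\<close>, whose L^2 norm decays in the gap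
  from k to j.\<close>

lemma cov_bound_late:
  assumes g: "bdd_meas (F j) g" "\<And>x. x \<in> space M \<Longrightarrow> norm (g x) \<le> c * \<bar>D j x\<bar>" "c \<ge> 0"
    and ik: "i \<le> k" "k < j"
  shows "norm (cov g (XX i k)) \<le> c * s j * (2 * K * \<eta> (j - k) ^ 2)"
proof -
  have "cov g (XX i k) = (\<integral>x. g x * of_real (Xc i k x) \<partial>M)"
  proof -
    have "integrable M (\<lambda>x. g x * of_real (X i x * X k x))" "integrable M g"
      by (intro bm_integrable bm_intros bm_M bm_of_F[OF g(1)])+
    then show ?thesis unfolding cov_def Xc_def by (simp add: right_diff_distrib)
  qed
  also have "\<dots> = (\<integral>x. g x * of_real (V i k j x) \<partial>M)" by (rule integral_V[OF g(1) ik(1), symmetric])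
  finally have "norm (cov g (XX i k)) \<le> c * (s j * sqrt (\<integral>x. (V i k j x)^2 \<partial>M))"
    using norm_integral_mult_le[OF bm_of_F[OF g(1)] g(2,3) bm_M(4) bm_M(5)] unfolding s_def s2_def by simp
  also have "\<dots> \<le> c * (s j * sqrt (4 * K^2 * \<eta> (j - k) ^ 4))"
    by (intro mult_left_mono real_sqrt_le_mono integral_V_square ik s_nonneg g(3))
  also have "4 * K^2 * \<eta> (j - k) ^ 4 = (2 * K * \<eta> (j - k) ^ 2)^2"
    by (simp add: power_mult_distrib)
  also have "sqrt ((2 * K * \<eta> (j - k) ^ 2)^2) = 2 * K * \<eta> (j - k) ^ 2"
    by (subst real_sqrt_abs) (use K_nonneg in simp)
  finally show ?thesis by (simp only: mult.assoc)
qed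

text \<open>As k < j, the product g * X k is measurable for \<open>F k\<close>, and
  \<open>X i\<close> may be replaced by \<open>G i k\<close>, which is small in the gap from i to k.
  The integral of the product and the product of the integrals are each small, so centring is not
  exploited here.\<close>

lemma cov_bound_early:
  assumes g: "bdd_meas (F j) g" "\<And>x. x \<in> space M \<Longrightarrow> norm (g x) \<le> c * \<bar>D j x\<bar>" "c \<ge> 0"
    and ik: "i < k" "k < j"
  shows "norm (cov g (XX i k)) \<le> c * s j * (4 * K^2 * \<eta> (k - i) ^ 2)"
proof -
  note gM = bm_of_F[OF g(1)]
  have Gs: "sqrt (\<integral>x. (G i k x)^2 \<partial>M) \<le> 2 * K * \<eta> (k - i) ^ 2"
  proof -
    have "(\<integral>x. (G i k x)^2 \<partial>M) \<le> 2 * K * \<eta> (k - i) ^ 4" by (rule integral_G_square[OF ik(1)])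
    \<comment> \<open>K \<ge> 1 allows the constant to be enlarged to a perfect square, so that the
      root can be taken exactly.\<close>
    also have "\<dots> \<le> (2 * K)^2 * \<eta> (k - i) ^ 4"
      using K_ge_1 by (intro mult_right_mono) (auto simp: power2_eq_square)
    also have "\<dots> = (2 * K * \<eta> (k - i) ^ 2)^2" by (simp add: power_mult_distrib)
    finally have "sqrt (\<integral>x. (G i k x)^2 \<partial>M) \<le> sqrt ((2 * K * \<eta> (k - i) ^ 2)^2)" by (rule real_sqrt_le_mono)
    then show ?thesis using K_nonneg by (simp add: less_imp_le eta_pos)
  qed
  have gX: "bdd_meas (F k) (\<lambda>x. g x * of_real (X k x))"
    using ik by (intro bm_intros bm_X bm_le[OF _ g(1)]) auto
  have "(\<integral>x. g x * of_real (X i x * X k x) \<partial>M) = (\<integral>x. (g x * of_real (X k x)) * of_real (G i k x) \<partial>M)"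
    by (subst integral_G[OF gX]) (simp add: ac_simps)
  also have "norm \<dots> \<le> (c * K) * (sqrt (\<integral>x. (D j x)^2 \<partial>M) * sqrt (\<integral>x. (G i k x)^2 \<partial>M))"
  proof (rule norm_integral_mult_le)
    fix x assume x: "x \<in> space M"
    have "norm (g x) * \<bar>X k x\<bar> \<le> (c * \<bar>D j x\<bar>) * K"
      using g(2)[OF x] g(3) X_bound[OF x] by (intro mult_mono) auto
    then show "norm (g x * of_real (X k x)) \<le> c * K * \<bar>D j x\<bar>" by (simp add: norm_mult ac_simps)
  qed (use g K_nonneg in \<open>auto intro!: bm_intros bm_M bm_of_F[OF gX]\<close>)
  also have "\<dots> \<le> (c * K) * (s j * (2 * K * \<eta> (k - i) ^ 2))"
    unfolding s_def s2_def using Gs g(3) K_nonneg by (intro mult_left_mono) auto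
  finally have 1: "norm (\<integral>x. g x * of_real (X i x * X k x) \<partial>M) \<le> c * s j * (2 * K^2 * \<eta> (k - i) ^ 2)"
    by (simp add: power2_eq_square ac_simps)
  have "norm (\<integral>x. g x \<partial>M) \<le> c * s j"
    using norm_integral_le_L2[OF gM g(2,3) bm_M(4)] unfolding s_def s2_def by simp
  moreover have "\<bar>\<integral>x. X i x * X k x \<partial>M\<bar> \<le> K * (2 * K * \<eta> (k - i) ^ 2)"
  proof -
    have "of_real (\<integral>x. X i x * X k x \<partial>M) = (\<integral>x. complex_of_real (X k x) * of_real (X i x) \<partial>M)"
      by (simp add: mult.commute flip: integral_complex_of_real)
    also have "\<dots> = (\<integral>x. complex_of_real (X k x) * of_real (G i k x) \<partial>M)"
      by (rule integral_G[symmetric]) (intro bm_intros bm_X)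
    also have "norm \<dots> \<le> K * (sqrt (\<integral>x. 1^2 \<partial>M) * sqrt (\<integral>x. (G i k x)^2 \<partial>M))"
      using X_bound K_nonneg by (intro norm_integral_mult_le) (auto intro!: bm_intros bm_M)
    also have "\<dots> \<le> K * (2 * K * \<eta> (k - i) ^ 2)" using Gs K_nonneg by (simp add: prob_space mult_left_mono)
    finally show ?thesis by (simp del: of_real_mult)
  qed
  ultimately have 2: "norm ((\<integral>x. g x \<partial>M) * of_real (\<integral>x. X i x * X k x \<partial>M)) \<le> (c * s j) * (K * (2 * K * \<eta> (k - i) ^ 2))"
    unfolding norm_mult norm_of_real using s_nonneg g(3) by (intro mult_mono) auto
  have "norm (cov g (XX i k)) \<le> norm (\<integral>x. g x * of_real (X i x * X k x) \<partial>M)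
      + norm ((\<integral>x. g x \<partial>M) * of_real (\<integral>x. X i x * X k x \<partial>M))"
    unfolding cov_def by (rule norm_triangle_ineq4)
  with 1 2 show ?thesis by (simp add: power2_eq_square algebra_simps)
qed

text \<open>The geometric mean of the two preceding bounds is summable separately over the gaps \<open>j - k\<close> and \<open>k - i\<close>.\<close>
lemma cov_bound:
  assumes g: "bdd_meas (F j) g" "\<And>x. x \<in> space M \<Longrightarrow> norm (g x) \<le> c * \<bar>D j x\<bar>" "c \<ge> 0"
    and ik: "i \<le> k" "k < j"
  shows "norm (cov g (XX i k)) \<le> c * s j * (4 * K^2 * (\<eta> (j - k) * \<eta> (k - i)))"
proof -
  define B where "B = norm (cov g (XX i k))"
  define A where "A = c * s j * (4 * K^2)"
  have A0: "A \<ge> 0" unfolding A_def using g(3) s_nonneg by simp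
  have "c * s j * (2 * K * \<eta> (j - k) ^ 2) \<le> c * s j * (4 * K^2 * \<eta> (j - k) ^ 2)"
    using K_ge_1 g(3) s_nonneg[of j] by (intro mult_left_mono mult_right_mono) (auto simp: power2_eq_square)
  from order_trans[OF cov_bound_late[OF assms] this] have 1: "B \<le> A * \<eta> (j - k) ^ 2"
    unfolding B_def A_def by (simp only: mult.assoc)
  have 2: "B \<le> A * \<eta> (k - i) ^ 2"
  proof (cases "i < k")
    case True
    from cov_bound_early[OF g this ik(2)] show ?thesis unfolding B_def A_def by (simp only: mult.assoc)
  next
    case False
    \<comment> \<open>Here i = k, so the second gap is 0 and the late bound suffices because \<eta>
      is decreasing.\<close>
    with ik have "k - i \<le> j - k" by simp
    then have "\<eta> (j - k) \<le> \<eta> (k - i)" using eta_decseq by (simp add: decseq_def)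
    then have "A * \<eta> (j - k) ^ 2 \<le> A * \<eta> (k - i) ^ 2"
      using A0 eta_pos[of "j - k"] by (intro mult_left_mono power_mono) auto
    with 1 show ?thesis by simp
  qed
  have "B * B \<le> (A * \<eta> (j - k) ^ 2) * (A * \<eta> (k - i) ^ 2)"
    using 1 2 A0 unfolding B_def by (intro mult_mono) auto
  then have "B^2 \<le> (A * (\<eta> (j - k) * \<eta> (k - i)))^2" by (simp add: power2_eq_square ac_simps)
  then have "B \<le> A * (\<eta> (j - k) * \<eta> (k - i))"
    by (rule power2_le_imp_le) (use A0 eta_pos in \<open>simp add: less_imp_le\<close>)
  then show ?thesis unfolding B_def A_def by (simp only: mult.assoc)
qed

section \<open>Characteristic function of the martingale sum\<close>

definition e :: "real \<Rightarrow> nat \<Rightarrow> nat \<Rightarrow> 'a \<Rightarrow> complex" where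
  "e t n k x = iexp (t * (\<Sum>j\<in>{k..<n}. D j x))"

text \<open>The reciprocal of the characteristic function of a centred normal law with the variance
  of the tail sum. Its product with the mean of \<open>e t n k\<close> equals 1 at k = n and is
  shown to stay close to 1 down to k = 0.\<close>

definition w :: "real \<Rightarrow> nat \<Rightarrow> nat \<Rightarrow> real" where
  "w t n k = exp (t^2 / 2 * (\<Sum>j\<in>{k..<n}. s2 j))"

text \<open>This is the reason for taking tails: \<open>F k\<close> contains the algebras of all
  later \<open>D j\<close>.\<close>

lemma bm_e: "bdd_meas (F k) (e t n k)"
  unfolding e_def by (intro bm_intros bm_le[OF _ bm_D]) simp

lemma bm_eM: "bdd_meas M (e t n k)" by (rule bm_of_F[OF bm_e])

lemma norm_e: "norm (e t n k x) = 1" unfolding e_def by simp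

lemma e_self: "e t n n = (\<lambda>x. 1)" unfolding e_def by simp

lemma e_step: "k < n \<Longrightarrow> e t n k x = e t n (Suc k) x * iexp (t * D k x)"
  unfolding e_def by (simp add: sum.atLeast_Suc_lessThan distrib_left exp_add[symmetric] add.commute)

lemma w_step: "k < n \<Longrightarrow> w t n (Suc k) = w t n k * exp (- (t^2 / 2 * s2 k))"
  unfolding w_def by (simp add: sum.atLeast_Suc_lessThan exp_add[symmetric] algebra_simps)

lemma w_pos: "w t n k > 0" unfolding w_def by simp

lemma w_le: "w t n k \<le> w t n 0"
  unfolding w_def exp_le_cancel_iff
  by (intro mult_left_mono sum_mono2) (auto simp: s2_nonneg)

lemma norm_e_diff:
  assumes "k < n"
  shows "norm (e t n k x - e t n (Suc k) x) \<le> \<bar>t\<bar> * \<bar>D k x\<bar>"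
proof -
  have "e t n k x - e t n (Suc k) x = e t n (Suc k) x * (iexp (t * D k x) - 1)"
    using e_step[OF assms] by (simp add: algebra_simps)
  then have "norm (e t n k x - e t n (Suc k) x) = norm (iexp (t * D k x) - 1)"
    by (simp add: norm_mult norm_e)
  also have "\<dots> \<le> \<bar>t * D k x\<bar>" using iexp_approx1[of "t * D k x" 0] by simp
  finally show ?thesis by (simp add: abs_mult)
qed

text \<open>Splitting the cube as |D k| times its square keeps one factor \<open>s k\<close>, which
  is what makes the sum over k smaller than n.\<close>

lemma integral_abs_D_cube: "(\<integral>x. \<bar>D k x\<bar> ^ 3 \<partial>M) \<le> sqrt Q * s k"
proof -
  have "(\<integral>x. \<bar>D k x\<bar> ^ 3 \<partial>M) = (\<integral>x. \<bar>D k x\<bar> * \<bar>(D k x)^2\<bar> \<partial>M)"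
    by (intro bochner_cong) (simp_all add: power3_eq_cube power2_eq_square ac_simps)
  also have "\<dots> \<le> sqrt (\<integral>x. (D k x)^2 \<partial>M) * sqrt (\<integral>x. ((D k x)^2)^2 \<partial>M)"
    by (intro bm_Cauchy_Schwarz bm_intros bm_M)
  also have "\<dots> \<le> s k * sqrt Q"
    using integral_D_power4[of k] s_nonneg unfolding s_def s2_def by (intro mult_left_mono) auto
  finally show ?thesis by (simp add: mult.commute)
qed

lemma exp_minus_taylor:
  fixes v :: real assumes "v \<ge> 0"
  shows "\<bar>exp (- v) - (1 - v)\<bar> \<le> v^2"
proof -
  have 1: "exp (- v) \<ge> 1 - v" using exp_ge_add_one_self[of "- v"] by simp
  have "exp v \<ge> 1 + v" by (rule exp_ge_add_one_self)
  then have "exp (- v) \<le> 1 / (1 + v)" using assms by (simp add: exp_minus field_simps)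
  also have "\<dots> \<le> 1 - v + v^2"
  proof -
    have "1 \<le> (1 - v + v^2) * (1 + v)" using assms by (simp add: power2_eq_square algebra_simps)
    then show ?thesis using assms by (simp add: divide_simps)
  qed
  finally show ?thesis using 1 by simp
qed

text \<open>Second order expansion of iexp (t * D k). The linear term vanishes by orthogonality, and
  the mean t^2 / 2 * s2 k of the quadratic term is cancelled by the ratio of the weights. What
  remains is the covariance, a cubic remainder and the Taylor error of that ratio.\<close>

lemma char_step:
  assumes "k < n"
  shows "norm (w t n k * (\<integral>x. e t n k x \<partial>M) - w t n (Suc k) * (\<integral>x. e t n (Suc k) x \<partial>M)
      + w t n k * (t^2 / 2) * cov (e t n (Suc k)) (\<lambda>x. (D k x)^2))
    \<le> w t n k * (sqrt Q * (\<bar>t\<bar>^3 * s k + t^4 * s2 k))"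
proof -
  let ?e = "e t n (Suc k)" and ?E = "\<integral>x. e t n (Suc k) x \<partial>M"
  define R where "R u = iexp u - (1 + \<i> * of_real u - of_real (u^2) / 2)" for u :: real
  define v where "v = t^2 / 2 * s2 k"
  define r where "r = exp (- v) - (1 - v)"
  have v0: "v \<ge> 0" unfolding v_def using s2_nonneg by simp
  have R: "norm (R u) \<le> \<bar>u\<bar>^3" for u
  proof -
    have "norm (R u) = norm (iexp u - (\<Sum>k\<le>2. (\<i> * u)^k / fact k))"
      unfolding R_def by (simp add: numeral_2_eq_2 power2_eq_square algebra_simps)
    also have "\<dots> \<le> \<bar>u\<bar>^3 / 6" using iexp_approx1[of u 2] by (simp add: numeral_3_eq_3 numeral_2_eq_2)
    finally show ?thesis using norm_ge_zero[of "R u"] by linarith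
  qed
  have bR: "bdd_meas M (\<lambda>x. ?e x * R (t * D k x))"
    unfolding R_def divide_inverse by (intro bm_intros bm_eM bm_M)
  have eq: "(\<integral>x. e t n k x \<partial>M) = ?E + \<i> * t * (\<integral>x. ?e x * of_real (D k x) \<partial>M)
      - of_real (t^2 / 2) * (\<integral>x. ?e x * of_real ((D k x)^2) \<partial>M) + (\<integral>x. ?e x * R (t * D k x) \<partial>M)"
  proof -
    have i: "integrable M ?e" "integrable M (\<lambda>x. ?e x * of_real (D k x))"
      "integrable M (\<lambda>x. ?e x * of_real ((D k x)^2))" "integrable M (\<lambda>x. ?e x * R (t * D k x))"
      by (intro bm_integrable bm_intros bm_eM bm_M bR)+
    have lincomb: "(\<integral>x. a x + \<i> * t * b x - of_real (t^2 / 2) * c x + d x \<partial>M) =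
      (\<integral>x. a x \<partial>M) + \<i> * t * (\<integral>x. b x \<partial>M) - of_real (t^2 / 2) * (\<integral>x. c x \<partial>M) + (\<integral>x. d x \<partial>M)"
      if "integrable M a" "integrable M b" "integrable M c" "integrable M d" for a b c d :: "'a \<Rightarrow> complex"
      using that by simp
    have "e t n k x = ?e x + \<i> * t * (?e x * of_real (D k x)) - of_real (t^2 / 2) * (?e x * of_real ((D k x)^2))
        + ?e x * R (t * D k x)" for x
      unfolding e_step[OF assms] R_def by (simp add: algebra_simps power_mult_distrib)
    then show ?thesis using lincomb[OF i] by simp
  qed
  have D0: "(\<integral>x. ?e x * of_real (D k x) \<partial>M) = 0" by (rule D_orthogonal[OF bm_e])
  have E1: "norm ?E \<le> 1"
  proof -
    have "norm ?E \<le> (\<integral>x. norm (?e x) \<partial>M)" by (rule integral_norm_bound)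
    then show ?thesis by (simp add: norm_e prob_space)
  qed
  have RE: "norm (\<integral>x. ?e x * R (t * D k x) \<partial>M) \<le> \<bar>t\<bar>^3 * (sqrt Q * s k)"
  proof -
    have "norm (\<integral>x. ?e x * R (t * D k x) \<partial>M) \<le> (\<integral>x. norm (?e x * R (t * D k x)) \<partial>M)"
      by (rule integral_norm_bound)
    also have "\<dots> \<le> (\<integral>x. \<bar>t\<bar>^3 * \<bar>D k x\<bar>^3 \<partial>M)"
      using R[of "t * D k _"]
      by (intro integral_mono bm_integrable bm_norm bR bm_intros bm_M)
         (simp add: norm_mult norm_e abs_mult power_mult_distrib)
    also have "\<dots> = \<bar>t\<bar>^3 * (\<integral>x. \<bar>D k x\<bar>^3 \<partial>M)" by simp
    also have "\<dots> \<le> \<bar>t\<bar>^3 * (sqrt Q * s k)" by (intro mult_left_mono integral_abs_D_cube) simp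
    finally show ?thesis .
  qed
  have rb: "\<bar>r\<bar> \<le> t^4 * (sqrt Q * s2 k)"
  proof -
    have "\<bar>r\<bar> \<le> v^2" unfolding r_def by (rule exp_minus_taylor[OF v0])
    also have "\<dots> = t^4 / 4 * (s2 k * s2 k)" unfolding v_def by (simp add: power2_eq_square power4_eq_xxxx)
    also have "\<dots> \<le> t^4 / 4 * (sqrt Q * s2 k)"
      by (intro mult_left_mono mult_right_mono s2_le s2_nonneg) simp
    also have "\<dots> \<le> t^4 * (sqrt Q * s2 k)" using s2_nonneg[of k] Q_ge_1 by (intro mult_right_mono) auto
    finally show ?thesis .
  qed
  have main: "w t n k * (\<integral>x. e t n k x \<partial>M) - w t n (Suc k) * ?E
      + w t n k * (t^2 / 2) * cov ?e (\<lambda>x. (D k x)^2)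
    = w t n k * ((\<integral>x. ?e x * R (t * D k x) \<partial>M) - r * ?E)"
  proof -
    have "w t n (Suc k) = w t n k * (1 - v + r)" unfolding r_def v_def w_step[OF assms] by simp
    then have ws: "complex_of_real (w t n (Suc k)) = w t n k * (1 - v + r)" by simp
    show ?thesis unfolding ws eq D0 cov_def s2_def[symmetric] unfolding v_def by (simp add: algebra_simps)
  qed
  have "norm (w t n k * ((\<integral>x. ?e x * R (t * D k x) \<partial>M) - r * ?E)) \<le> w t n k * (norm (\<integral>x. ?e x * R (t * D k x) \<partial>M) + \<bar>r\<bar> * norm ?E)"
    unfolding norm_mult using w_pos[of t n k]
    by (simp add: order_trans[OF norm_triangle_ineq4] norm_mult)
  also have "\<dots> \<le> w t n k * (\<bar>t\<bar>^3 * (sqrt Q * s k) + t^4 * (sqrt Q * s2 k) * 1)"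
  proof (rule mult_left_mono[OF add_mono[OF RE mult_mono[OF rb E1]]])
    show "0 \<le> t^4 * (sqrt Q * s2 k)" using rb by linarith
  qed (simp_all add: less_imp_le[OF w_pos])
  also have "\<bar>t\<bar>^3 * (sqrt Q * s k) + t^4 * (sqrt Q * s2 k) * 1 = sqrt Q * (\<bar>t\<bar>^3 * s k + t^4 * s2 k)"
    by (simp only: distrib_left mult_1_right mult.left_commute)
  finally show ?thesis unfolding main .
qed

text \<open>\<open>e t n (Suc k)\<close> is telescoped into the increments at the times j > k,
  ending with \<open>e t n n\<close>, the constant 1, which has covariance 0. Each increment is
  dominated by |t| |D j|, as \<open>cov_bound\<close> requires.\<close>

lemma cov_e_XX:
  assumes "i \<le> k" "Suc k \<le> n"
  shows "norm (cov (e t n (Suc k)) (XX i k))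
      \<le> (\<Sum>j\<in>{Suc k..<n}. \<bar>t\<bar> * s j * (4 * K^2 * (\<eta> (j - k) * \<eta> (k - i))))"
proof -
  have "norm (cov (e t n m) (XX i k))
      \<le> (\<Sum>j\<in>{m..<n}. \<bar>t\<bar> * s j * (4 * K^2 * (\<eta> (j - k) * \<eta> (k - i))))"
    if "m \<le> n" "k < m" for m
    using that
  proof (induction m rule: inc_induct)
    case base then show ?case by (simp add: e_self cov_one)
  next
    case (step m)
    have "cov (\<lambda>x. e t n m x - e t n (Suc m) x) (XX i k)
        = cov (e t n m) (XX i k) - cov (e t n (Suc m)) (XX i k)"
      by (intro cov_diff bm_eM bm_intros bm_M)
    then have "norm (cov (e t n m) (XX i k)) \<le>
        norm (cov (\<lambda>x. e t n m x - e t n (Suc m) x) (XX i k))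
        + norm (cov (e t n (Suc m)) (XX i k))"
      by (simp only: add.commute norm_triangle_sub)
    also have "norm (cov (\<lambda>x. e t n m x - e t n (Suc m) x) (XX i k))
        \<le> \<bar>t\<bar> * s m * (4 * K^2 * (\<eta> (m - k) * \<eta> (k - i)))"
    proof (rule cov_bound)
      show "bdd_meas (F m) (\<lambda>x. e t n m x - e t n (Suc m) x)"
        by (rule bm_diff[OF bm_e bm_le[OF _ bm_e]]) simp
    qed (use step assms norm_e_diff in auto)
    also have "norm (cov (e t n (Suc m)) (XX i k))
        \<le> (\<Sum>j\<in>{Suc m..<n}. \<bar>t\<bar> * s j * (4 * K^2 * (\<eta> (j - k) * \<eta> (k - i))))"
      using step by simp
    finally show ?case using step by (simp add: sum.atLeast_Suc_lessThan[of m n])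
  qed
  from this[of "Suc k"] assms show ?thesis by simp
qed

text \<open>Summation over i and, after exchanging the order, over k costs a factor \<Lambda> each;
  only the sum of the \<open>s j\<close> is left.\<close>

lemma sum_cov_e_XX:
  "(\<Sum>k<n. norm (cov (e t n (Suc k)) (XX k k) + 2 * (\<Sum>i<k. cov (e t n (Suc k)) (XX i k))))
    \<le> 8 * K^2 * \<Lambda>^2 * \<bar>t\<bar> * (\<Sum>k<n. s k)"
proof -
  let ?c = "\<lambda>i k. norm (cov (e t n (Suc k)) (XX i k))"
  have "norm (cov (e t n (Suc k)) (XX k k) + 2 * (\<Sum>i<k. cov (e t n (Suc k)) (XX i k)))
     \<le> (\<Sum>j\<in>{Suc k..<n}. 8 * K^2 * \<Lambda> * \<bar>t\<bar> * (s j * \<eta> (j - k)))" if "k < n" for k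
  proof -
    have "norm (cov (e t n (Suc k)) (XX k k) + 2 * (\<Sum>i<k. cov (e t n (Suc k)) (XX i k)))
      \<le> ?c k k + 2 * (\<Sum>i<k. ?c i k)"
      by (intro order_trans[OF norm_triangle_ineq] add_mono) (auto simp: norm_mult intro!: norm_sum)
    also have "\<dots> \<le> 2 * (\<Sum>i\<le>k. ?c i k)" by (simp add: lessThan_Suc_atMost[symmetric])
    also have "\<dots> \<le> 2 * (\<Sum>i\<le>k. \<Sum>j\<in>{Suc k..<n}. \<bar>t\<bar> * s j * (4 * K^2 * (\<eta> (j - k) * \<eta> (k - i))))"
      using that by (intro mult_left_mono sum_mono cov_e_XX) auto
    also have "\<dots> = (\<Sum>j\<in>{Suc k..<n}. 8 * K^2 * (\<Sum>i\<le>k. \<eta> (k - i)) * \<bar>t\<bar> * (s j * \<eta> (j - k)))"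
    proof -
      have "(\<Sum>i\<le>k. \<bar>t\<bar> * s j * (4 * K^2 * (\<eta> (j - k) * \<eta> (k - i))))
          = \<bar>t\<bar> * s j * (4 * K^2 * (\<eta> (j - k) * (\<Sum>i\<le>k. \<eta> (k - i))))" for j
        by (simp only: sum_distrib_left)
      then show ?thesis
        by (subst sum.swap) (simp add: sum_distrib_left[of 2] ac_simps)
    qed
    also have "\<dots> \<le> (\<Sum>j\<in>{Suc k..<n}. 8 * K^2 * \<Lambda> * \<bar>t\<bar> * (s j * \<eta> (j - k)))"
    proof -
      have "(\<Sum>i\<le>k. \<eta> (k - i)) \<le> \<Lambda>" by (rule sum_eta_le) (auto simp: inj_on_def)
      then show ?thesis
        by (intro sum_mono mult_right_mono mult_left_mono) (auto simp: s_nonneg less_imp_le eta_pos)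
    qed
    finally show ?thesis .
  qed
  then have "(\<Sum>k<n. norm (cov (e t n (Suc k)) (XX k k) + 2 * (\<Sum>i<k. cov (e t n (Suc k)) (XX i k))))
    \<le> (\<Sum>k<n. \<Sum>j\<in>{Suc k..<n}. 8 * K^2 * \<Lambda> * \<bar>t\<bar> * (s j * \<eta> (j - k)))"
    by (intro sum_mono) auto
  also have "\<dots> = (\<Sum>k<n. \<Sum>j\<in>{j\<in>{..<n}. k < j}. 8 * K^2 * \<Lambda> * \<bar>t\<bar> * (s j * \<eta> (j - k)))"
    by (intro sum.cong) auto
  also have "\<dots> = (\<Sum>j<n. \<Sum>k\<in>{k\<in>{..<n}. k < j}. 8 * K^2 * \<Lambda> * \<bar>t\<bar> * (s j * \<eta> (j - k)))"
    by (rule sum.swap_restrict) auto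
  also have "\<dots> = (\<Sum>j<n. 8 * K^2 * \<Lambda> * \<bar>t\<bar> * (s j * (\<Sum>k\<in>{k\<in>{..<n}. k < j}. \<eta> (j - k))))"
    by (simp add: sum_distrib_left)
  also have "\<dots> \<le> (\<Sum>j<n. 8 * K^2 * \<Lambda> * \<bar>t\<bar> * (s j * \<Lambda>))"
    by (intro sum_mono mult_left_mono sum_eta_le) (auto simp: inj_on_def s_nonneg Lambda_nonneg)
  also have "\<dots> = 8 * K^2 * \<Lambda>^2 * \<bar>t\<bar> * (\<Sum>k<n. s k)"
    by (simp add: sum_distrib_left power2_eq_square algebra_simps)
  finally show ?thesis .
qed

lemma H_0: "H 0 = (\<lambda>x. 0)" unfolding H_def by simp

text \<open>Here \<open>b\<close> is the L^2 norm of \<open>d\<close>. The bound serves twice: with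
  d = D k for an increment of \<open>e\<close>, and with d = 1 for \<open>e\<close> itself.\<close>

lemma norm_cov_le:
  assumes g: "bdd_meas M g" "\<And>x. x \<in> space M \<Longrightarrow> norm (g x) \<le> c * \<bar>d x\<bar>" "c \<ge> 0"
    and d: "bdd_meas M d" "(\<integral>x. (d x)^2 \<partial>M) = b^2" "b \<ge> 0"
  shows "norm (cov g (\<lambda>x. (H k x)^2)) \<le> 2 * sqrt Q * c * b"
proof -
  have b: "sqrt (\<integral>x. (d x)^2 \<partial>M) = b" using d by simp
  have "norm (\<integral>x. g x * of_real ((H k x)^2) \<partial>M) \<le> c * (b * sqrt (\<integral>x. ((H k x)^2)^2 \<partial>M))"
    using norm_integral_mult_le[OF g d(1), of "\<lambda>x. (H k x)^2"] unfolding b by (simp add: bm_intros bm_M)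
  also have "\<dots> \<le> c * (b * sqrt Q)"
    using integral_H_power4[of k] g(3) d(3) by (intro mult_left_mono) auto
  finally have 1: "norm (\<integral>x. g x * of_real ((H k x)^2) \<partial>M) \<le> c * (b * sqrt Q)" .
  have "norm ((\<integral>x. g x \<partial>M) * of_real (\<integral>x. (H k x)^2 \<partial>M)) \<le> (c * b) * sqrt Q"
    unfolding norm_mult norm_of_real using norm_integral_le_L2[OF g d(1)] integral_H_square_le[of k] g(3) d(3)
    unfolding b by (intro mult_mono) auto
  with 1 have "norm (\<integral>x. g x * of_real ((H k x)^2) \<partial>M) + norm ((\<integral>x. g x \<partial>M) * of_real (\<integral>x. (H k x)^2 \<partial>M))
      \<le> 2 * sqrt Q * c * b" by (simp add: ac_simps)
  then show ?thesis unfolding cov_def by (rule order_trans[OF norm_triangle_ineq4])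
qed

text \<open>Bounded one by one, these differences would add up to order n. Summation by parts moves
  the difference from the squares of \<open>H\<close> to \<open>e\<close> and \<open>w\<close>,
  whose increments are of order \<open>s k\<close> and \<open>s2 k\<close>. Both boundary terms
  vanish, since \<open>H 0\<close> is 0 and \<open>e t n n\<close> is 1.\<close>

lemma sum_cov_e_HH:
  "norm (\<Sum>k<n. w t n k * (cov (e t n (Suc k)) (\<lambda>x. (H k x)^2) - cov (e t n (Suc k)) (\<lambda>x. (H (Suc k) x)^2)))
    \<le> w t n 0 * (2 * sqrt Q * (\<bar>t\<bar> * (\<Sum>k<n. s k) + t^2 * (\<Sum>k<n. s2 k)))"
proof -
  define c where "c m k = cov (e t n m) (\<lambda>x. (H k x)^2)" for m k
  define B where "B k = w t n k * c k k" for k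
  \<comment> \<open>What the increment of \<open>B\<close> contains besides the wanted term: first
    the change of \<open>e\<close>, then the change of \<open>w\<close>.\<close>
  define r where "r k = w t n k * (c k k - c (Suc k) k) + (w t n k - w t n (Suc k)) * c (Suc k) (Suc k)" for k
  have "(\<Sum>k<n. w t n k * (c (Suc k) k - c (Suc k) (Suc k))) = (\<Sum>k<n. (B k - B (Suc k)) - r k)"
    unfolding B_def r_def by (intro sum.cong) (auto simp: algebra_simps)
  also have "\<dots> = B 0 - B n - (\<Sum>k<n. r k)"
    by (subst sum_subtractf) (simp only: sum_lessThan_telescope')
  also have "B 0 = 0" unfolding B_def c_def H_0 cov_def by simp
  also have "B n = 0" unfolding B_def c_def e_self cov_one by simp
  finally have "norm (\<Sum>k<n. w t n k * (c (Suc k) k - c (Suc k) (Suc k))) = norm (\<Sum>k<n. r k)" by simp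
  also have "\<dots> \<le> (\<Sum>k<n. w t n 0 * (2 * sqrt Q * (\<bar>t\<bar> * s k + t^2 * s2 k)))"
  proof (rule sum_norm_le)
    fix k assume "k \<in> {..<n}"
    then have k: "k < n" by simp
    have "c k k - c (Suc k) k = cov (\<lambda>x. e t n k x - e t n (Suc k) x) (\<lambda>x. (H k x)^2)"
      unfolding c_def by (intro cov_diff[symmetric] bm_eM bm_intros bm_M)
    also have "norm \<dots> \<le> 2 * sqrt Q * \<bar>t\<bar> * s k"
      by (rule norm_cov_le[OF _ norm_e_diff[OF k]])
        (auto intro!: bm_diff bm_eM bm_M s_nonneg simp: s_def s2_nonneg simp flip: s2_def)
    finally have 1: "norm (c k k - c (Suc k) k) \<le> 2 * sqrt Q * \<bar>t\<bar> * s k" .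
    have 2: "norm (c (Suc k) (Suc k)) \<le> 2 * sqrt Q * 1 * 1" unfolding c_def
      by (rule norm_cov_le[where d="\<lambda>x. 1"]) (auto simp: norm_e prob_space intro!: bm_eM bm_intros)
    have v: "\<bar>w t n k - w t n (Suc k)\<bar> \<le> w t n k * (t^2 * s2 k)"
    proof -
      let ?v = "t^2 / 2 * s2 k"
      have v0: "?v \<ge> 0" using s2_nonneg[of k] by simp
      have "\<bar>1 - exp (- ?v)\<bar> \<le> t^2 * s2 k"
        using exp_ge_add_one_self[of "- ?v"] v0 exp_le_one_iff[of "- ?v"] by (simp add: abs_if)
      moreover have "w t n k - w t n (Suc k) = w t n k * (1 - exp (- ?v))"
        unfolding w_step[OF k] by (simp add: algebra_simps)
      ultimately show ?thesis using w_pos[of t n k] by (simp add: abs_mult)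
    qed
    have "norm (r k) \<le> w t n k * norm (c k k - c (Suc k) k) + \<bar>w t n k - w t n (Suc k)\<bar> * norm (c (Suc k) (Suc k))"
      unfolding r_def using w_pos[of t n k]
      by (intro order_trans[OF norm_triangle_ineq]) (simp add: norm_mult flip: of_real_diff)
    also have "\<dots> \<le> w t n k * (2 * sqrt Q * \<bar>t\<bar> * s k) + (w t n k * (t^2 * s2 k)) * (2 * sqrt Q * 1 * 1)"
      using 1 2 v w_pos[of t n k] by (intro add_mono mult_mono mult_left_mono) (auto simp: s2_nonneg)
    also have "\<dots> = w t n k * (2 * sqrt Q * (\<bar>t\<bar> * s k + t^2 * s2 k))" by (simp add: algebra_simps)
    also have "\<dots> \<le> w t n 0 * (2 * sqrt Q * (\<bar>t\<bar> * s k + t^2 * s2 k))"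
      using Q_ge_1 by (intro mult_right_mono w_le) (auto simp: s2_nonneg s_nonneg)
    finally show "norm (r k) \<le> w t n 0 * (2 * sqrt Q * (\<bar>t\<bar> * s k + t^2 * s2 k))" .
  qed
  also have "\<dots> = w t n 0 * (2 * sqrt Q * (\<bar>t\<bar> * (\<Sum>k<n. s k) + t^2 * (\<Sum>k<n. s2 k)))"
    by (simp only: sum_distrib_left[symmetric] sum.distrib)
  finally show ?thesis unfolding c_def .
qed

definition C where "C = 8 * K^2 * \<Lambda>^2 + 2 * sqrt Q"

lemma char_bound:
  "norm (w t n 0 * (\<integral>x. e t n 0 x \<partial>M) - 1) \<le> w t n 0 * (C * (\<bar>t\<bar>^3 * (\<Sum>k<n. s k) + t^4 * (\<Sum>k<n. s2 k)))"
proof -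
  define E where "E k = w t n k * (\<integral>x. e t n k x \<partial>M)" for k
  define cD where "cD k = w t n k * cov (e t n (Suc k)) (\<lambda>x. (D k x)^2)" for k
  define cX where "cX k = cov (e t n (Suc k)) (XX k k)
      + 2 * (\<Sum>i<k. cov (e t n (Suc k)) (XX i k))" for k
  define cH where "cH k = cov (e t n (Suc k)) (\<lambda>x. (H k x)^2) - cov (e t n (Suc k)) (\<lambda>x. (H (Suc k) x)^2)" for k
  define S where "S = (\<Sum>k<n. s k)"
  define S2 where "S2 = (\<Sum>k<n. s2 k)"
  have S0: "S \<ge> 0" "S2 \<ge> 0" unfolding S_def S2_def by (auto intro!: sum_nonneg s_nonneg s2_nonneg)
  let ?W = "w t n 0"
  have W0: "?W > 0" by (rule w_pos)
  have En: "E n = 1" unfolding E_def w_def e_self by (simp add: prob_space)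
  \<comment> \<open>Telescoping from E n = 1. The covariance terms are added inside the sum and
    taken out again, so that \<open>char_step\<close> bounds each summand.\<close>
  have E0: "E 0 - 1 = (\<Sum>k<n. (E k - E (Suc k) + of_real (t^2 / 2) * cD k)) - of_real (t^2 / 2) * (\<Sum>k<n. cD k)"
    by (simp only: sum.distrib sum_lessThan_telescope' En sum_distrib_left[symmetric]) simp
  have 1: "norm (\<Sum>k<n. (E k - E (Suc k) + of_real (t^2 / 2) * cD k)) \<le> ?W * (sqrt Q * (\<bar>t\<bar>^3 * S + t^4 * S2))"
  proof -
    have "norm (\<Sum>k<n. (E k - E (Suc k) + of_real (t^2 / 2) * cD k))
        \<le> (\<Sum>k<n. ?W * (sqrt Q * (\<bar>t\<bar>^3 * s k + t^4 * s2 k)))"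
    proof (rule sum_norm_le)
      fix k assume "k \<in> {..<n}"
      then have "norm (E k - E (Suc k) + of_real (t^2 / 2) * cD k) \<le> w t n k * (sqrt Q * (\<bar>t\<bar>^3 * s k + t^4 * s2 k))"
        using char_step[of k n t] unfolding E_def cD_def by (simp add: algebra_simps)
      also have "\<dots> \<le> ?W * (sqrt Q * (\<bar>t\<bar>^3 * s k + t^4 * s2 k))"
        using Q_ge_1 by (intro mult_right_mono w_le) (auto simp: s2_nonneg s_nonneg)
      finally show "norm (E k - E (Suc k) + of_real (t^2 / 2) * cD k) \<le> ?W * (sqrt Q * (\<bar>t\<bar>^3 * s k + t^4 * s2 k))" .
    qed
    then show ?thesis unfolding S_def S2_def by (simp only: sum_distrib_left[symmetric] sum.distrib)
  qed
  have "cD k = w t n k * cX k + w t n k * cH k" for k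
    unfolding cD_def cX_def cH_def cov_D_square[OF bm_e] by (simp add: algebra_simps)
  then have "(\<Sum>k<n. cD k) = (\<Sum>k<n. w t n k * cX k) + (\<Sum>k<n. w t n k * cH k)" by (simp add: sum.distrib)
  also have "norm \<dots> \<le> ?W * (8 * K^2 * \<Lambda>^2 * \<bar>t\<bar> * S) + ?W * (2 * sqrt Q * (\<bar>t\<bar> * S + t^2 * S2))"
  proof (intro norm_triangle_le add_mono)
    have "norm (\<Sum>k<n. w t n k * cX k) \<le> (\<Sum>k<n. ?W * norm (cX k))"
    proof (rule sum_norm_le)
      fix k
      show "norm (w t n k * cX k) \<le> ?W * norm (cX k)"
        unfolding norm_mult norm_of_real abs_of_pos[OF w_pos] by (intro mult_right_mono w_le) simp
    qed
    also have "\<dots> \<le> ?W * (8 * K^2 * \<Lambda>^2 * \<bar>t\<bar> * S)"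
      using sum_cov_e_XX[where n=n and t=t] W0 unfolding cX_def S_def by (simp add: sum_distrib_left[symmetric])
    finally show "norm (\<Sum>k<n. w t n k * cX k) \<le> ?W * (8 * K^2 * \<Lambda>^2 * \<bar>t\<bar> * S)" .
    show "norm (\<Sum>k<n. w t n k * cH k) \<le> ?W * (2 * sqrt Q * (\<bar>t\<bar> * S + t^2 * S2))"
      using sum_cov_e_HH[where n=n and t=t] unfolding cH_def S_def S2_def .
  qed
  finally have "norm (of_real (t^2 / 2) * (\<Sum>k<n. cD k)) \<le>
      t^2 / 2 * (?W * (8 * K^2 * \<Lambda>^2 * \<bar>t\<bar> * S) + ?W * (2 * sqrt Q * (\<bar>t\<bar> * S + t^2 * S2)))"
    unfolding norm_mult norm_of_real by (simp add: mult_left_mono)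
  also have "\<dots> = ?W * (4 * K^2 * \<Lambda>^2 * (t^2 * \<bar>t\<bar> * S) + sqrt Q * (t^2 * \<bar>t\<bar> * S + t^4 * S2))"
    by (simp add: algebra_simps power2_eq_square power4_eq_xxxx)
  also have "t^2 * \<bar>t\<bar> = \<bar>t\<bar>^3" by (simp add: power3_eq_cube power2_eq_square abs_if)
  finally have 2: "norm (of_real (t^2 / 2) * (\<Sum>k<n. cD k)) \<le>
      ?W * (4 * K^2 * \<Lambda>^2 * (\<bar>t\<bar>^3 * S) + sqrt Q * (\<bar>t\<bar>^3 * S + t^4 * S2))" .
  have "norm (E 0 - 1) \<le> ?W * (sqrt Q * (\<bar>t\<bar>^3 * S + t^4 * S2)) +
      ?W * (4 * K^2 * \<Lambda>^2 * (\<bar>t\<bar>^3 * S) + sqrt Q * (\<bar>t\<bar>^3 * S + t^4 * S2))"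
    unfolding E0 by (rule order_trans[OF norm_triangle_ineq4 add_mono[OF 1 2]])
  also have "\<dots> = ?W * (4 * K^2 * \<Lambda>^2 * (\<bar>t\<bar>^3 * S) + 2 * sqrt Q * (\<bar>t\<bar>^3 * S + t^4 * S2))"
    by (simp add: algebra_simps)
  also have "\<dots> \<le> ?W * (C * (\<bar>t\<bar>^3 * S + t^4 * S2))"
  proof -
    have "4 * K^2 * \<Lambda>^2 * (\<bar>t\<bar>^3 * S) \<le> 8 * K^2 * \<Lambda>^2 * (\<bar>t\<bar>^3 * S + t^4 * S2)"
      using S0 by (intro mult_mono) auto
    then show ?thesis using W0 unfolding C_def by (intro mult_left_mono) (auto simp: algebra_simps)
  qed
  finally show ?thesis unfolding E_def S_def S2_def .
qed

section \<open>Variance of the sums and the limit law\<close>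

definition S :: "nat \<Rightarrow> 'a \<Rightarrow> real" where "S n x = (\<Sum>k<n. X k x)"

lemma bm_S: "bdd_meas M (S n)"
  unfolding S_def by (intro bm_intros bm_M)

lemma sum_D: "(\<Sum>k<n. D k x) = S n x - H n x"
  by (induction n) (auto simp: S_def H_0 D_def)

lemma D_orthogonal_real:
  fixes g :: "'a \<Rightarrow> real"
  assumes "bdd_meas (F (Suc k)) g"
  shows "(\<integral>x. g x * D k x \<partial>M) = 0"
proof -
  have "complex_of_real (\<integral>x. g x * D k x \<partial>M) = (\<integral>x. of_real (g x) * of_real (D k x) \<partial>M)"
    by (simp flip: integral_complex_of_real)
  also have "\<dots> = 0" by (rule D_orthogonal[OF bm_of_real[OF assms]])
  finally show ?thesis by simp
qed

lemma integral_sum_D_square: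
  assumes "k \<le> n"
  shows "(\<integral>x. (\<Sum>j\<in>{k..<n}. D j x)^2 \<partial>M) = (\<Sum>j\<in>{k..<n}. s2 j)"
  using assms
proof (induction k rule: inc_induct)
  case (step k)
  let ?N = "\<lambda>x. \<Sum>j\<in>{Suc k..<n}. D j x"
  have bN: "bdd_meas (F (Suc k)) ?N"
    by (intro bm_intros bm_le[OF _ bm_D]) simp
  have i: "integrable M (\<lambda>x. (D k x)^2)" "integrable M (\<lambda>x. ?N x * D k x)" "integrable M (\<lambda>x. (?N x)^2)"
    by (intro bm_integrable bm_intros bm_M bm_of_F[OF bN])+
  have "(\<integral>x. (\<Sum>j\<in>{k..<n}. D j x)^2 \<partial>M) = (\<integral>x. (D k x)^2 + 2 * (?N x * D k x) + (?N x)^2 \<partial>M)"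
    using step(2) by (simp add: sum.atLeast_Suc_lessThan power2_sum algebra_simps)
  also have "\<dots> = s2 k + 2 * (\<integral>x. ?N x * D k x \<partial>M) + (\<integral>x. (?N x)^2 \<partial>M)"
    using i unfolding s2_def by simp
  finally show ?case
    using step unfolding D_orthogonal_real[OF bN] by (simp add: sum.atLeast_Suc_lessThan)
qed simp

text \<open>\<open>S n\<close> is the sum of the \<open>D k\<close> plus \<open>H n\<close>, and
  \<open>H n\<close> is measurable for \<open>F n\<close>, hence orthogonal to every
  \<open>D k\<close> with k < n.\<close>

lemma integral_S_square:
  "(\<integral>x. (S n x)^2 \<partial>M) = (\<Sum>k<n. s2 k) + (\<integral>x. (H n x)^2 \<partial>M)"
proof -
  have i: "integrable M (\<lambda>x. (\<Sum>k<n. D k x)^2)" "\<And>k. integrable M (\<lambda>x. H n x * D k x)" "integrable M (\<lambda>x. (H n x)^2)"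
    by (intro bm_integrable bm_intros bm_M)+
  have "(\<integral>x. (S n x)^2 \<partial>M) = (\<integral>x. (\<Sum>k<n. D k x)^2 + 2 * (\<Sum>k<n. H n x * D k x) + (H n x)^2 \<partial>M)"
  proof (intro bochner_cong refl)
    fix x
    have "(\<Sum>k<n. H n x * D k x) = H n x * (S n x - H n x)"
      by (simp only: sum_distrib_left[symmetric] sum_D)
    then show "(S n x)^2 = (\<Sum>k<n. D k x)^2 + 2 * (\<Sum>k<n. H n x * D k x) + (H n x)^2"
      by (simp only: sum_D) (simp add: power2_eq_square algebra_simps)
  qed
  also have "\<dots> = (\<integral>x. (\<Sum>k<n. D k x)^2 \<partial>M) + 2 * (\<Sum>k<n. \<integral>x. H n x * D k x \<partial>M) + (\<integral>x. (H n x)^2 \<partial>M)"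
    using i by simp
  also have "(\<Sum>k<n. \<integral>x. H n x * D k x \<partial>M) = 0"
    by (intro sum.neutral ballI D_orthogonal_real bm_le[OF _ bm_H]) auto
  also have "(\<integral>x. (\<Sum>k<n. D k x)^2 \<partial>M) = (\<Sum>k<n. s2 k)"
    using integral_sum_D_square[of 0 n] by (simp add: atLeast0LessThan)
  finally show ?thesis by simp
qed

lemma sum_s_le:
  assumes "(\<Sum>k<n. s2 k) \<le> \<sigma>^2" "\<sigma> \<ge> 0"
  shows "(\<Sum>k<n. s k) \<le> sqrt n * \<sigma>"
proof -
  have "(\<Sum>k<n. s k)^2 = (\<Sum>k<n. 1 * s k)^2" by simp
  also have "\<dots> \<le> (\<Sum>k<n. 1^2) * (\<Sum>k<n. (s k)^2)" by (rule Cauchy_Schwarz_ineq_sum)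
  also have "\<dots> = real n * (\<Sum>k<n. s2 k)" by (simp add: s_def s2_nonneg)
  also have "\<dots> \<le> real n * \<sigma>^2" using assms by (intro mult_left_mono) auto
  also have "\<dots> = (sqrt n * \<sigma>)^2" by (simp add: power_mult_distrib)
  finally show ?thesis by (rule power2_le_imp_le) (use assms in auto)
qed

definition \<sigma> :: "nat \<Rightarrow> real" where "\<sigma> n = sqrt (\<integral>x. (S n x)^2 \<partial>M)"

lemma sigma_square: "(\<sigma> n)^2 = (\<Sum>k<n. s2 k) + (\<integral>x. (H n x)^2 \<partial>M)"
  unfolding \<sigma>_def integral_S_square[symmetric] by simp

lemma w_bound:
  assumes "\<sigma> n > 0"
  shows "w (t / \<sigma> n) n 0 \<le> exp (t^2 / 2)"
proof -
  have "(\<Sum>k<n. s2 k) \<le> (\<sigma> n)^2" unfolding sigma_square by simp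
  then have "(t / \<sigma> n)^2 / 2 * (\<Sum>k<n. s2 k) \<le> (t / \<sigma> n)^2 / 2 * (\<sigma> n)^2" by (intro mult_left_mono) auto
  also have "\<dots> = t^2 / 2" using assms by (simp add: power_divide)
  finally show ?thesis unfolding w_def by (simp add: atLeast0LessThan)
qed

text \<open>The factor (1 / \<sigma> n)^3 from rescaling meets a sum of \<open>s k\<close> of size
  at most sqrt n * \<sigma> n, which leaves sqrt n / (\<sigma> n)^2.\<close>

lemma char_bound_sigma:
  assumes "\<sigma> n > 0"
  shows "norm (w (t / \<sigma> n) n 0 * (\<integral>x. e (t / \<sigma> n) n 0 x \<partial>M) - 1)
    \<le> exp (t^2 / 2) * (C * (\<bar>t\<bar>^3 * (sqrt n / (\<sigma> n)^2) + t^4 * (1 / (\<sigma> n)^2)))"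
proof -
  let ?t = "t / \<sigma> n"
  have S2: "(\<Sum>k<n. s2 k) \<le> (\<sigma> n)^2" unfolding sigma_square by simp
  have C0: "C \<ge> 0" unfolding C_def using Q_ge_1 by simp
  have a: "\<bar>?t\<bar>^3 * (\<Sum>k<n. s k) \<le> \<bar>t\<bar>^3 * (sqrt n / (\<sigma> n)^2)"
  proof -
    have "\<bar>?t\<bar>^3 * (\<Sum>k<n. s k) \<le> \<bar>?t\<bar>^3 * (sqrt n * \<sigma> n)"
      using assms by (intro mult_left_mono sum_s_le S2) auto
    also have "\<dots> = \<bar>t\<bar>^3 * (sqrt n / (\<sigma> n)^2)"
      using assms by (simp add: abs_divide power_divide power3_eq_cube power2_eq_square)
    finally show ?thesis .
  qed
  have b: "?t^4 * (\<Sum>k<n. s2 k) \<le> t^4 * (1 / (\<sigma> n)^2)"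
  proof -
    have "?t^4 * (\<Sum>k<n. s2 k) \<le> ?t^4 * (\<sigma> n)^2"
      by (intro mult_left_mono S2) simp
    also have "\<dots> = t^4 * (1 / (\<sigma> n)^2)"
      using assms by (simp add: power_divide power4_eq_xxxx power2_eq_square)
    finally show ?thesis .
  qed
  have "norm (w ?t n 0 * (\<integral>x. e ?t n 0 x \<partial>M) - 1) \<le> w ?t n 0 * (C * (\<bar>?t\<bar>^3 * (\<Sum>k<n. s k) + ?t^4 * (\<Sum>k<n. s2 k)))"
    by (rule char_bound)
  also have "\<dots> \<le> exp (t^2 / 2) * (C * (\<bar>t\<bar>^3 * (sqrt n / (\<sigma> n)^2) + t^4 * (1 / (\<sigma> n)^2)))"
    by (rule mult_mono[OF w_bound[OF assms] mult_left_mono[OF add_mono[OF a b] C0]])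
       (auto intro!: mult_nonneg_nonneg add_nonneg_nonneg C0 sum_nonneg s_nonneg s2_nonneg)
  finally show ?thesis .
qed

text \<open>The sum differs from the martingale sum by \<open>H n\<close>, whose L^2 norm is bounded
  uniformly in n.\<close>

lemma char_S_e:
  assumes "\<sigma> n > 0"
  shows "norm ((\<integral>x. iexp (t * (S n x / \<sigma> n)) \<partial>M) - (\<integral>x. e (t / \<sigma> n) n 0 x \<partial>M)) \<le> \<bar>t\<bar> * sqrt (sqrt Q) / \<sigma> n"
proof -
  let ?t = "t / \<sigma> n"
  have b1: "bdd_meas M (\<lambda>x. iexp (t * (S n x / \<sigma> n)))"
    unfolding divide_inverse by (intro bm_intros bm_S)
  have bnd: "norm (iexp (t * (S n x / \<sigma> n)) - e ?t n 0 x) \<le> \<bar>?t\<bar> * \<bar>H n x\<bar>" for x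
  proof -
    have "iexp (t * (S n x / \<sigma> n)) = e ?t n 0 x * iexp (?t * H n x)"
      unfolding e_def atLeast0LessThan sum_D by (simp add: exp_add[symmetric] algebra_simps)
    then have "iexp (t * (S n x / \<sigma> n)) - e ?t n 0 x = e ?t n 0 x * (iexp (?t * H n x) - 1)"
      by (simp add: algebra_simps)
    then have "norm (iexp (t * (S n x / \<sigma> n)) - e ?t n 0 x) = norm (iexp (?t * H n x) - 1)"
      by (simp add: norm_mult norm_e)
    also have "\<dots> \<le> \<bar>?t * H n x\<bar>" using iexp_approx1[of "?t * H n x" 0] by simp
    finally show ?thesis by (simp only: abs_mult)
  qed
  have "(\<integral>x. iexp (t * (S n x / \<sigma> n)) \<partial>M) - (\<integral>x. e ?t n 0 x \<partial>M) = (\<integral>x. iexp (t * (S n x / \<sigma> n)) - e ?t n 0 x \<partial>M)"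
    by (intro Bochner_Integration.integral_diff[symmetric] bm_integrable b1 bm_eM)
  moreover have "norm (\<integral>x. iexp (t * (S n x / \<sigma> n)) - e ?t n 0 x \<partial>M) \<le> \<bar>?t\<bar> * sqrt (\<integral>x. (H n x)^2 \<partial>M)"
    by (intro norm_integral_le_L2 bnd bm_diff b1 bm_eM bm_M) simp
  moreover have "\<bar>?t\<bar> * sqrt (\<integral>x. (H n x)^2 \<partial>M) \<le> \<bar>?t\<bar> * sqrt (sqrt Q)"
    by (intro mult_left_mono real_sqrt_le_mono integral_H_square_le) simp
  ultimately show ?thesis using assms by (simp add: abs_divide)
qed

theorem central_limit:
  assumes growth: "filterlim (\<lambda>n. (\<sigma> n)^2 / sqrt n) at_top sequentially"
  shows "weak_conv_m (\<lambda>n. distr M borel (\<lambda>x. S n x / \<sigma> n)) std_normal_distribution"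
proof (rule levy_continuity)
  have Sm [measurable]: "S n \<in> borel_measurable M" for n using bm_S unfolding bdd_meas_def by simp
  show "real_distribution (distr M borel (\<lambda>x. S n x / \<sigma> n))" for n
    by (rule real_distribution_distr) simp
  show "real_distribution std_normal_distribution" by (rule real_dist_normal_dist)
  fix t :: real
  have s0: "\<sigma> n \<ge> 0" for n unfolding \<sigma>_def by simp
  have ev: "eventually (\<lambda>n. \<sigma> n > 0 \<and> (\<sigma> n)^2 \<ge> sqrt n) sequentially"
    using filterlim_at_top_dense[THEN iffD1, OF growth, rule_format, of 1] eventually_gt_at_top[of 0]
  proof eventually_elim
    case (elim n)
    then have gt: "(\<sigma> n)^2 > sqrt n" by (simp add: less_divide_eq)
    then have "(\<sigma> n)^2 > 0" by (rule le_less_trans[rotated]) simp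
    then have "\<sigma> n \<noteq> 0" by auto
    then show ?case using s0[of n] gt by linarith
  qed
  have q0: "(\<lambda>n. sqrt n / (\<sigma> n)^2) \<longlonglongrightarrow> 0"
    using tendsto_inverse_0_at_top[OF growth] by simp
  have s2_top: "filterlim (\<lambda>n. (\<sigma> n)^2) at_top sequentially"
  proof (rule filterlim_at_top_mono)
    show "filterlim (\<lambda>n. sqrt (real n)) at_top sequentially"
      by (rule filterlim_compose[OF sqrt_at_top filterlim_real_sequentially])
    show "eventually (\<lambda>n. sqrt (real n) \<le> (\<sigma> n)^2) sequentially" using ev by eventually_elim simp
  qed
  have s_top: "filterlim \<sigma> at_top sequentially"
  proof -
    have "filterlim (\<lambda>n. sqrt ((\<sigma> n)^2)) at_top sequentially" by (rule filterlim_compose[OF sqrt_at_top s2_top])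
    then show ?thesis using s0 by simp
  qed
  have q1: "(\<lambda>n. 1 / (\<sigma> n)^2) \<longlonglongrightarrow> 0" using tendsto_inverse_0_at_top[OF s2_top] by (simp add: inverse_eq_divide)
  have q2: "(\<lambda>n. 1 / \<sigma> n) \<longlonglongrightarrow> 0" using tendsto_inverse_0_at_top[OF s_top] by (simp add: inverse_eq_divide)
  define E where "E n = (\<integral>x. e (t / \<sigma> n) n 0 x \<partial>M)" for n
  define W where "W n = w (t / \<sigma> n) n 0" for n
  have WE: "(\<lambda>n. of_real (W n) * E n) \<longlonglongrightarrow> 1"
  proof (rule LIM_zero_cancel, rule Lim_null_comparison)
    show "eventually (\<lambda>n. norm (of_real (W n) * E n - 1) \<le>
      exp (t^2 / 2) * (C * (\<bar>t\<bar>^3 * (sqrt n / (\<sigma> n)^2) + t^4 * (1 / (\<sigma> n)^2)))) sequentially"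
      using ev by eventually_elim (unfold W_def E_def, rule char_bound_sigma, simp)
    show "(\<lambda>n. exp (t^2 / 2) * (C * (\<bar>t\<bar>^3 * (sqrt n / (\<sigma> n)^2) + t^4 * (1 / (\<sigma> n)^2)))) \<longlonglongrightarrow> 0"
      using tendsto_mult_left[OF tendsto_mult_left[OF tendsto_add[OF tendsto_mult_left[OF q0, of "\<bar>t\<bar>^3"]
        tendsto_mult_left[OF q1, of "t^4"]], of C], of "exp (t^2 / 2)"] by simp
  qed
  \<comment> \<open>The variance of the martingale sum is (\<sigma> n)^2 minus the second moment of
    \<open>H n\<close>. The latter is bounded, so the exponent of \<open>W n\<close> tends to t^2 /
    2.\<close>
  have W: "W \<longlonglongrightarrow> exp (t^2 / 2)"
  proof -
    have "(\<lambda>n. (\<integral>x. (H n x)^2 \<partial>M) / (\<sigma> n)^2) \<longlonglongrightarrow> 0"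
    proof (rule Lim_null_comparison)
      show "eventually (\<lambda>n. norm ((\<integral>x. (H n x)^2 \<partial>M) / (\<sigma> n)^2) \<le> sqrt Q * (1 / (\<sigma> n)^2)) sequentially"
        by (rule always_eventually) (auto intro!: divide_right_mono integral_H_square_le)
      show "(\<lambda>n. sqrt Q * (1 / (\<sigma> n)^2)) \<longlonglongrightarrow> 0" using tendsto_mult_left[OF q1, of "sqrt Q"] by simp
    qed
    then have "(\<lambda>n. exp (t^2 / 2 * (1 - (\<integral>x. (H n x)^2 \<partial>M) / (\<sigma> n)^2))) \<longlonglongrightarrow> exp (t^2 / 2 * (1 - 0))"
      by (intro tendsto_intros)
    moreover have "eventually (\<lambda>n. exp (t^2 / 2 * (1 - (\<integral>x. (H n x)^2 \<partial>M) / (\<sigma> n)^2)) = W n) sequentially"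
      using ev
    proof eventually_elim
      case (elim n)
      have s2eq: "(\<Sum>k<n. s2 k) = (\<sigma> n)^2 - (\<integral>x. (H n x)^2 \<partial>M)" using sigma_square[of n] by simp
      show ?case unfolding W_def w_def atLeast0LessThan s2eq using elim by (simp add: field_simps)
    qed
    ultimately show ?thesis by (simp add: tendsto_cong)
  qed
  have "(\<lambda>n. of_real (W n) * E n / of_real (W n)) \<longlonglongrightarrow> 1 / complex_of_real (exp (t^2 / 2))"
    by (intro tendsto_divide WE tendsto_of_real W) simp
  moreover have "of_real (W n) * E n / of_real (W n) = E n" for n
    using w_pos[of "t / \<sigma> n" n 0] unfolding W_def by simp
  ultimately have E: "E \<longlonglongrightarrow> complex_of_real (exp (- (t^2) / 2))"
    by (simp add: exp_minus inverse_eq_divide)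
  have "(\<lambda>n. (\<integral>x. iexp (t * (S n x / \<sigma> n)) \<partial>M) - E n) \<longlonglongrightarrow> 0"
  proof (rule Lim_null_comparison)
    show "eventually (\<lambda>n. norm ((\<integral>x. iexp (t * (S n x / \<sigma> n)) \<partial>M) - E n) \<le> \<bar>t\<bar> * sqrt (sqrt Q) * (1 / \<sigma> n)) sequentially"
      using ev by eventually_elim (use char_S_e[of _ t] in \<open>simp add: E_def\<close>)
    show "(\<lambda>n. \<bar>t\<bar> * sqrt (sqrt Q) * (1 / \<sigma> n)) \<longlonglongrightarrow> 0"
      using tendsto_mult_left[OF q2, of "\<bar>t\<bar> * sqrt (sqrt Q)"] by simp
  qed
  from tendsto_add[OF this E] have "(\<lambda>n. \<integral>x. iexp (t * (S n x / \<sigma> n)) \<partial>M) \<longlonglongrightarrow> complex_of_real (exp (- (t^2) / 2))"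
    by simp
  then show "(\<lambda>n. char (distr M borel (\<lambda>x. S n x / \<sigma> n)) t) \<longlonglongrightarrow> char std_normal_distribution t"
    unfolding char_std_normal_distribution char_def by (subst integral_distr) auto
qed

end

section \<open>Transfer operators of the intermittent maps\<close>

text \<open>The point 0 is left out: densities may blow up there, and the left branch is a bijection
  from {0<..1/2} onto {0<..1}.\<close>

abbreviation U :: "real measure" where "U \<equiv> lebesgue_on {0<..1}"

definition dLSV :: "real \<Rightarrow> real \<Rightarrow> real" where
  "dLSV \<gamma> x = 1 + (1 + \<gamma>) * (2 * x) powr \<gamma>"

definition linv :: "real \<Rightarrow> real \<Rightarrow> real" where
  "linv \<gamma> z = inv_into {0<..1/2} (LSV \<gamma>) z"

section \<open>The two branches and the inverse of the left one\<close>

lemma LSV_left: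
  assumes "0 \<le> x" "x \<le> 1/2"
  shows "LSV \<gamma> x = x * (1 + (2 * x) powr \<gamma>)"
proof (cases "x = 0")
  case False
  then have "x powr (1 + \<gamma>) = x * x powr \<gamma>" using assms by (simp add: powr_add)
  then show ?thesis using assms by (simp add: LSV_def powr_mult algebra_simps)
qed (simp add: LSV_def)

lemma LSV_right: "x > 1/2 \<Longrightarrow> LSV \<gamma> x = 2 * x - 1"
  by (simp add: LSV_def)

lemma two_powr_le_one: "0 \<le> x \<Longrightarrow> x \<le> 1/2 \<Longrightarrow> \<gamma> \<ge> 0 \<Longrightarrow> (2 * x) powr \<gamma> \<le> (1::real)"
  using powr_mono2[of \<gamma> "2 * x" 1] by simp

lemma dLSV_ge: "\<gamma> \<ge> 0 \<Longrightarrow> dLSV \<gamma> x \<ge> 1"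
  unfolding dLSV_def by simp

lemma dLSV_le:
  assumes "0 \<le> x" "x \<le> 1/2" "0 \<le> \<gamma>" "\<gamma> \<le> 1"
  shows "dLSV \<gamma> x \<le> 3"
proof -
  have "(1 + \<gamma>) * (2 * x) powr \<gamma> \<le> 2 * 1"
    using assms two_powr_le_one[of x \<gamma>] by (intro mult_mono) auto
  then show ?thesis unfolding dLSV_def by simp
qed

lemma dLSV_mono:
  assumes "0 \<le> x" "x \<le> y" "0 \<le> \<gamma>"
  shows "dLSV \<gamma> x \<le> dLSV \<gamma> y"
  unfolding dLSV_def using assms by (intro add_mono mult_left_mono powr_mono2) auto

lemma LSV_strict_mono:
  assumes "0 \<le> x" "x < y" "y \<le> 1/2" "\<gamma> > 0"
  shows "LSV \<gamma> x < LSV \<gamma> y"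
proof -
  have "x * (1 + (2 * x) powr \<gamma>) < y * (1 + (2 * y) powr \<gamma>)"
  proof (rule mult_strict_mono')
    show "1 + (2 * x) powr \<gamma> < 1 + (2 * y) powr \<gamma>"
      using assms by (simp add: powr_less_mono2)
  qed (use assms in \<open>auto intro!: add_nonneg_nonneg\<close>)
  then show ?thesis using assms by (simp add: LSV_left)
qed

lemma LSV_left_bounds:
  assumes "0 < x" "x \<le> 1/2" "\<gamma> > 0"
  shows "x < LSV \<gamma> x" "LSV \<gamma> x \<le> 2 * x" "LSV \<gamma> x \<le> 1"
proof -
  have "(2 * x) powr \<gamma> \<le> 1" "(2 * x) powr \<gamma> > 0" using assms two_powr_le_one[of x \<gamma>] by auto
  then have "x * 1 < x * (1 + (2 * x) powr \<gamma>)" "x * (1 + (2 * x) powr \<gamma>) \<le> x * 2"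
    using assms by (intro mult_strict_left_mono mult_left_mono; simp)+
  then show "x < LSV \<gamma> x" and two: "LSV \<gamma> x \<le> 2 * x" using assms by (auto simp: LSV_left)
  show "LSV \<gamma> x \<le> 1" using two assms by linarith
qed

lemma LSV_half: "\<gamma> > 0 \<Longrightarrow> LSV \<gamma> (1/2) = 1"
  by (simp add: LSV_left)

lemma LSV_unit:
  assumes "x \<in> {0<..1}" "\<gamma> > 0"
  shows "LSV \<gamma> x \<in> {0<..1}"
proof (cases "x \<le> 1/2")
  case True
  then show ?thesis using assms LSV_left_bounds[of x \<gamma>] by auto
qed (use assms in \<open>auto simp: LSV_right\<close>)

lemma inj_LSV:
  assumes "\<gamma> > 0"
  shows "inj_on (LSV \<gamma>) {0<..1/2}"
proof (rule linorder_inj_onI')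
  fix x y :: real assume "x \<in> {0<..1/2}" "y \<in> {0<..1/2}" "x < y"
  then show "LSV \<gamma> x \<noteq> LSV \<gamma> y" using LSV_strict_mono[of x y \<gamma>] assms by auto
qed

lemma LSV_image: 
  assumes "\<gamma> > 0"
  shows "LSV \<gamma> ` {0<..1/2} = {0<..1}"
proof
  show "LSV \<gamma> ` {0<..1/2} \<subseteq> {0<..1}"
    using LSV_unit[OF _ assms] by auto
  show "{0<..1} \<subseteq> LSV \<gamma> ` {0<..1/2}"
  proof
    fix z :: real assume z: "z \<in> {0<..1}"
    have "continuous_on {0..1/2} (\<lambda>x. x * (1 + (2 * x) powr \<gamma>))"
      by (intro continuous_on_mult continuous_on_add continuous_on_powr' continuous_on_id continuous_on_const)
        (use assms in auto)
    then have "\<exists>x\<ge>0. x \<le> 1/2 \<and> x * (1 + (2 * x) powr \<gamma>) = z"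
      using z by (intro IVT') auto
    then obtain x where x: "0 \<le> x" "x \<le> 1/2" "x * (1 + (2 * x) powr \<gamma>) = z" by auto
    then have "x \<noteq> 0" using z by auto
    then show "z \<in> LSV \<gamma> ` {0<..1/2}" using x by (intro image_eqI[of _ _ x]) (auto simp: LSV_left)
  qed
qed

lemma linv:
  assumes "\<gamma> > 0" "z \<in> {0<..1}"
  shows "0 < linv \<gamma> z" "linv \<gamma> z \<le> 1/2" "LSV \<gamma> (linv \<gamma> z) = z"
  using assms inv_into_into[of z "LSV \<gamma>" "{0<..1/2}"] f_inv_into_f[of z "LSV \<gamma>" "{0<..1/2}"] LSV_image[of \<gamma>]
  unfolding linv_def by auto

lemma linv_LSV:
  assumes "\<gamma> > 0" "x \<in> {0<..1/2}"
  shows "linv \<gamma> (LSV \<gamma> x) = x"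
  unfolding linv_def by (rule inv_into_f_f[OF inj_LSV assms(2)]) (rule assms)

lemma le_linv_iff:
  assumes "\<gamma> > 0" "z \<in> {0<..1}" "x \<in> {0<..1/2}"
  shows "x \<le> linv \<gamma> z \<longleftrightarrow> LSV \<gamma> x \<le> z"
  using linv[OF assms(1,2)] assms(3) LSV_strict_mono[of x "linv \<gamma> z" \<gamma>] LSV_strict_mono[of "linv \<gamma> z" x \<gamma>] assms(1)
  by (cases x "linv \<gamma> z" rule: linorder_cases) auto

lemma linv_mono:
  assumes "\<gamma> > 0" "0 < z" "z \<le> z'" "z' \<le> 1"
  shows "linv \<gamma> z \<le> linv \<gamma> z'"
  using le_linv_iff[of \<gamma> z' "linv \<gamma> z"] linv[of \<gamma> z] assms by auto

lemma LSV_deriv: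
  assumes "\<gamma> > 0" "x \<in> {0<..1/2}"
  shows "(LSV \<gamma> has_field_derivative dLSV \<gamma> x) (at x within {0<..1/2})"
proof -
  have "((\<lambda>x. x * (1 + (2 * x) powr \<gamma>)) has_field_derivative dLSV \<gamma> x) (at x within {0<..1/2})"
  proof (rule DERIV_subset[of _ _ _ UNIV])
    have "(2 * x) powr \<gamma> = (2 * x) * (2 * x) powr (\<gamma> - 1)"
      using assms by (simp add: powr_mult_base)
    then show "((\<lambda>x. x * (1 + (2 * x) powr \<gamma>)) has_field_derivative dLSV \<gamma> x) (at x)"
      using assms unfolding dLSV_def
      by (auto intro!: derivative_eq_intros simp: algebra_simps)
  qed simp
  then show ?thesis
    by (rule has_field_derivative_transform_within[OF _ zero_less_one assms(2)]) (auto simp: LSV_left)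
qed

section \<open>Measurability, change of variables and duality\<close>

lemma borel_measurable_LSV [measurable]: "LSV \<gamma> \<in> borel_measurable borel"
  unfolding LSV_def by measurable

lemma borel_measurable_compT [measurable]: "compT \<beta> n \<in> borel_measurable borel"
  by (induction n) (auto simp: comp_def id_def)

text \<open>Translates between absolute integrability on a subset, the language of the change of
  variables theorem, and integrals over \<open>U\<close>.\<close>

lemma integrable_subset_iff:
  fixes f :: "real \<Rightarrow> real"
  assumes "S \<in> sets lebesgue" "S \<subseteq> {0<..1}"
  shows "f absolutely_integrable_on S \<longleftrightarrow> integrable U (\<lambda>x. indicator S x * f x)"
    and "f absolutely_integrable_on S \<Longrightarrow> integral S f = (\<integral>x. indicator S x * f x \<partial>U)"
proof -
  have *: "(\<lambda>x. indicator {0<..1} x * (indicator S x * f x)) = (\<lambda>x. indicator S x * f x)"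
    using assms by (auto simp: fun_eq_iff split: split_indicator)
  show "f absolutely_integrable_on S \<longleftrightarrow> integrable U (\<lambda>x. indicator S x * f x)"
    by (subst integrable_restrict_space) (auto simp: set_integrable_def *)
  show "integral S f = (\<integral>x. indicator S x * f x \<partial>U)" if "f absolutely_integrable_on S"
    by (subst integral_restrict_space)
      (auto simp: set_lebesgue_integral_eq_integral(2)[OF that, symmetric] * set_lebesgue_integral_def)
qed

text \<open>Integrability of \<open>h\<close> is a conclusion, so that transferred densities get
  their integrability from the original ones.\<close>

lemma left_change_of_variables:
  fixes h :: "real \<Rightarrow> real"
  assumes "\<gamma> > 0" and i: "integrable U (\<lambda>x. indicator {0<..1/2} x * (dLSV \<gamma> x * h (LSV \<gamma> x)))"
  shows "integrable U h"
    "(\<integral>z. h z \<partial>U) = (\<integral>x. indicator {0<..1/2} x * (dLSV \<gamma> x * h (LSV \<gamma> x)) \<partial>U)"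
proof -
  let ?b = "\<integral>x. indicator {0<..1/2} x * (dLSV \<gamma> x * h (LSV \<gamma> x)) \<partial>U"
  have a: "(\<lambda>x. dLSV \<gamma> x * h (LSV \<gamma> x)) absolutely_integrable_on {0<..1/2}"
    using i by (subst integrable_subset_iff) auto
  have b: "integral {0<..1/2} (\<lambda>x. dLSV \<gamma> x * h (LSV \<gamma> x)) = ?b"
    by (rule integrable_subset_iff(2)[OF _ _ a]) auto
  have abs: "\<bar>dLSV \<gamma> x\<bar> = dLSV \<gamma> x" for x using dLSV_ge[of \<gamma> x] assms by simp
  have "h absolutely_integrable_on {0<..1} \<and> integral {0<..1} h = ?b"
    using has_absolute_integral_change_of_variables_1'[OF _ LSV_deriv[OF assms(1)] inj_LSV[OF assms(1)], of h ?b]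
      a b unfolding abs LSV_image[OF assms(1)] by simp
  then have h: "h absolutely_integrable_on {0<..1}" "integral {0<..1} h = ?b" by auto
  have u: "integrable U (\<lambda>x. indicator {0<..1} x * h x) \<longleftrightarrow> integrable U h"
    "(\<integral>x. indicator {0<..1} x * h x \<partial>U) = (\<integral>x. h x \<partial>U)"
    by (intro Bochner_Integration.integrable_cong bochner_cong; simp)+
  show "integrable U h" using h(1) integrable_subset_iff(1)[of "{0<..1}" h] u by simp
  show "(\<integral>z. h z \<partial>U) = ?b" using h(2) integrable_subset_iff(2)[of "{0<..1}" h, OF _ _ h(1)] u by simp
qed

lemma right_change_of_variables:
  fixes h :: "real \<Rightarrow> real"
  assumes i: "integrable U (\<lambda>x. indicator {1/2<..1} x * (2 * h (2 * x - 1)))"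
  shows "integrable U h"
    "(\<integral>z. h z \<partial>U) = (\<integral>x. indicator {1/2<..1} x * (2 * h (2 * x - 1)) \<partial>U)"
proof -
  let ?b = "\<integral>x. indicator {1/2<..1} x * (2 * h (2 * x - 1)) \<partial>U"
  have a: "(\<lambda>x. 2 * h (2 * x - 1)) absolutely_integrable_on {1/2<..1}"
    using i by (subst integrable_subset_iff) auto
  have b: "integral {1/2<..1} (\<lambda>x. 2 * h (2 * x - 1)) = ?b"
    by (rule integrable_subset_iff(2)[OF _ _ a]) auto
  have im: "(\<lambda>x::real. 2 * x - 1) ` {1/2<..1} = {0<..1}"
  proof (intro equalityI subsetI)
    fix z :: real assume "z \<in> {0<..1}"
    then show "z \<in> (\<lambda>x. 2 * x - 1) ` {1/2<..1}" by (intro image_eqI[of _ _ "(z + 1) / 2"]) (auto simp: field_simps)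
  qed auto
  have "h absolutely_integrable_on {0<..1} \<and> integral {0<..1} h = ?b"
  proof -
    have d: "((\<lambda>x. 2 * x - 1) has_real_derivative 2) (at x within {1/2<..1})" for x :: real
      by (auto intro!: derivative_eq_intros)
    have "inj_on (\<lambda>x::real. 2 * x - 1) {1/2<..1}" by (auto intro: inj_onI)
    from has_absolute_integral_change_of_variables_1'[OF _ d this, of h ?b] a b show ?thesis
      unfolding im by simp
  qed
  then have h: "h absolutely_integrable_on {0<..1}" "integral {0<..1} h = ?b" by auto
  have u: "integrable U (\<lambda>x. indicator {0<..1} x * h x) \<longleftrightarrow> integrable U h"
    "(\<integral>x. indicator {0<..1} x * h x \<partial>U) = (\<integral>x. h x \<partial>U)"
    by (intro Bochner_Integration.integrable_cong bochner_cong; simp)+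
  show "integrable U h" using h(1) integrable_subset_iff(1)[of "{0<..1}" h] u by simp
  show "(\<integral>z. h z \<partial>U) = ?b" using h(2) integrable_subset_iff(2)[of "{0<..1}" h, OF _ _ h(1)] u by simp
qed

text \<open>The summand of the transfer operator that belongs to the left branch. It is kept apart
  in order to follow the mass that never leaves this branch.\<close>

definition ltransfer :: "real \<Rightarrow> (real \<Rightarrow> real) \<Rightarrow> real \<Rightarrow> real" where
  "ltransfer \<gamma> f z = f (linv \<gamma> z) / dLSV \<gamma> (linv \<gamma> z)"

definition transfer :: "real \<Rightarrow> (real \<Rightarrow> real) \<Rightarrow> real \<Rightarrow> real" where
  "transfer \<gamma> f z = ltransfer \<gamma> f z + f ((z + 1) / 2) / 2"

lemma bounded_times_integrable:
  fixes f g :: "real \<Rightarrow> real"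
  assumes "integrable U f" "g \<in> borel_measurable borel" "\<And>x. \<bar>g x\<bar> \<le> c"
  shows "integrable U (\<lambda>x. f x * g x)"
proof -
  have [measurable]: "g \<in> borel_measurable U"
    using assms(2) by (simp add: borel_measurable_if_I measurable_completion measurable_restrict_space1)
  show ?thesis
  proof (rule Bochner_Integration.integrable_bound[of _ "\<lambda>x. c * \<bar>f x\<bar>"])
    show "AE x in U. norm (f x * g x) \<le> norm (c * \<bar>f x\<bar>)"
      using order_trans[OF assms(3) abs_ge_self]
      by (intro AE_I2) (simp add: abs_mult mult.commute[of "\<bar>c\<bar>"] mult_left_mono)
  qed (use assms in auto)
qed

lemma ltransfer_duality:
  assumes "\<gamma> > 0" "integrable U f" and g: "g \<in> borel_measurable borel" "\<And>x. \<bar>g x\<bar> \<le> c"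
  shows "integrable U (\<lambda>z. ltransfer \<gamma> f z * g z)"
    "(\<integral>z. ltransfer \<gamma> f z * g z \<partial>U) = (\<integral>x. f x * (indicator {0<..1/2} x * g (LSV \<gamma> x)) \<partial>U)"
proof -
  let ?h = "\<lambda>z. ltransfer \<gamma> f z * g z"
  have eq: "indicator {0<..1/2} x * (dLSV \<gamma> x * ?h (LSV \<gamma> x)) = f x * (indicator {0<..1/2} x * g (LSV \<gamma> x))" for x
    using linv_LSV[OF assms(1), of x] dLSV_ge[of \<gamma> x] assms(1) by (auto simp: indicator_def ltransfer_def)
  have c0: "c \<ge> 0" using g(2)[of 0] by linarith
  have i: "integrable U (\<lambda>x. f x * (indicator {0<..1/2} x * g (LSV \<gamma> x)))"
    using g c0 by (intro bounded_times_integrable[of _ _ c] assms) (auto simp: indicator_def)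
  show "integrable U ?h" "(\<integral>z. ?h z \<partial>U) = (\<integral>x. f x * (indicator {0<..1/2} x * g (LSV \<gamma> x)) \<partial>U)"
    using left_change_of_variables[OF assms(1), of ?h] i unfolding eq by auto
qed

text \<open>The test functions are Borel on the whole line, so that their composition with
  \<open>LSV\<close> is again admissible and the duality can be iterated.\<close>

lemma transfer_duality:
  assumes "\<gamma> > 0" "integrable U f" and g: "g \<in> borel_measurable borel" "\<And>x. \<bar>g x\<bar> \<le> c"
  shows "integrable U (\<lambda>z. transfer \<gamma> f z * g z)"
    "(\<integral>z. transfer \<gamma> f z * g z \<partial>U) = (\<integral>x. f x * g (LSV \<gamma> x) \<partial>U)"
proof -
  let ?r = "\<lambda>z. f ((z + 1) / 2) / 2 * g z"
  have eq: "indicator {1/2<..1} x * (2 * ?r (2 * x - 1)) = f x * (indicator {1/2<..1} x * g (LSV \<gamma> x))" for x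
    by (auto simp: indicator_def LSV_right)
  have c0: "c \<ge> 0" using g(2)[of 0] by linarith
  have i: "integrable U (\<lambda>x. f x * (indicator {1/2<..1} x * g (LSV \<gamma> x)))"
    using g c0 by (intro bounded_times_integrable[of _ _ c] assms) (auto simp: indicator_def)
  have i': "integrable U (\<lambda>x. f x * (indicator {0<..1/2} x * g (LSV \<gamma> x)))"
    using g c0 by (intro bounded_times_integrable[of _ _ c] assms) (auto simp: indicator_def)
  have r: "integrable U ?r" "(\<integral>z. ?r z \<partial>U) = (\<integral>x. f x * (indicator {1/2<..1} x * g (LSV \<gamma> x)) \<partial>U)"
    using right_change_of_variables[of ?r] i unfolding eq by auto
  note l = ltransfer_duality[OF assms]
  have split: "(\<lambda>z. transfer \<gamma> f z * g z) = (\<lambda>z. ltransfer \<gamma> f z * g z + ?r z)"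
    by (auto simp: transfer_def algebra_simps)
  show "integrable U (\<lambda>z. transfer \<gamma> f z * g z)" unfolding split using l r by simp
  have "(\<integral>z. transfer \<gamma> f z * g z \<partial>U) = (\<integral>x. f x * (indicator {0<..1/2} x * g (LSV \<gamma> x))
      + f x * (indicator {1/2<..1} x * g (LSV \<gamma> x)) \<partial>U)"
    unfolding split using l r i i' by simp
  also have "\<dots> = (\<integral>x. f x * g (LSV \<gamma> x) \<partial>U)"
    by (intro bochner_cong) (auto simp: indicator_def)
  finally show "(\<integral>z. transfer \<gamma> f z * g z \<partial>U) = (\<integral>x. f x * g (LSV \<gamma> x) \<partial>U)" .
qed

lemma one_plus_powr_le:
  fixes u a :: real
  assumes "0 \<le> u" "0 < a" "a \<le> 1"
  shows "(1 + u) powr a \<le> 1 + a * u"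
proof -
  have "((\<lambda>u. 1 + a * u - (1 + u) powr a) has_real_derivative (a - a * (1 + x) powr (a - 1))) (at x)"
    if "0 \<le> x" for x
    using that by (auto intro!: derivative_eq_intros)
  moreover have "a - a * (1 + x) powr (a - 1) \<ge> 0" if "0 \<le> x" for x
  proof -
    have "(1 + x) powr (a - 1) \<le> (1 + x) powr 0" using that assms by (intro powr_mono) auto
    then show ?thesis using assms that by simp
  qed
  ultimately have "1 + a * 0 - (1 + 0) powr a \<le> 1 + a * u - (1 + u) powr a"
    using assms by (intro DERIV_nonneg_imp_nondecreasing[of 0 u "\<lambda>u. 1 + a * u - (1 + u) powr a"]) blast+
  then show ?thesis by simp
qed

text \<open>The factor 1/2 stems from exp (u / 2) \<le> 1 + u on the unit interval, raised to the
  power \<open>a\<close>.\<close>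

lemma one_plus_powr_ge:
  fixes u a :: real
  assumes "0 \<le> u" "u \<le> 1" "0 < a"
  shows "1 + a * u / 2 \<le> (1 + u) powr a"
proof -
  have "exp (u / 2) \<le> 1 + u"
  proof -
    have "exp (u / 2) \<le> 1 + u / 2 + (u / 2)^2" using assms by (intro exp_bound) auto
    also have "\<dots> \<le> 1 + u" using assms mult_left_le[of u u] by (simp add: power2_eq_square)
    finally show ?thesis .
  qed
  then have "u / 2 \<le> ln (1 + u)" by (subst ln_ge_iff) (use assms in auto)
  then have "a * u / 2 \<le> a * ln (1 + u)" using assms by simp
  then have "exp (a * u / 2) \<le> (1 + u) powr a" using assms by (simp add: powr_def)
  then show ?thesis using exp_ge_add_one_self[of "a * u / 2"] by linarith
qed

lemma integrable_U_subset: "integrable U f \<Longrightarrow> S \<in> sets lebesgue \<Longrightarrow> integrable U (\<lambda>x. indicator S x * f x)"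
  for f :: "real \<Rightarrow> real"
  using integrable_real_mult_indicator[of "S \<inter> {0<..1}" U f]
  by (subst Bochner_Integration.integrable_cong[where g="\<lambda>x. f x * indicator (S \<inter> {0<..1}) x"])
    (auto simp: sets_restrict_space indicator_def)

lemma prob_space_U: "prob_space U"
  by (rule prob_spaceI) (simp add: emeasure_restrict_space)

lemma integral_U_interval:
  assumes "0 \<le> a" "a \<le> b" "b \<le> 1"
  shows "integrable U (\<lambda>x. indicator {a<..b} x * (c::real))" "(\<integral>x. indicator {a<..b} x * c \<partial>U) = (b - a) * c"
proof -
  interpret prob_space U by (rule prob_space_U)
  have "integrable U (\<lambda>x. c)" by simp
  then show "integrable U (\<lambda>x. indicator {a<..b} x * c)" by (rule integrable_U_subset) simp
  have s: "{a<..b} \<in> sets U" using assms by (auto simp: sets_restrict_space intro!: image_eqI[of _ _ "{a<..b}"])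
  have "measure U {a<..b} = b - a" using assms by (subst measure_restrict_space) auto
  then show "(\<integral>x. indicator {a<..b} x * c \<partial>U) = (b - a) * c" using s assms by simp
qed

section \<open>Nonincreasing densities\<close>

definition decr :: "(real \<Rightarrow> real) \<Rightarrow> bool" where
  "decr f \<longleftrightarrow> (\<forall>x\<in>{0<..1}. 0 \<le> f x) \<and> (\<forall>x y. 0 < x \<longrightarrow> x \<le> y \<longrightarrow> y \<le> 1 \<longrightarrow> f y \<le> f x)"

lemma decrD:
  assumes "decr f"
  shows "0 < x \<Longrightarrow> x \<le> 1 \<Longrightarrow> 0 \<le> f x" "0 < x \<Longrightarrow> x \<le> y \<Longrightarrow> y \<le> 1 \<Longrightarrow> f y \<le> f x"
  using assms unfolding decr_def by auto

lemma decr_measurable: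
  assumes "decr f"
  shows "f \<in> borel_measurable U"
proof -
  have "mono_on {0<..1} (\<lambda>x. - f x)" using decrD[OF assms] by (auto intro!: mono_onI)
  then have "(\<lambda>x. - f x) \<in> borel_measurable (restrict_space borel {0<..1})"
    by (rule borel_measurable_mono_on_fnc)
  then have "(\<lambda>x. indicator {0<..1} x *\<^sub>R (- f x)) \<in> borel_measurable borel"
    by (subst (asm) borel_measurable_restrict_space_iff) auto
  then have "(\<lambda>x. indicator {0<..1} x *\<^sub>R (- f x)) \<in> borel_measurable lebesgue"
    by (simp add: measurable_completion)
  then have "(\<lambda>x. - f x) \<in> borel_measurable U"
    by (subst borel_measurable_restrict_space_iff) auto
  then show ?thesis using borel_measurable_uminus[of "\<lambda>x. - f x" U] by simp
qed

definition mass :: "(real \<Rightarrow> real) \<Rightarrow> real" where "mass f = (\<integral>x. f x \<partial>U)"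

lemma decr_value_le_mass:
  assumes "decr f" "integrable U f" "0 < z" "z \<le> 1"
  shows "f z * z \<le> mass f"
proof -
  have "f z * z = (\<integral>x. indicator {0<..z} x * f z \<partial>U)" by (subst integral_U_interval(2)) (use assms in auto)
  also have "\<dots> \<le> mass f" unfolding mass_def
    using assms decrD[OF assms(1)]
    by (intro integral_mono integral_U_interval) (auto simp: indicator_def)
  finally show ?thesis .
qed

text \<open>Read from right to left: mass to the right of \<open>z\<close> forces a large value at
  \<open>z\<close>.\<close>

lemma decr_tail_le:
  assumes "decr f" "integrable U f" "0 < z" "z \<le> 1"
  shows "(\<integral>x. f x * indicator {z<..1} x \<partial>U) \<le> f z"
proof -
  have "(\<integral>x. f x * indicator {z<..1} x \<partial>U) \<le> (\<integral>x. indicator {z<..1} x * f z \<partial>U)"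
    using assms decrD[OF assms(1)] integrable_U_subset[OF assms(2), of "{z<..1}"]
    by (intro integral_mono integral_U_interval) (auto simp: indicator_def mult.commute)
  also have "\<dots> = (1 - z) * f z" using assms by (subst integral_U_interval) auto
  also have "\<dots> \<le> f z" using assms decrD(1)[OF assms(1)] by (simp add: mult_left_le_one_le)
  finally show ?thesis .
qed

text \<open>The inverse branch and the derivative of the left branch are both nondecreasing, so the
  numerator falls while the denominator grows.\<close>

lemma decr_ltransfer:
  assumes "decr f" "0 < \<gamma>"
  shows "decr (ltransfer \<gamma> f)"
  unfolding decr_def
proof (intro conjI ballI allI impI)
  fix x :: real assume "x \<in> {0<..1}"
  then show "0 \<le> ltransfer \<gamma> f x" unfolding ltransfer_def
    using linv[OF assms(2), of x] decrD(1)[OF assms(1)] dLSV_ge[of \<gamma> "linv \<gamma> x"] assms(2)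
    by (intro divide_nonneg_nonneg) auto
next
  fix x y :: real assume xy: "0 < x" "x \<le> y" "y \<le> 1"
  then have l: "0 < linv \<gamma> x" "linv \<gamma> x \<le> linv \<gamma> y" "linv \<gamma> y \<le> 1/2"
    using linv[OF assms(2)] linv_mono[OF assms(2)] by auto
  show "ltransfer \<gamma> f y \<le> ltransfer \<gamma> f x" unfolding ltransfer_def
  proof (rule frac_le)
    show "f (linv \<gamma> y) \<le> f (linv \<gamma> x)" using decrD(2)[OF assms(1)] l by auto
    show "dLSV \<gamma> (linv \<gamma> x) \<le> dLSV \<gamma> (linv \<gamma> y)" using l assms by (intro dLSV_mono) auto
    show "0 < dLSV \<gamma> (linv \<gamma> x)" using dLSV_ge[of \<gamma> "linv \<gamma> x"] assms by simp
    show "0 \<le> f (linv \<gamma> x)" using l by (intro decrD[OF assms(1)]) auto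
  qed
qed

lemma decr_transfer:
  assumes "decr f" "0 < \<gamma>"
  shows "decr (transfer \<gamma> f)"
proof -
  have "decr (\<lambda>z. f ((z + 1) / 2) / 2)"
    unfolding decr_def using decrD[OF assms(1)] by (auto intro!: divide_right_mono)
  with decr_ltransfer[OF assms] show ?thesis
    unfolding decr_def transfer_def by (auto intro!: add_mono add_nonneg_nonneg)
qed

lemma ltransfer_mono:
  assumes "0 < \<gamma>" "\<And>x. 0 < x \<Longrightarrow> x \<le> 1 \<Longrightarrow> f x \<le> g x" "0 < z" "z \<le> 1"
  shows "ltransfer \<gamma> f z \<le> ltransfer \<gamma> g z"
  unfolding ltransfer_def using linv[OF assms(1), of z] dLSV_ge[of \<gamma> "linv \<gamma> z"] assms
  by (intro divide_right_mono) auto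

lemma ltransfer_lincomb: "ltransfer \<gamma> (\<lambda>x. a * f x + b * g x) z = a * ltransfer \<gamma> f z + b * ltransfer \<gamma> g z"
  unfolding ltransfer_def by (simp add: add_divide_distrib)

lemma transfer_lincomb: "transfer \<gamma> (\<lambda>x. a * f x + b * g x) z = a * transfer \<gamma> f z + b * transfer \<gamma> g z"
  unfolding transfer_def ltransfer_lincomb by (simp add: algebra_simps add_divide_distrib)

fun transfers :: "(nat \<Rightarrow> real) \<Rightarrow> nat \<Rightarrow> (real \<Rightarrow> real) \<Rightarrow> real \<Rightarrow> real" where
  "transfers \<beta> 0 f = f"
| "transfers \<beta> (Suc n) f = transfer (\<beta> (Suc n)) (transfers \<beta> n f)"

fun ltransfers :: "(nat \<Rightarrow> real) \<Rightarrow> nat \<Rightarrow> (real \<Rightarrow> real) \<Rightarrow> real \<Rightarrow> real" where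
  "ltransfers \<beta> 0 f = f"
| "ltransfers \<beta> (Suc n) f = ltransfer (\<beta> (Suc n)) (ltransfers \<beta> n f)"

text \<open>Pulls \<open>b\<close> back along the left branches, the last map first. The points that
  use the left branch in all n steps and end in {0<..b} form {0<..lpoint \<beta> n b}.\<close>

fun lpoint :: "(nat \<Rightarrow> real) \<Rightarrow> nat \<Rightarrow> real \<Rightarrow> real" where
  "lpoint \<beta> 0 b = b"
| "lpoint \<beta> (Suc n) b = lpoint \<beta> n (linv (\<beta> (Suc n)) b)"

lemma transfers_lincomb: "transfers \<beta> n (\<lambda>x. a * f x + b * g x) = (\<lambda>x. a * transfers \<beta> n f x + b * transfers \<beta> n g x)"
  by (induction n) (auto simp: transfer_lincomb)

lemma transfers_add: "transfers \<beta> (k + n) f = transfers (\<lambda>i. \<beta> (k + i)) n (transfers \<beta> k f)"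
  by (induction n) auto

lemma compT_add: "compT \<beta> (k + n) x = compT (\<lambda>i. \<beta> (k + i)) n (compT \<beta> k x)"
  by (induction n) auto

text \<open>The maps are numbered from 1, so only positive indices are constrained. The class is
  closed under shifts, which lets every estimate be restarted at a later time.\<close>

locale lsv_sequence =
  fixes \<alpha> :: real and \<beta> :: "nat \<Rightarrow> real"
  assumes alpha: "0 < \<alpha>" "\<alpha> < 1"
    and beta: "\<And>k. 0 < k \<Longrightarrow> 0 < \<beta> k \<and> \<beta> k \<le> \<alpha>"
begin

lemma beta_Suc: "0 < \<beta> (Suc n)" "\<beta> (Suc n) \<le> \<alpha>" using beta by auto

lemma shift: "lsv_sequence \<alpha> (\<lambda>i. \<beta> (k + i))"
  using alpha beta by unfold_locales auto

text \<open>The induction varies \<open>g\<close>: the last map is moved from the transfer operator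
  into the test function.\<close>

lemma transfers_duality:
  assumes f: "integrable U f" and g: "g \<in> borel_measurable borel" "\<And>x. \<bar>g x\<bar> \<le> c"
  shows "integrable U (\<lambda>z. transfers \<beta> n f z * g z)"
    "(\<integral>z. transfers \<beta> n f z * g z \<partial>U) = (\<integral>x. f x * g (compT \<beta> n x) \<partial>U)"
proof -
  have "integrable U (\<lambda>z. transfers \<beta> n f z * g z) \<and>
    (\<integral>z. transfers \<beta> n f z * g z \<partial>U) = (\<integral>x. f x * g (compT \<beta> n x) \<partial>U)"
    using g
  proof (induction n arbitrary: g c)
    case 0
    then show ?case using bounded_times_integrable[OF f, of g c] by simp
  next
    case (Suc n)
    have i: "integrable U (transfers \<beta> n f)" using Suc.IH[of "\<lambda>_. 1" 1] by simp
    have [measurable]: "g \<in> borel_measurable borel" by fact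
    have "(\<lambda>x. g (LSV (\<beta> (Suc n)) x)) \<in> borel_measurable borel" by measurable
    from Suc.IH[OF this Suc.prems(2)] transfer_duality[OF beta_Suc(1)[of n] i Suc.prems] show ?case by simp
  qed
  then show "integrable U (\<lambda>z. transfers \<beta> n f z * g z)"
    "(\<integral>z. transfers \<beta> n f z * g z \<partial>U) = (\<integral>x. f x * g (compT \<beta> n x) \<partial>U)" by auto
qed

lemma integrable_transfers: "integrable U f \<Longrightarrow> integrable U (transfers \<beta> n f)"
  using transfers_duality(1)[of f "\<lambda>_. 1" 1 n] by simp

lemma mass_transfers: "integrable U f \<Longrightarrow> mass (transfers \<beta> n f) = mass f"
  using transfers_duality(2)[of f "\<lambda>_. 1" 1 n] unfolding mass_def by simp

lemma decr_transfers: "decr f \<Longrightarrow> decr (transfers \<beta> n f)"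
  by (induction n) (auto intro!: decr_transfer beta_Suc)

lemma decr_ltransfers: "decr f \<Longrightarrow> decr (ltransfers \<beta> n f)"
  by (induction n) (auto intro!: decr_ltransfer beta_Suc)

section \<open>The invariant cone and the mass that stays near 0\<close>

definition cone :: "real \<Rightarrow> (real \<Rightarrow> real) \<Rightarrow> bool" where
  "cone A f \<longleftrightarrow> decr f \<and> (\<forall>x\<in>{0<..1}. f x \<le> A * x powr - \<alpha>)"

lemma integral_powr:
  assumes "0 \<le> c" "c \<le> 1"
  shows "integrable U (\<lambda>x. indicator {0<..c} x * x powr - \<alpha>)"
    "(\<integral>x. indicator {0<..c} x * x powr - \<alpha> \<partial>U) = c powr (1 - \<alpha>) / (1 - \<alpha>)"
proof -
  have h: "((\<lambda>x. x powr - \<alpha>) has_integral (c powr (1 - \<alpha>) / (1 - \<alpha>))) {0..c}"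
    using has_integral_powr_from_0[of "- \<alpha>" c] alpha assms by (simp add: add.commute)
  have "((\<lambda>x. x powr - \<alpha>) has_integral (c powr (1 - \<alpha>) / (1 - \<alpha>))) {0<..c}"
    by (rule has_integral_spike_set_eq[THEN iffD1, OF _ _ h]; rule negligible_subset[of "{0}"]) auto
  then have i: "integral {0<..c} (\<lambda>x. x powr - \<alpha>) = c powr (1 - \<alpha>) / (1 - \<alpha>)"
    and "(\<lambda>x. x powr - \<alpha>) integrable_on {0<..c}" by (auto simp: integral_unique has_integral_integrable)
  then have a: "(\<lambda>x. x powr - \<alpha>) absolutely_integrable_on {0<..c}"
    by (intro nonnegative_absolutely_integrable_1) auto
  show "integrable U (\<lambda>x. indicator {0<..c} x * x powr - \<alpha>)"
    using a assms by (subst integrable_subset_iff(1)[symmetric]) auto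
  show "(\<integral>x. indicator {0<..c} x * x powr - \<alpha> \<partial>U) = c powr (1 - \<alpha>) / (1 - \<alpha>)"
    using assms by (subst integrable_subset_iff(2)[OF _ _ a, symmetric]) (auto simp: i)
qed

lemma integrable_powr: "integrable U (\<lambda>x. x powr - \<alpha>)"
  using integral_powr(1)[of 1]
  by (subst Bochner_Integration.integrable_cong[where g="\<lambda>x. indicator {0<..1} x * x powr - \<alpha>"]) auto

lemma cone_integrable:
  assumes "cone A f"
  shows "integrable U f"
proof (rule Bochner_Integration.integrable_bound[of _ "\<lambda>x. A * x powr - \<alpha>"])
  show "integrable U (\<lambda>x. A * x powr - \<alpha>)" using integrable_powr by simp
  show "f \<in> borel_measurable U" using assms decr_measurable unfolding cone_def by auto
  show "AE x in U. norm (f x) \<le> norm (A * x powr - \<alpha>)"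
  proof (rule AE_I2)
    fix x assume "x \<in> space U"
    then have "0 \<le> f x" "f x \<le> A * x powr - \<alpha>" using assms decrD(1)[of f x] unfolding cone_def by auto
    then show "norm (f x) \<le> norm (A * x powr - \<alpha>)" by simp
  qed
qed

lemma cone_head_le:
  assumes "integrable U f" "\<And>x. x \<in> {0<..1} \<Longrightarrow> f x \<le> A * x powr - \<alpha>" "0 \<le> c" "c \<le> 1"
  shows "(\<integral>x. f x * indicator {0<..c} x \<partial>U) \<le> A * (c powr (1 - \<alpha>) / (1 - \<alpha>))"
proof -
  have "(\<integral>x. f x * indicator {0<..c} x \<partial>U) \<le> (\<integral>x. A * (indicator {0<..c} x * x powr - \<alpha>) \<partial>U)"
    using assms integrable_U_subset[OF assms(1), of "{0<..c}"] integral_powr(1)[OF assms(3,4)]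
    by (intro integral_mono) (auto simp: indicator_def mult.commute)
  also have "\<dots> = A * (c powr (1 - \<alpha>) / (1 - \<alpha>))" using integral_powr(2)[OF assms(3,4)] by simp
  finally show ?thesis .
qed

text \<open>With y = linv \<gamma> z one has z = y (1 + u). The last claim combines z \<le> 2y \<le>
  1 with \<gamma> \<le> \<alpha>: z^\<alpha> \<le> (2y)^\<alpha> \<le> (2y)^\<gamma> = u. It is the
  source of estimates uniform over all admissible exponents.\<close>

lemma linv_power_gain:
  assumes "0 < \<gamma>" "\<gamma> \<le> \<alpha>" "0 < z" "z \<le> 1"
  defines "u \<equiv> (2 * linv \<gamma> z) powr \<gamma>"
  shows "0 < u" "u \<le> 1" "linv \<gamma> z powr - \<alpha> = z powr - \<alpha> * (1 + u) powr \<alpha>" "1 \<le> z powr - \<alpha> * u"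
proof -
  let ?y = "linv \<gamma> z"
  have y: "0 < ?y" "?y \<le> 1/2" "LSV \<gamma> ?y = z" using linv[of \<gamma> z] assms by auto
  show u: "0 < u" "u \<le> 1" unfolding u_def using y two_powr_le_one[of ?y \<gamma>] assms by auto
  have z: "z = ?y * (1 + u)" using y LSV_left[of ?y \<gamma>] unfolding u_def by simp
  have "z powr - \<alpha> = ?y powr - \<alpha> * (1 + u) powr - \<alpha>"
    by (subst z) (use y u in \<open>simp add: powr_mult\<close>)
  then show "?y powr - \<alpha> = z powr - \<alpha> * (1 + u) powr \<alpha>"
    using u by (simp add: powr_minus mult.assoc)
  have "z \<le> 2 * ?y" using z u y by (metis mult.commute mult_right_mono add_left_mono one_add_one less_imp_le)
  then have "z powr \<alpha> \<le> (2 * ?y) powr \<alpha>" using assms alpha by (intro powr_mono2) auto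
  also have "\<dots> \<le> u" unfolding u_def using y assms by (intro powr_mono') auto
  finally have "z powr - \<alpha> * z powr \<alpha> \<le> z powr - \<alpha> * u" by (intro mult_left_mono) auto
  then show "1 \<le> z powr - \<alpha> * u" using assms by (simp add: powr_minus)
qed

text \<open>The left branch loses at least the proportion (1 - \<alpha>) u / 2, and z^(-\<alpha>) u
  \<ge> 1 turns this into an absolute loss independent of z.\<close>

lemma ltransfer_powr_le:
  assumes "0 < \<gamma>" "\<gamma> \<le> \<alpha>" "0 < z" "z \<le> 1"
  shows "ltransfer \<gamma> (\<lambda>x. x powr - \<alpha>) z \<le> z powr - \<alpha> - (1 - \<alpha>) / 2"
proof -
  define u where "u = (2 * linv \<gamma> z) powr \<gamma>"
  note g = linv_power_gain[OF assms, folded u_def]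
  have "(1 + u) powr \<alpha> / (1 + (1 + \<gamma>) * u) \<le> (1 + \<alpha> * u) / (1 + u)"
    using g(1) assms alpha one_plus_powr_le[of u \<alpha>] by (intro frac_le) auto
  also have "\<dots> = 1 - (1 - \<alpha>) * u / (1 + u)" using g(1) by (simp add: field_simps)
  also have "\<dots> \<le> 1 - (1 - \<alpha>) * u / 2"
    using g(1,2) alpha by (intro diff_left_mono divide_left_mono) auto
  finally have "z powr - \<alpha> * ((1 + u) powr \<alpha> / (1 + (1 + \<gamma>) * u)) \<le> z powr - \<alpha> * (1 - (1 - \<alpha>) * u / 2)"
    by (rule mult_left_mono) simp
  also have "\<dots> = z powr - \<alpha> - (1 - \<alpha>) / 2 * (z powr - \<alpha> * u)" by (simp add: field_simps)
  also have "\<dots> \<le> z powr - \<alpha> - (1 - \<alpha>) / 2 * 1"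
    using g(4) alpha by (intro diff_left_mono mult_left_mono) auto
  finally show ?thesis unfolding ltransfer_def dLSV_def g(3) u_def[symmetric] by simp
qed

text \<open>This value makes the gain in \<open>ltransfer_powr_le\<close> compensate the mass that enters through the right branch.\<close>
definition A :: real where "A = 2 / (1 - \<alpha>)"

lemma A_ge: "A \<ge> 2" "A * ((1 - \<alpha>) / 2) = 1"
  unfolding A_def using alpha by (auto simp: field_simps)

text \<open>The right branch adds at most \<open>mass f\<close>, which is paid for by the loss B (1
  - \<alpha>) / 2 on the left. The function \<open>g\<close> is an excess over the cone bound: g = 0
  yields invariance of the cone, other choices keep track of mass confined to the left
  branch.\<close>

lemma transfer_bound:
  assumes \<gamma>: "0 < \<gamma>" "\<gamma> \<le> \<alpha>" and f: "decr f" "integrable U f"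
    and b: "\<And>x. x \<in> {0<..1} \<Longrightarrow> f x \<le> B * x powr - \<alpha> + g x" and B: "A * mass f \<le> B"
    and z: "0 < z" "z \<le> 1"
  shows "transfer \<gamma> f z \<le> B * z powr - \<alpha> + ltransfer \<gamma> g z"
proof -
  have m0: "mass f \<ge> 0" unfolding mass_def using decrD(1)[OF f(1)] by (intro integral_nonneg_AE AE_I2) auto
  have B0: "B \<ge> 0" using m0 A_ge(1) B by (meson mult_nonneg_nonneg order_trans zero_le_numeral)
  have "f ((z + 1) / 2) / 2 \<le> mass f"
  proof -
    have "f ((z + 1) / 2) * (1/2) \<le> f ((z + 1) / 2) * ((z + 1) / 2)"
      using z by (intro mult_left_mono decrD(1)[OF f(1)]) auto
    also have "\<dots> \<le> mass f" using z by (intro decr_value_le_mass f) auto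
    finally show ?thesis by simp
  qed
  also have "mass f = A * mass f * ((1 - \<alpha>) / 2)" using A_ge(2) by (simp add: mult.assoc mult.left_commute)
  also have "\<dots> \<le> B * ((1 - \<alpha>) / 2)" using B alpha by (intro mult_right_mono) auto
  finally have r: "f ((z + 1) / 2) / 2 \<le> B * ((1 - \<alpha>) / 2)" .
  have "ltransfer \<gamma> f z \<le> ltransfer \<gamma> (\<lambda>x. B * x powr - \<alpha> + 1 * g x) z"
    using b by (intro ltransfer_mono \<gamma> z) auto
  also have "\<dots> = B * ltransfer \<gamma> (\<lambda>x. x powr - \<alpha>) z + ltransfer \<gamma> g z" by (subst ltransfer_lincomb) simp
  also have "\<dots> \<le> B * (z powr - \<alpha> - (1 - \<alpha>) / 2) + ltransfer \<gamma> g z"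
    using B0 ltransfer_powr_le[OF \<gamma> z] by (intro add_right_mono mult_left_mono) auto
  also have "B * (z powr - \<alpha> - (1 - \<alpha>) / 2) = B * z powr - \<alpha> - B * ((1 - \<alpha>) / 2)"
    by (rule right_diff_distrib)
  finally show ?thesis unfolding transfer_def using r by linarith
qed

lemma cone_transfers:
  assumes "cone B f" "A * mass f \<le> B"
  shows "cone B (transfers \<beta> n f)"
proof (induction n)
  case 0 then show ?case using assms by simp
next
  case (Suc n)
  have d: "decr (transfers \<beta> n f)" using Suc unfolding cone_def by simp
  have i: "integrable U (transfers \<beta> n f)" by (rule cone_integrable[OF Suc])
  have m: "mass (transfers \<beta> n f) = mass f" by (rule mass_transfers[OF cone_integrable[OF assms(1)]])
  have "transfer (\<beta> (Suc n)) (transfers \<beta> n f) z \<le> B * z powr - \<alpha> + ltransfer (\<beta> (Suc n)) (\<lambda>_. 0) z" if "z \<in> {0<..1}" for z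
    using that Suc assms(2) by (intro transfer_bound beta_Suc d i) (auto simp: cone_def m)
  then show ?case using decr_transfer[OF d beta_Suc(1)[of n]] unfolding cone_def by (simp add: ltransfer_def)
qed

lemma transfers_le_ltransfers:
  assumes f: "cone B f" and z: "0 < z" "z \<le> 1"
  shows "transfers \<beta> n f z \<le> A * mass f * z powr - \<alpha> + ltransfers \<beta> n f z"
  using z
proof (induction n arbitrary: z)
  case 0
  have "mass f \<ge> 0" unfolding mass_def using f decrD(1)[of f] by (intro integral_nonneg_AE AE_I2) (auto simp: cone_def)
  then show ?case using A_ge(1) by simp
next
  case (Suc n)
  have d: "decr (transfers \<beta> n f)" using f decr_transfers unfolding cone_def by simp
  have i: "integrable U (transfers \<beta> n f)" by (rule integrable_transfers[OF cone_integrable[OF f]])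
  have m: "mass (transfers \<beta> n f) = mass f" by (rule mass_transfers[OF cone_integrable[OF f]])
  show ?case using Suc by (auto intro!: transfer_bound beta_Suc d i simp: m)
qed

lemma integrable_ltransfers: "integrable U f \<Longrightarrow> integrable U (ltransfers \<beta> n f)"
proof (induction n)
  case (Suc n)
  then show ?case using ltransfer_duality(1)[OF beta_Suc(1)[of n], of "ltransfers \<beta> n f" "\<lambda>_. 1" 1] by simp
qed simp

lemma lpoint_bounds: "0 < b \<Longrightarrow> b \<le> 1 \<Longrightarrow> 0 < lpoint \<beta> n b \<and> lpoint \<beta> n b \<le> 1"
proof (induction n arbitrary: b)
  case (Suc n)
  then show ?case using Suc.IH[of "linv (\<beta> (Suc n)) b"] linv[OF beta_Suc(1)[of n], of b] by auto
qed simp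

lemma integral_ltransfers:
  assumes "integrable U f" "0 < b" "b \<le> 1"
  shows "(\<integral>z. ltransfers \<beta> n f z * indicator {0<..b} z \<partial>U) = (\<integral>x. f x * indicator {0<..lpoint \<beta> n b} x \<partial>U)"
  using assms(2,3)
proof (induction n arbitrary: b)
  case (Suc n)
  let ?g = "\<beta> (Suc n)"
  note g0 = beta_Suc(1)[of n]
  have l: "0 < linv ?g b" "linv ?g b \<le> 1/2" using linv[OF g0, of b] Suc by auto
  have "(\<integral>z. ltransfer ?g (ltransfers \<beta> n f) z * indicator {0<..b} z \<partial>U) =
      (\<integral>x. ltransfers \<beta> n f x * (indicator {0<..1/2} x * indicator {0<..b} (LSV ?g x)) \<partial>U)"
    by (rule ltransfer_duality(2)[OF g0 integrable_ltransfers[OF assms(1)], of _ 1]) (auto simp: indicator_def)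
  also have "\<dots> = (\<integral>x. ltransfers \<beta> n f x * indicator {0<..linv ?g b} x \<partial>U)"
  proof (intro bochner_cong refl arg_cong2[of _ _ _ _ "(*)"])
    fix x :: real
    show "indicator {0<..1/2} x * indicator {0<..b} (LSV ?g x) = (indicator {0<..linv ?g b} x :: real)"
      using le_linv_iff[OF g0, of b x] LSV_left_bounds[of x ?g] Suc.prems l g0
      by (cases "x \<in> {0<..1/2}") (auto simp: indicator_def)
  qed
  also have "\<dots> = (\<integral>x. f x * indicator {0<..lpoint \<beta> n (linv ?g b)} x \<partial>U)"
    using Suc.IH[of "linv ?g b"] l by simp
  finally show ?case by simp
qed simp

text \<open>Each preimage raises b^(-\<alpha>) by at least \<alpha> / 2, by
  \<open>linv_power_gain\<close>. Hence the n-th preimage of 1 is at most of order n^(-1 /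
  \<alpha>).\<close>

lemma lpoint_powr:
  assumes "0 < b" "b \<le> 1"
  shows "b powr - \<alpha> + n * (\<alpha> / 2) \<le> lpoint \<beta> n b powr - \<alpha>"
  using assms
proof (induction n arbitrary: b)
  case (Suc n)
  let ?g = "\<beta> (Suc n)"
  define u where "u = (2 * linv ?g b) powr ?g"
  note g = linv_power_gain[OF beta_Suc[of n] Suc.prems, folded u_def]
  have l: "0 < linv ?g b" "linv ?g b \<le> 1/2" using linv[OF beta_Suc(1)[of n], of b] Suc.prems by auto
  then have l1: "linv ?g b \<le> 1" by simp
  have "b powr - \<alpha> + \<alpha> / 2 \<le> b powr - \<alpha> + \<alpha> / 2 * (b powr - \<alpha> * u)"
    using g(4) alpha by simp
  also have "\<dots> = b powr - \<alpha> * (1 + \<alpha> * u / 2)" by (simp add: algebra_simps)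
  also have "\<dots> \<le> b powr - \<alpha> * (1 + u) powr \<alpha>"
    using g(1,2) alpha one_plus_powr_ge[of u \<alpha>] by (intro mult_left_mono) auto
  also have "\<dots> = linv ?g b powr - \<alpha>" using g(3) by simp
  finally have "b powr - \<alpha> + \<alpha> / 2 \<le> linv ?g b powr - \<alpha>" .
  moreover have "real (Suc n) * (\<alpha> / 2) = real n * (\<alpha> / 2) + \<alpha> / 2" by (simp add: field_simps)
  ultimately show ?case using Suc.IH[OF l(1) l1] unfolding lpoint.simps by linarith
qed simp

text \<open>Mass that a density bounded by \<open>x powr - \<alpha>\<close> can keep in the left branch during \<open>n\<close> steps.\<close>
definition \<epsilon> :: "nat \<Rightarrow> real" where
  "\<epsilon> n = (n * (\<alpha> / 2)) powr - ((1 - \<alpha>) / \<alpha>) / (1 - \<alpha>)"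

lemma lpoint_le:
  assumes "n > 0"
  shows "lpoint \<beta> n 1 powr (1 - \<alpha>) / (1 - \<alpha>) \<le> \<epsilon> n"
proof -
  let ?y = "lpoint \<beta> n 1"
  have y: "0 < ?y" "?y \<le> 1" using lpoint_bounds[of 1 n] by auto
  have "n * (\<alpha> / 2) \<le> ?y powr - \<alpha>" using lpoint_powr[of 1 n] by simp
  then have "(?y powr - \<alpha>) powr - ((1 - \<alpha>) / \<alpha>) \<le> (n * (\<alpha> / 2)) powr - ((1 - \<alpha>) / \<alpha>)"
    using assms alpha by (intro powr_mono2') auto
  also have "(?y powr - \<alpha>) powr - ((1 - \<alpha>) / \<alpha>) = ?y powr (1 - \<alpha>)"
    using alpha by (simp add: powr_powr)
  finally show ?thesis unfolding \<epsilon>_def using alpha by (intro divide_right_mono) auto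
qed

end

section \<open>Loss of memory\<close>

context lsv_sequence
begin

text \<open>Chosen so that a density in the cone with constant A * M has mass at most M / 4 on
  {0<..x0}.\<close>

definition x0 :: real where "x0 = ((1 - \<alpha>) / (4 * A)) powr (1 / (1 - \<alpha>))"

lemma x0: "0 < x0" "x0 \<le> 1" "A * (x0 powr (1 - \<alpha>) / (1 - \<alpha>)) = 1/4"
proof -
  have b: "0 < (1 - \<alpha>) / (4 * A)" "(1 - \<alpha>) / (4 * A) \<le> 1" using A_ge(1) alpha by (auto simp: divide_le_eq)
  show "0 < x0" unfolding x0_def using A_ge(1) alpha by simp
  show "x0 \<le> 1" unfolding x0_def using b alpha by (intro powr_le1) auto
  have "x0 powr (1 - \<alpha>) = (1 - \<alpha>) / (4 * A)"
    unfolding x0_def using alpha b A_ge(1) by (simp add: powr_powr)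
  then show "A * (x0 powr (1 - \<alpha>) / (1 - \<alpha>)) = 1/4" using A_ge(1) alpha by simp
qed

lemma mass_nonneg: "decr f \<Longrightarrow> 0 \<le> mass f"
  unfolding mass_def using decrD(1)[of f] by (intro integral_nonneg_AE AE_I2) auto

text \<open>The mass that never left the left branch is at most a quarter, and the remaining density
  obeys the bound with constant A * mass f, so at most another quarter lies on {0<..x0}. At least
  half lies to the right of \<open>x0\<close>, where a nonincreasing density is at most its value at
  \<open>x0\<close>.\<close>

lemma half_mass:
  assumes f: "cone B f" and n: "n > 0" and small: "B * \<epsilon> n \<le> mass f / 4" and B: "B \<ge> 0"
  shows "mass f / 2 \<le> transfers \<beta> n f x0"
proof -
  have df: "decr f" using f unfolding cone_def by simp
  have i: "integrable U f" by (rule cone_integrable[OF f])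
  let ?P = "transfers \<beta> n f" and ?L = "ltransfers \<beta> n f"
  have iP: "integrable U ?P" and iL: "integrable U ?L" by (rule integrable_transfers[OF i], rule integrable_ltransfers[OF i])
  have Lmass: "(\<integral>x. ?L x * indicator {0<..1} x \<partial>U) \<le> mass f / 4"
  proof -
    have "(\<integral>x. ?L x * indicator {0<..1} x \<partial>U) = (\<integral>x. f x * indicator {0<..lpoint \<beta> n 1} x \<partial>U)"
      by (rule integral_ltransfers[OF i]) auto
    also have "\<dots> \<le> B * (lpoint \<beta> n 1 powr (1 - \<alpha>) / (1 - \<alpha>))"
      using f lpoint_bounds[of 1 n] by (intro cone_head_le i) (auto simp: cone_def)
    also have "\<dots> \<le> B * \<epsilon> n" using B lpoint_le[OF n] by (rule mult_left_mono[rotated])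
    finally show ?thesis using small by simp
  qed
  have diff: "integrable U (\<lambda>x. ?P x - ?L x)" using iP iL by simp
  have "(\<integral>x. (?P x - ?L x) * indicator {0<..x0} x \<partial>U) \<le> (A * mass f) * (x0 powr (1 - \<alpha>) / (1 - \<alpha>))"
    using transfers_le_ltransfers[OF f, of _ n] x0 by (intro cone_head_le diff) (auto simp: algebra_simps)
  also have "\<dots> = mass f * (A * (x0 powr (1 - \<alpha>) / (1 - \<alpha>)))" by (simp only: ac_simps)
  also have "\<dots> = mass f / 4" unfolding x0(3) by simp
  finally have h: "(\<integral>x. (?P x - ?L x) * indicator {0<..x0} x \<partial>U) \<le> mass f / 4" .
  have ind: "integrable U (\<lambda>x. g x * indicator S x :: real)" if "integrable U g" "S \<in> sets borel"
    for g :: "real \<Rightarrow> real" and S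
    using bounded_times_integrable[OF that(1), of "indicator S" 1] that(2) by (auto simp: indicator_def)
  have "(\<integral>x. ?L x * indicator {0<..x0} x \<partial>U) \<le> (\<integral>x. ?L x * indicator {0<..1} x \<partial>U)"
    using decrD(1)[OF decr_ltransfers[OF df]] x0 by (intro integral_mono ind iL) (auto simp: indicator_def)
  moreover have "(\<integral>x. (?P x - ?L x) * indicator {0<..x0} x \<partial>U) =
      (\<integral>x. ?P x * indicator {0<..x0} x \<partial>U) - (\<integral>x. ?L x * indicator {0<..x0} x \<partial>U)"
    unfolding left_diff_distrib by (intro Bochner_Integration.integral_diff ind iP iL) auto
  ultimately have head: "(\<integral>x. ?P x * indicator {0<..x0} x \<partial>U) \<le> mass f / 2" using h Lmass by linarith
  have "mass f = mass ?P" using mass_transfers[OF i] by simp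
  also have "\<dots> = (\<integral>x. ?P x * indicator {0<..x0} x + ?P x * indicator {x0<..1} x \<partial>U)"
    unfolding mass_def using x0 by (intro bochner_cong) (auto simp: indicator_def)
  also have "\<dots> = (\<integral>x. ?P x * indicator {0<..x0} x \<partial>U) + (\<integral>x. ?P x * indicator {x0<..1} x \<partial>U)"
    by (intro Bochner_Integration.integral_add ind iP) auto
  finally show ?thesis using head decr_tail_le[OF decr_transfers[OF df] iP x0(1,2)] by linarith
qed

text \<open>A lower bound for LSV \<gamma> x / x on [x0, 1/2], uniform in \<gamma>: as 2x \<le> 1,
  (2x)^\<gamma> is at least (2x)^\<alpha>.\<close>

definition q :: real where "q = 1 + (2 * x0) powr \<alpha>"

lemma q_gt_1: "q > 1" unfolding q_def using x0 by simp

text \<open>For a nonincreasing density a lower bound at one point holds everywhere to its left. One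
  step moves that point to the right by a factor of at least \<open>q\<close>, until it reaches 1,
  and dividing by the derivative costs at most a factor 3.\<close>

lemma spread:
  assumes f: "decr f" and b: "b \<ge> 0" "b \<le> f x0"
  shows "b / 3 ^ k \<le> transfers \<beta> k f (min 1 (x0 * q ^ k))"
proof (induction k)
  case 0
  then show ?case using b x0 by simp
next
  case (Suc k)
  let ?s = "min 1 (x0 * q ^ k)" and ?g = "\<beta> (Suc k)" and ?F = "transfers \<beta> k f"
  note g = beta_Suc[of k]
  have dF: "decr ?F" by (rule decr_transfers[OF f])
  have dP: "decr (transfer ?g ?F)" by (rule decr_transfer[OF dF g(1)])
  have s: "x0 \<le> ?s" "?s \<le> 1" "0 < ?s" using x0 q_gt_1 by (auto simp: mult_le_cancel_left1 one_le_power less_imp_le)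
  have val: "b / 3 ^ Suc k \<le> transfer ?g ?F (LSV ?g t)" if t: "0 < t" "t \<le> 1/2" "b / 3 ^ k \<le> ?F t" for t
  proof -
    have Fn: "0 \<le> ?F ((LSV ?g t + 1) / 2)"
      using LSV_unit[of t ?g] t g by (intro decrD(1)[OF dF]) auto
    have "0 \<le> b / 3 ^ k" using b(1) by simp
    with t(3) have F0: "0 \<le> ?F t" by linarith
    have "b / 3 ^ Suc k = (b / 3 ^ k) / 3" by simp
    also have "\<dots> \<le> ?F t / dLSV ?g t"
      using t F0 dLSV_le[of t ?g] dLSV_ge[of ?g t] g alpha by (intro frac_le) auto
    also have "\<dots> = ltransfer ?g ?F (LSV ?g t)" unfolding ltransfer_def using t g by (simp add: linv_LSV)
    also have "\<dots> \<le> transfer ?g ?F (LSV ?g t)" unfolding transfer_def using Fn by simp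
    finally show ?thesis .
  qed
  show ?case
  proof (cases "?s \<le> 1/2")
    case True
    then have se: "?s = x0 * q ^ k" by (auto simp: min_def split: if_splits)
    have "(2 * x0) powr \<alpha> \<le> (2 * ?s) powr \<alpha>" using s x0 alpha by (intro powr_mono2) auto
    also have "\<dots> \<le> (2 * ?s) powr ?g" using True s g by (intro powr_mono') auto
    finally have "q \<le> 1 + (2 * ?s) powr ?g" unfolding q_def by simp
    then have "?s * q \<le> LSV ?g ?s" using True s by (subst LSV_left) (auto intro!: mult_left_mono)
    then have le: "min 1 (x0 * q ^ Suc k) \<le> LSV ?g ?s" unfolding se by (simp add: ac_simps min_le_iff_disj)
    have "0 < min 1 (x0 * q ^ Suc k)" using x0 q_gt_1 by simp
    moreover have "LSV ?g ?s \<le> 1" using LSV_left_bounds(3)[of ?s ?g] s True g by simp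
    ultimately have "transfer ?g ?F (LSV ?g ?s) \<le> transfer ?g ?F (min 1 (x0 * q ^ Suc k))"
      using le by (intro decrD(2)[OF dP]) auto
    then show ?thesis using val[OF s(3) True Suc.IH] by simp
  next
    case False
    \<comment> \<open>Beyond 1/2 the bound is used at 1/2 itself, which the left branch sends to
      1.\<close>
    have "?F ?s \<le> ?F (1/2)" using False s by (intro decrD(2)[OF dF]) auto
    then have "b / 3 ^ Suc k \<le> transfer ?g ?F 1" using val[of "1/2"] Suc.IH LSV_half[OF g(1)] by simp
    also have "\<dots> \<le> transfer ?g ?F (min 1 (x0 * q ^ Suc k))"
      using x0 q_gt_1 by (intro decrD(2)[OF dP]) auto
    finally show ?thesis by simp
  qed
qed

text \<open>Number of steps after which the point in \<open>spread\<close> has reached 1, so that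
  the lower bound holds on the whole interval.\<close>

definition N :: nat where "N = (SOME N. 1 \<le> x0 * q ^ N)"

lemma N: "1 \<le> x0 * q ^ N"
proof -
  obtain k where "1 / x0 < q ^ k" using real_arch_pow[OF q_gt_1] by blast
  then have "1 \<le> x0 * q ^ k" using x0 by (simp add: field_simps)
  then show ?thesis unfolding N_def by (rule someI)
qed

text \<open>The 2 comes from \<open>half_mass\<close>, the power of 3 from the \<open>N\<close>
  steps of \<open>spread\<close>.\<close>

definition c :: real where "c = 1 / (2 * 3 ^ N)"

lemma c: "0 < c" "c \<le> 1/2"
  unfolding c_def by (auto simp: divide_le_eq)

lemma block_lower_bound:
  assumes f: "cone B f" and n: "n > 0" and small: "B * \<epsilon> n \<le> mass f / 4" and B: "B \<ge> 0"
    and z: "0 < z" "z \<le> 1"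
  shows "c * mass f \<le> transfers \<beta> (n + N) f z"
proof -
  interpret s: lsv_sequence \<alpha> "\<lambda>i. \<beta> (n + i)" by (rule shift)
  have df: "decr f" using f unfolding cone_def by simp
  have dP: "decr (transfers \<beta> n f)" by (rule decr_transfers[OF df])
  have "mass f / 2 / 3 ^ N \<le> transfers (\<lambda>i. \<beta> (n + i)) N (transfers \<beta> n f) (min 1 (x0 * q ^ N))"
    using half_mass[OF assms(1-4)] mass_nonneg[OF df] by (intro s.spread dP) auto
  also have "min 1 (x0 * q ^ N) = 1" using N by simp
  also have "transfers (\<lambda>i. \<beta> (n + i)) N (transfers \<beta> n f) 1 \<le> transfers (\<lambda>i. \<beta> (n + i)) N (transfers \<beta> n f) z"
    using z by (intro decrD(2)[OF s.decr_transfers[OF dP]]) auto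
  finally show ?thesis unfolding transfers_add c_def by simp
qed

lemma decr_test:
  assumes "decr f" "integrable U f" "S \<in> sets borel"
  shows "0 \<le> (\<integral>x. f x * indicator S x \<partial>U)" "(\<integral>x. f x * indicator S x \<partial>U) \<le> mass f"
    "integrable U (\<lambda>x. f x * indicator S x)"
proof -
  show i: "integrable U (\<lambda>x. f x * indicator S x)"
    using bounded_times_integrable[OF assms(2), of "indicator S" 1] assms(3) by (auto simp: indicator_def)
  show "0 \<le> (\<integral>x. f x * indicator S x \<partial>U)"
    using decrD(1)[OF assms(1)] by (intro integral_nonneg_AE AE_I2) auto
  show "(\<integral>x. f x * indicator S x \<partial>U) \<le> mass f"
    unfolding mass_def using decrD(1)[OF assms(1)] by (intro integral_mono i assms) (auto simp: indicator_def)
qed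

text \<open>After \<open>n + N\<close> steps the density exceeds a constant depending only on its mass; removing it keeps
  monotonicity, and removing the same constant from two densities does not change their difference.\<close>
definition coupled :: "nat \<Rightarrow> (real \<Rightarrow> real) \<Rightarrow> real \<Rightarrow> real" where
  "coupled n f = (\<lambda>x. 1 * transfers \<beta> (n + N) f x + (- (c * mass f)) * 1)"

text \<open>\<open>B\<close> is kept while the mass contracts, so the smallness hypothesis becomes
  harder to satisfy with every block.\<close>

lemma cone_subtract:
  assumes f: "cone B f" "A * mass f \<le> B" and n: "n > 0" and small: "B * \<epsilon> n \<le> mass f / 4" and B: "B \<ge> 0"
  shows "cone B (coupled n f)" "mass (coupled n f) = (1 - c) * mass f"
proof -
  have df: "decr f" using f unfolding cone_def by simp
  have m0: "c * mass f \<ge> 0" using mass_nonneg[OF df] c(1) by simp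
  have cP: "cone B (transfers \<beta> (n + N) f)" by (rule cone_transfers[OF f])
  then have dP: "decr (transfers \<beta> (n + N) f)" unfolding cone_def by simp
  have "decr (coupled n f)" unfolding decr_def coupled_def
    using block_lower_bound[OF f(1) n small B] decrD(2)[OF dP] by auto
  moreover have "coupled n f x \<le> B * x powr - \<alpha>" if "x \<in> {0<..1}" for x
    using cP m0 that unfolding cone_def coupled_def by force
  ultimately show "cone B (coupled n f)" unfolding cone_def by blast
  interpret p: prob_space U by (rule prob_space_U)
  have i: "integrable U (transfers \<beta> (n + N) f)" by (rule cone_integrable[OF cP])
  have "mass (coupled n f) = mass (transfers \<beta> (n + N) f) - c * mass f"
    unfolding mass_def coupled_def using i p.prob_space by simp
  also have "mass (transfers \<beta> (n + N) f) = mass f" by (rule mass_transfers[OF cone_integrable[OF f(1)]])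
  finally show "mass (coupled n f) = (1 - c) * mass f" by (simp add: algebra_simps)
qed

end

text \<open>Stated outside the locale because the induction over blocks passes to shifted sequences;
  the constants depend on \<alpha> only. If the mass is too small for a subtraction it is below 4 *
  B * \<epsilon> n and bounds the difference by itself, so this error is not multiplied by the
  number of blocks.\<close>

lemma decay_blocks:
  assumes "lsv_sequence \<alpha> \<beta>" and "lsv_sequence.cone \<alpha> B f" "lsv_sequence.cone \<alpha> B g"
    and "mass f = mass g" "lsv_sequence.A \<alpha> * mass f \<le> B" "n > 0" "B \<ge> 0" and S: "S \<in> sets borel"
  shows "\<bar>(\<integral>x. transfers \<beta> (k * (n + lsv_sequence.N \<alpha>)) f x * indicator S x \<partial>U)
      - (\<integral>x. transfers \<beta> (k * (n + lsv_sequence.N \<alpha>)) g x * indicator S x \<partial>U)\<bar>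
    \<le> mass f * (1 - lsv_sequence.c \<alpha>) ^ k + 4 * B * lsv_sequence.\<epsilon> \<alpha> n"
  using assms(1-5)
proof (induction k arbitrary: \<beta> f g)
  case 0
  then interpret lsv_sequence \<alpha> \<beta> by simp
  have "0 \<le> B * \<epsilon> n" using assms(7) alpha unfolding \<epsilon>_def by simp
  moreover have "decr f" "decr g" "integrable U f" "integrable U g"
    using 0 cone_integrable unfolding cone_def by auto
  ultimately show ?case
    using decr_test[of f S] decr_test[of g S] S 0 by simp
next
  case (Suc k)
  then interpret lsv_sequence \<alpha> \<beta> by simp
  interpret s: lsv_sequence \<alpha> "\<lambda>i. \<beta> (n + N + i)" by (rule shift)
  have d: "decr f" "decr g" and i: "integrable U f" "integrable U g"
    using Suc.prems cone_integrable unfolding cone_def by auto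
  let ?D = "\<lambda>\<beta> l f. \<integral>x. transfers \<beta> l f x * indicator S x \<partial>U"
  have e0: "0 \<le> B * \<epsilon> n" using assms(7) alpha unfolding \<epsilon>_def by simp
  show ?case
  proof (cases "B * \<epsilon> n \<le> mass f / 4")
    case False
    have "0 \<le> mass f * (1 - c) ^ Suc k" using mass_nonneg[OF d(1)] c by simp
    moreover have "\<bar>?D \<beta> (Suc k * (n + N)) f - ?D \<beta> (Suc k * (n + N)) g\<bar> \<le> mass f"
      using decr_test[OF decr_transfers[OF d(1)] integrable_transfers[OF i(1)] S, of "Suc k * (n + N)"]
        decr_test[OF decr_transfers[OF d(2)] integrable_transfers[OF i(2)] S, of "Suc k * (n + N)"]
        mass_transfers[OF i(1), of "Suc k * (n + N)"] mass_transfers[OF i(2), of "Suc k * (n + N)"] Suc.prems(4) by linarith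
    moreover have "mass f \<le> 4 * B * \<epsilon> n" using False by simp
    ultimately show ?thesis by linarith
  next
    case True
    let ?l = "k * (n + N)" and ?b = "\<lambda>i. \<beta> (n + N + i)"
    define f' where "f' = coupled n f"
    define g' where "g' = coupled n g"
    have f': "cone B f'" "mass f' = (1 - c) * mass f"
      unfolding f'_def
      by (rule cone_subtract(1)[OF Suc.prems(2,5) assms(6) True assms(7)],
          rule cone_subtract(2)[OF Suc.prems(2,5) assms(6) True assms(7)])
    note mg = Suc.prems(5)[unfolded Suc.prems(4)] True[unfolded Suc.prems(4)]
    have g': "cone B g'" "mass g' = (1 - c) * mass g"
      unfolding g'_def
      by (rule cone_subtract(1)[OF Suc.prems(3) mg(1) assms(6) mg(2) assms(7)],
          rule cone_subtract(2)[OF Suc.prems(3) mg(1) assms(6) mg(2) assms(7)])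
    have "A * mass f' \<le> A * mass f" unfolding f'(2)
      using c mass_nonneg[OF d(1)] A_ge(1) by (intro mult_left_mono mult_left_le_one_le) auto
    then have IH: "\<bar>?D ?b ?l f' - ?D ?b ?l g'\<bar> \<le> mass f' * (1 - c) ^ k + 4 * B * \<epsilon> n"
      using Suc.prems by (intro Suc.IH s.lsv_sequence_axioms f' g') (auto simp: f'(2) g'(2))
    have i1: "integrable U (\<lambda>x. transfers ?b ?l (\<lambda>_. 1) x * indicator S x)"
      using s.decr_test(3)[OF s.decr_transfers s.integrable_transfers S, of "\<lambda>_. 1" ?l]
      by (simp add: decr_def finite_measure.integrable_const prob_space.finite_measure[OF prob_space_U])
    \<comment> \<open>The masses of \<open>f\<close> and \<open>g\<close> agree, so the subtracted
      constants evolve identically and cancel in the difference.\<close>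
    have "?D ?b ?l (\<lambda>x. 1 * transfers \<beta> (n + N) h x + (- (c * mass h)) * 1) = ?D \<beta> (Suc k * (n + N)) h
        - c * mass h * ?D ?b ?l (\<lambda>_. 1)" if "decr h" "integrable U h" for h
    proof -
      have e: "transfers ?b ?l (transfers \<beta> (n + N) h) = transfers \<beta> (Suc k * (n + N)) h"
        using transfers_add[of \<beta> "n + N" ?l h] by simp
      have ih: "integrable U (\<lambda>x. transfers \<beta> (Suc k * (n + N)) h x * indicator S x)"
        by (rule decr_test(3)[OF decr_transfers[OF that(1)] integrable_transfers[OF that(2)] S])
      show ?thesis unfolding transfers_lincomb e using ih i1 by (simp add: algebra_simps)
    qed
    from this[OF d(1) i(1)] this[OF d(2) i(2)]
    have "?D ?b ?l f' - ?D ?b ?l g' = ?D \<beta> (Suc k * (n + N)) f - ?D \<beta> (Suc k * (n + N)) g"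
      unfolding f'_def g'_def coupled_def Suc.prems(4) by simp
    with IH show ?thesis unfolding f'(2) by (simp add: ac_simps)
  qed
qed

context lsv_sequence
begin

section \<open>Polynomial rate of the loss of memory\<close>

definition \<kappa> :: real where "\<kappa> = (1 - \<alpha>) / \<alpha>"

text \<open>One summand for each source of error: the geometric contraction, the mass left near 0,
  and times too short for a complete block.\<close>

definition C :: real where
  "C = (\<kappa> / - ln (1 - c)) powr \<kappa> / (1 - c) + 4 * ((2 * (real N + 2) / \<alpha>) powr \<kappa> / (1 - \<alpha>)) + (real N + 1) powr \<kappa>"

lemma kappa_pos: "\<kappa> > 0" unfolding \<kappa>_def using alpha by simp

text \<open>The inequality x \<le> exp x at x = l (p + 1) / \<kappa>, raised to the power \<kappa>,
  compares the power with the exponential.\<close>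

lemma geometric_rate: "(1 - c) ^ p * (real p + 1) powr \<kappa> \<le> (\<kappa> / - ln (1 - c)) powr \<kappa> / (1 - c)"
proof -
  define l where "l = - ln (1 - c)"
  have l: "l > 0" unfolding l_def using c by simp
  have "l * (real p + 1) / \<kappa> \<le> exp (l * (real p + 1) / \<kappa>)"
    using exp_ge_add_one_self[of "l * (real p + 1) / \<kappa>"] by linarith
  then have "(l * (real p + 1) / \<kappa>) powr \<kappa> \<le> exp (l * (real p + 1) / \<kappa>) powr \<kappa>"
    using l kappa_pos by (intro powr_mono2) auto
  also have "\<dots> = exp (l * (real p + 1))" using kappa_pos by (simp add: powr_def)
  also have "\<dots> = inverse ((1 - c) ^ (p + 1))"
  proof -
    have "(1 - c) ^ (p + 1) = exp (ln (1 - c)) ^ (p + 1)" using c by simp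
    also have "\<dots> = exp (real (p + 1) * ln (1 - c))" by (rule exp_of_nat_mult[symmetric])
    also have "real (p + 1) * ln (1 - c) = - (l * (real p + 1))" unfolding l_def by (simp add: algebra_simps)
    finally have e: "(1 - c) ^ (p + 1) = exp (- (l * (real p + 1)))" .
    show ?thesis unfolding e exp_minus by simp
  qed
  finally have b: "(l * (real p + 1) / \<kappa>) powr \<kappa> \<le> inverse ((1 - c) ^ (p + 1))" .
  have b2: "(l / \<kappa>) powr \<kappa> * (real p + 1) powr \<kappa> \<le> inverse ((1 - c) ^ (p + 1))"
  proof -
    have "(l / \<kappa>) powr \<kappa> * (real p + 1) powr \<kappa> = (l / \<kappa> * (real p + 1)) powr \<kappa>"
      using l kappa_pos by (subst powr_mult) auto
    also have "l / \<kappa> * (real p + 1) = l * (real p + 1) / \<kappa>" by simp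
    finally show ?thesis using b by simp
  qed
  have "(1 - c) ^ (p + 1) * ((l / \<kappa>) powr \<kappa> * (real p + 1) powr \<kappa>) \<le> (1 - c) ^ (p + 1) * inverse ((1 - c) ^ (p + 1))"
    using c by (intro mult_left_mono[OF b2]) simp
  also have "\<dots> = 1" by (rule right_inverse) (use c in simp)
  finally have "(1 - c) ^ p * (real p + 1) powr \<kappa> * ((l / \<kappa>) powr \<kappa> * (1 - c)) \<le> 1"
    by (simp add: ac_simps)
  moreover have "(l / \<kappa>) powr \<kappa> * (1 - c) > 0" using l kappa_pos c by simp
  ultimately have "(1 - c) ^ p * (real p + 1) powr \<kappa> \<le> 1 / ((l / \<kappa>) powr \<kappa> * (1 - c))"
    by (simp add: pos_le_divide_eq)
  also have "\<dots> = (\<kappa> / l) powr \<kappa> / (1 - c)" using l kappa_pos by (simp add: powr_divide)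
  finally show ?thesis unfolding l_def .
qed

lemma polynomial_rate:
  assumes "p > N"
  shows "\<epsilon> (p - N) * (real p + 1) powr \<kappa> \<le> (2 * (real N + 2) / \<alpha>) powr \<kappa> / (1 - \<alpha>)"
proof -
  define j where "j = real (p - N)"
  have j: "j \<ge> 1" "real p + 1 = j + N + 1" unfolding j_def using assms by auto
  \<comment> \<open>Since j \<ge> 1, the loss of \<open>N\<close> steps from each block costs only a
    constant factor.\<close>
  have "real p + 1 \<le> (real N + 2) * j" using j mult_left_mono[of 1 j "real N + 1"] by (simp add: algebra_simps)
  then have "(real p + 1) powr \<kappa> \<le> ((real N + 2) * j) powr \<kappa>" using kappa_pos by (intro powr_mono2) auto
  moreover have e: "\<epsilon> (p - N) = (j * (\<alpha> / 2)) powr - \<kappa> / (1 - \<alpha>)" unfolding \<epsilon>_def \<kappa>_def j_def by simp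
  ultimately have "\<epsilon> (p - N) * (real p + 1) powr \<kappa> \<le> (j * (\<alpha> / 2)) powr - \<kappa> / (1 - \<alpha>) * ((real N + 2) * j) powr \<kappa>"
    using alpha by (intro mult_mono) auto
  also have "\<dots> = (((real N + 2) * j) / (j * (\<alpha> / 2))) powr \<kappa> / (1 - \<alpha>)"
  proof -
    have quot: "v powr - \<kappa> / d * u powr \<kappa> = (u / v) powr \<kappa> / d" if "0 \<le> u" "0 \<le> v" for u v d :: real
      using that by (simp add: powr_minus powr_divide inverse_eq_divide)
    show ?thesis by (rule quot) (use alpha j in auto)
  qed
  also have "((real N + 2) * j) / (j * (\<alpha> / 2)) = 2 * (real N + 2) / \<alpha>" using j alpha by (simp add: divide_simps)
  finally show ?thesis .
qed

definition rate :: "nat \<Rightarrow> real" where "rate l = (l + 1) powr - (\<kappa> / 2)"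

lemma rate_nonneg: "rate l \<ge> 0" unfolding rate_def by simp

text \<open>With p the integer square root of l one has l + 1 \<le> (p + 1)^2, so decay of order
  p^(-\<kappa>) is decay of order l^(-\<kappa> / 2).\<close>

lemma rate_ge:
  fixes p l :: nat and y z :: real
  assumes "p^2 \<le> l" "l < (p + 1)^2" and y: "y * (real p + 1) powr \<kappa> \<le> z" "0 \<le> y"
  shows "y \<le> z * rate l"
proof -
  have "real l + 1 \<le> (real p + 1)^2"
  proof -
    have "l + 1 \<le> (p + 1)^2" using assms(2) by simp
    then have "real (l + 1) \<le> real ((p + 1)^2)" by (simp only: of_nat_le_iff)
    then show ?thesis by (simp add: add.commute)
  qed
  then have "(real l + 1) powr (\<kappa> / 2) \<le> ((real p + 1)^2) powr (\<kappa> / 2)"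
    using kappa_pos by (intro powr_mono2) auto
  also have "\<dots> = ((real p + 1) powr 2) powr (\<kappa> / 2)" by (subst powr_numeral) auto
  also have "\<dots> = (real p + 1) powr \<kappa>" by (simp only: powr_powr) simp
  finally have "y * (real l + 1) powr (\<kappa> / 2) \<le> y * (real p + 1) powr \<kappa>" using y by (intro mult_left_mono)
  with y have "y * (real l + 1) powr (\<kappa> / 2) \<le> z" by simp
  then show ?thesis unfolding rate_def by (simp add: powr_minus divide_inverse[symmetric] pos_le_divide_eq)
qed

lemma decay:
  assumes "cone B f" "cone B g" "mass f = mass g" "A * mass f \<le> B" and S: "S \<in> sets borel"
  shows "\<bar>(\<integral>x. f x * indicator S (compT \<beta> l x) \<partial>U) - (\<integral>x. g x * indicator S (compT \<beta> l x) \<partial>U)\<bar> \<le> B * C * rate l"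
proof -
  obtain p where p: "p^2 \<le> l" "l < (p + 1)^2"
  proof
    show "(floor_sqrt l)^2 \<le> l" by simp
    show "l < (floor_sqrt l + 1)^2" using Suc_floor_sqrt_power2_gt[of l] by simp
  qed
  have d: "decr f" "decr g" and i: "integrable U f" "integrable U g"
    using assms cone_integrable unfolding cone_def by auto
  have m: "0 \<le> mass f" "mass f \<le> B"
    using mass_nonneg[OF d(1)] A_ge(1) assms(4) mult_right_mono[of 1 A "mass f"] by auto
  then have B0: "B \<ge> 0" by simp
  let ?I = "\<lambda>h. \<integral>x. h x * indicator S (compT \<beta> l x) \<partial>U"
  have triv: "\<bar>?I f - ?I g\<bar> \<le> mass f"
  proof -
    have S': "compT \<beta> l -` S \<in> sets borel" using measurable_sets[OF borel_measurable_compT S] by simp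
    have "?I h = (\<integral>x. h x * indicator (compT \<beta> l -` S) x \<partial>U)" for h :: "real \<Rightarrow> real" by (simp add: indicator_def)
    then show ?thesis
      using decr_test[OF d(1) i(1) S'] decr_test[OF d(2) i(2) S'] assms(3) by simp
  qed
  show ?thesis
  proof (cases "p \<le> N")
    case True
    have "(real p + 1) powr \<kappa> \<le> (real N + 1) powr \<kappa>" using True kappa_pos by (intro powr_mono2) auto
    also have "\<dots> \<le> C" unfolding C_def using alpha c by simp
    finally have "B * (real p + 1) powr \<kappa> \<le> B * C" using B0 by (rule mult_left_mono)
    from rate_ge[OF p this B0] triv m show ?thesis by simp
  next
    case False
    \<comment> \<open>Of the p steps of a block, \<open>n\<close> let mass escape from the
      neighbourhood of 0 and \<open>N\<close> spread it over the interval.\<close>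
    define n where "n = p - N"
    have n: "n > 0" "n + N = p" unfolding n_def using False by auto
    define r where "r = l - p * p"
    have l: "l = p * p + r" using p unfolding r_def power2_eq_square by simp
    interpret s: lsv_sequence \<alpha> "\<lambda>i. \<beta> (p * p + i)" by (rule shift)
    \<comment> \<open>The remaining l - p * p steps are absorbed into the test set.\<close>
    define S' where "S' = compT (\<lambda>i. \<beta> (p * p + i)) r -` S"
    have S': "S' \<in> sets borel" unfolding S'_def using measurable_sets[OF borel_measurable_compT S] by simp
    have I: "?I h = (\<integral>x. transfers \<beta> (p * p) h x * indicator S' x \<partial>U)" if "integrable U h" for h
    proof -
      have "(\<integral>x. transfers \<beta> (p * p) h x * indicator S' x \<partial>U) = (\<integral>x. h x * indicator S' (compT \<beta> (p * p) x) \<partial>U)"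
        using S' by (intro transfers_duality(2)[OF that, of _ 1]) (auto simp: indicator_def)
      then show ?thesis unfolding S'_def l compT_add by (simp add: indicator_def)
    qed
    have "\<bar>?I f - ?I g\<bar> \<le> mass f * (1 - c) ^ p + 4 * B * \<epsilon> n"
      unfolding I[OF i(1)] I[OF i(2)]
      using decay_blocks[OF lsv_sequence_axioms assms(1-4) n(1) B0 S', of p] unfolding n(2) .
    also have "\<dots> \<le> B * ((1 - c) ^ p + 4 * \<epsilon> n)"
      using mult_right_mono[OF m(2), of "(1 - c) ^ p"] c by (simp add: algebra_simps)
    also have "\<dots> \<le> B * C * rate l"
    proof (rule rate_ge[OF p])
      have "((1 - c) ^ p + 4 * \<epsilon> n) * (real p + 1) powr \<kappa> \<le> C"
        using geometric_rate[of p] polynomial_rate[of p] False powr_ge_zero[of "real N + 1" \<kappa>]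
        unfolding C_def n_def distrib_right by linarith
      then show "B * ((1 - c) ^ p + 4 * \<epsilon> n) * (real p + 1) powr \<kappa> \<le> B * C"
        using B0 by (simp add: mult.assoc mult_left_mono)
      show "0 \<le> B * ((1 - c) ^ p + 4 * \<epsilon> n)" using B0 c alpha unfolding \<epsilon>_def by simp
    qed
    finally show ?thesis .
  qed
qed

text \<open>Differences of elements of the cone: this class contains products of densities with observables.\<close>
definition dcone :: "real \<Rightarrow> (real \<Rightarrow> real) \<Rightarrow> bool" where
  "dcone B f \<longleftrightarrow> (\<exists>f1 f2. cone B f1 \<and> cone B f2 \<and> (\<forall>x\<in>{0<..1}. f x = f1 x - f2 x))"

lemma cone_mono: "cone B f \<Longrightarrow> B \<le> B' \<Longrightarrow> cone B' f"
  unfolding cone_def using mult_right_mono[of B B' "_ powr - \<alpha>"] by (fastforce intro: order_trans)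

lemma cone_nonneg:
  assumes "cone B f"
  shows "B \<ge> 0"
proof -
  have d: "decr f" and b: "\<forall>x\<in>{0<..1}. f x \<le> B * x powr - \<alpha>" using assms unfolding cone_def by auto
  show ?thesis using decrD(1)[OF d, of 1] bspec[OF b, of 1] by simp
qed

lemma cone_mass: "cone B f \<Longrightarrow> A * mass f \<le> A * B / (1 - \<alpha>)"
proof -
  assume f: "cone B f"
  have i: "integrable U f" by (rule cone_integrable[OF f])
  have "mass f = (\<integral>x. f x * indicator {0<..1} x \<partial>U)"
    unfolding mass_def by (intro bochner_cong) auto
  also have "\<dots> \<le> B * (1 powr (1 - \<alpha>) / (1 - \<alpha>))"
    using f by (intro cone_head_le i) (auto simp: cone_def)
  finally have "mass f \<le> B / (1 - \<alpha>)" by simp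
  then have "A * mass f \<le> A * (B / (1 - \<alpha>))" using A_ge(1) by (intro mult_left_mono) auto
  then show ?thesis by simp
qed

text \<open>With this larger constant the mass condition of \<open>cone_transfers\<close> and
  \<open>decay\<close> holds automatically, by \<open>cone_mass\<close>.\<close>

lemma cone_enlarge:
  assumes "cone B f"
  shows "cone (A * B / (1 - \<alpha>)) f"
proof (rule cone_mono[OF assms])
  have "B * 1 \<le> B * (A / (1 - \<alpha>))"
    using cone_nonneg[OF assms] A_ge(1) alpha by (intro mult_left_mono) (auto simp: le_divide_eq)
  then show "B \<le> A * B / (1 - \<alpha>)" by (simp add: mult.commute)
qed

lemma cone_add:
  assumes "cone B f" "cone B' g"
  shows "cone (B + B') (\<lambda>x. f x + g x)"
proof -
  have d: "decr f" "decr g" using assms unfolding cone_def by auto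
  have "decr (\<lambda>x. f x + g x)" unfolding decr_def
    using decrD[OF d(1)] decrD[OF d(2)] by (auto intro!: add_mono add_nonneg_nonneg)
  moreover have "f x + g x \<le> (B + B') * x powr - \<alpha>" if "x \<in> {0<..1}" for x
    unfolding distrib_right using assms that unfolding cone_def by (intro add_mono) auto
  ultimately show ?thesis unfolding cone_def by blast
qed

lemma cone_mult:
  assumes g: "decr g" "\<And>x. x \<in> {0<..1} \<Longrightarrow> g x \<le> R" and f: "cone B f"
  shows "cone (R * B) (\<lambda>x. g x * f x)"
proof -
  have df: "decr f" using f unfolding cone_def by simp
  have "decr (\<lambda>x. g x * f x)" unfolding decr_def
    using decrD[OF df] decrD[OF g(1)] by (auto intro!: mult_mono)
  moreover have "g x * f x \<le> R * B * x powr - \<alpha>" if "x \<in> {0<..1}" for x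
  proof -
    have "g x * f x \<le> R * (B * x powr - \<alpha>)"
      using g(2)[OF that] f decrD(1)[OF df] decrD(1)[OF g(1)] that unfolding cone_def
      by (intro mult_mono) (auto intro: order_trans)
    then show ?thesis by (simp add: mult.assoc)
  qed
  ultimately show ?thesis unfolding cone_def by blast
qed

lemma dcone_integrable:
  assumes "dcone B f"
  shows "integrable U f"
proof -
  obtain f1 f2 where f: "cone B f1" "cone B f2" "\<forall>x\<in>{0<..1}. f x = f1 x - f2 x"
    using assms unfolding dcone_def by blast
  have "integrable U (\<lambda>x. f1 x - f2 x)" using f cone_integrable by auto
  then show ?thesis using f(3) by (subst Bochner_Integration.integrable_cong[of U U]) auto
qed

lemma dcone_diff:
  assumes "dcone B f" "dcone B' g"
  shows "dcone (B + B') (\<lambda>x. f x - g x)"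
proof -
  obtain f1 f2 g1 g2 where "cone B f1" "cone B f2" "\<forall>x\<in>{0<..1}. f x = f1 x - f2 x"
    "cone B' g1" "cone B' g2" "\<forall>x\<in>{0<..1}. g x = g1 x - g2 x"
    using assms unfolding dcone_def by blast
  then show ?thesis unfolding dcone_def
    by (intro exI[of _ "\<lambda>x. f1 x + g2 x"] exI[of _ "\<lambda>x. f2 x + g1 x"]) (auto intro: cone_add)
qed

text \<open>A Lipschitz function is a difference of two nonnegative nonincreasing functions, and the
  class of nonnegative nonincreasing functions is closed under products.\<close>
lemma dcone_mult:
  assumes f: "dcone B f" and R: "\<And>x. \<bar>\<phi> x\<bar> \<le> R" "\<And>x y. \<bar>\<phi> x - \<phi> y\<bar> \<le> R * \<bar>x - y\<bar>"
  shows "dcone (5 * R * B) (\<lambda>x. \<phi> x * f x)"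
proof -
  obtain f1 f2 where f: "cone B f1" "cone B f2" "\<forall>x\<in>{0<..1}. f x = f1 x - f2 x"
    using f unfolding dcone_def by blast
  \<comment> \<open>On the unit interval R * (2 - x) is at least R, which makes the sum nonnegative,
    and its slope -R makes it nonincreasing. The suprema 3 * R and 2 * R of \<open>g1\<close> and
    \<open>g2\<close> give the factor 5.\<close>
  define g1 where "g1 x = \<phi> x + R * (2 - x)" for x
  define g2 where "g2 x = R * (2 - x)" for x
  have R0: "R \<ge> 0" using R(1)[of 0] by linarith
  have Rx: "0 \<le> R * x" "R * x \<le> R" if "x \<in> {0<..1}" for x
    using that R0 by (auto intro: mult_left_le)
  have g1: "decr g1" "\<And>x. x \<in> {0<..1} \<Longrightarrow> g1 x \<le> 3 * R"
  proof -
    show "decr g1" unfolding decr_def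
    proof (intro conjI ballI allI impI)
      fix x :: real assume "x \<in> {0<..1}"
      then show "0 \<le> g1 x" using R(1)[of x] Rx[of x] unfolding g1_def right_diff_distrib by linarith
    next
      fix x y :: real assume "0 < x" "x \<le> y" "y \<le> 1"
      then show "g1 y \<le> g1 x" using R(2)[of y x] unfolding g1_def by (simp add: right_diff_distrib)
    qed
    fix x :: real assume "x \<in> {0<..1}"
    then show "g1 x \<le> 3 * R" using R(1)[of x] Rx[of x] unfolding g1_def right_diff_distrib by linarith
  qed
  have g2: "decr g2" "\<And>x. x \<in> {0<..1} \<Longrightarrow> g2 x \<le> 2 * R"
    using R0 Rx unfolding decr_def g2_def by (auto intro: mult_left_mono simp: right_diff_distrib)
  have b: "3 * R * B + 2 * R * B = 5 * R * B" by simp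
  show ?thesis unfolding dcone_def
  proof (intro exI conjI ballI)
    show "cone (5 * R * B) (\<lambda>x. g1 x * f1 x + g2 x * f2 x)"
      using cone_add[OF cone_mult[OF g1 f(1)] cone_mult[OF g2 f(2)]] unfolding b .
    show "cone (5 * R * B) (\<lambda>x. g1 x * f2 x + g2 x * f1 x)"
      using cone_add[OF cone_mult[OF g1 f(2)] cone_mult[OF g2 f(1)]] unfolding b .
    fix x :: real assume "x \<in> {0<..1}"
    then have fx: "f x = f1 x - f2 x" using f(3) by blast
    show "\<phi> x * f x = g1 x * f1 x + g2 x * f2 x - (g1 x * f2 x + g2 x * f1 x)"
      unfolding fx g1_def g2_def by (simp add: algebra_simps)
  qed
qed

lemma transfers_cong: "(\<And>x. x \<in> {0<..1} \<Longrightarrow> f x = g x) \<Longrightarrow> z \<in> {0<..1} \<Longrightarrow> transfers \<beta> n f z = transfers \<beta> n g z"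
proof (induction n arbitrary: z)
  case (Suc n)
  then show ?case using linv[OF beta_Suc(1)[of n], of z] by (auto simp: transfer_def ltransfer_def)
qed simp

lemma dcone_transfers:
  assumes "dcone B f"
  shows "dcone (A * B / (1 - \<alpha>)) (transfers \<beta> n f)"
proof -
  obtain f1 f2 where f: "cone B f1" "cone B f2" "\<forall>x\<in>{0<..1}. f x = f1 x - f2 x"
    using assms unfolding dcone_def by blast
  have "transfers \<beta> n f z = transfers \<beta> n f1 z - transfers \<beta> n f2 z" if "z \<in> {0<..1}" for z
    using transfers_cong[of f "\<lambda>x. 1 * f1 x + (- 1) * f2 x" z n] f(3) that unfolding transfers_lincomb by simp
  then show ?thesis unfolding dcone_def
    using cone_transfers[OF cone_enlarge cone_mass] f(1,2) by blast
qed

text \<open>Mean zero says that the two cone parts have equal mass, which is what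
  \<open>decay\<close> compares.\<close>

lemma decay_dcone:
  assumes f: "dcone B f" "(\<integral>x. f x \<partial>U) = 0" and S: "S \<in> sets borel"
  shows "\<bar>\<integral>x. f x * indicator S (compT \<beta> l x) \<partial>U\<bar> \<le> A * B / (1 - \<alpha>) * C * rate l"
proof -
  obtain f1 f2 where f12: "cone B f1" "cone B f2" "\<forall>x\<in>{0<..1}. f x = f1 x - f2 x"
    using f(1) unfolding dcone_def by blast
  have i: "integrable U f1" "integrable U f2" using f12 cone_integrable by auto
  have [measurable]: "S \<in> sets borel" by fact
  have ii: "integrable U (\<lambda>x. h x * indicator S (compT \<beta> l x))" if "integrable U h" for h :: "real \<Rightarrow> real"
    by (rule bounded_times_integrable[OF that, of _ 1]) (auto simp: indicator_def)
  have eq: "(\<integral>x. f x * g x \<partial>U) = (\<integral>x. f1 x * g x - f2 x * g x \<partial>U)" for g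
    using f12(3) by (intro bochner_cong) (auto simp: left_diff_distrib)
  have "mass f1 = mass f2" using eq[of "\<lambda>_. 1"] f(2) i unfolding mass_def by simp
  then have "\<bar>(\<integral>x. f1 x * indicator S (compT \<beta> l x) \<partial>U) - (\<integral>x. f2 x * indicator S (compT \<beta> l x) \<partial>U)\<bar>
      \<le> A * B / (1 - \<alpha>) * C * rate l"
    using f12 by (intro decay cone_enlarge S cone_mass)
  then show ?thesis unfolding eq using ii i by simp
qed

end

section \<open>Mixing of the observables and the theorem\<close>

lemma C1_on_unit_Lipschitz:
  assumes "C1_on_unit \<phi>"
  obtains R where "\<And>x. x \<in> {0..1} \<Longrightarrow> \<bar>\<phi> x\<bar> \<le> R"
    "\<And>x y. x \<in> {0..1} \<Longrightarrow> y \<in> {0..1} \<Longrightarrow> \<bar>\<phi> x - \<phi> y\<bar> \<le> R * \<bar>x - y\<bar>"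
proof -
  obtain \<phi>' where p: "continuous_on {0..1} \<phi>'"
    "\<And>x. x \<in> {0..1} \<Longrightarrow> (\<phi> has_real_derivative \<phi>' x) (at x within {0..1})"
    using assms unfolding C1_on_unit_def by blast
  have "bounded (\<phi>' ` {0..1})"
    using p(1) by (intro compact_imp_bounded compact_continuous_image) auto
  then obtain K where "\<forall>y\<in>\<phi>' ` {0..1}. norm y \<le> K" unfolding bounded_iff by blast
  then have K: "norm (\<phi>' x) \<le> K" if "x \<in> {0..1}" for x using that by blast
  have K_nonneg: "K \<ge> 0" using order_trans[OF norm_ge_zero K[of 0]] by simp
  have L: "\<bar>\<phi> x - \<phi> y\<bar> \<le> K * \<bar>x - y\<bar>" if "x \<in> {0..1}" "y \<in> {0..1}" for x y
    using field_differentiable_bound[of "{0..1}" \<phi> \<phi>' K x y] p(2) K that by simp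
  show thesis
  proof (rule that[of "\<bar>\<phi> 0\<bar> + K"])
    fix x y :: real assume x: "x \<in> {0..1}"
    have "K * \<bar>x - 0\<bar> \<le> K" using x K_nonneg by (simp add: mult_left_le)
    with L[OF x, of 0] show "\<bar>\<phi> x\<bar> \<le> \<bar>\<phi> 0\<bar> + K" by simp
    assume y: "y \<in> {0..1}"
    show "\<bar>\<phi> x - \<phi> y\<bar> \<le> (\<bar>\<phi> 0\<bar> + K) * \<bar>x - y\<bar>"
      using L[OF x y] by (rule order_trans) (simp add: mult_right_mono)
  qed
qed

text \<open>The observable is controlled on the whole line, so compositions and measurability need
  no restriction to the unit interval; one \<open>R\<close> serves as sup bound and as Lipschitz
  constant.\<close>

locale lsv_observable = lsv_sequence +
  fixes \<psi> :: "real \<Rightarrow> real" and R :: real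
  assumes psi_bound: "\<And>x. \<bar>\<psi> x\<bar> \<le> R" and psi_Lipschitz: "\<And>x y. \<bar>\<psi> x - \<psi> y\<bar> \<le> R * \<bar>x - y\<bar>"
begin

lemma R_nonneg: "R \<ge> 0" using psi_bound[of 0] by linarith

lemma psi_measurable [measurable]: "\<psi> \<in> borel_measurable borel"
proof (rule borel_measurable_continuous_onI, rule continuous_onI)
  fix x e :: real assume "e > 0"
  show "\<exists>d>0. \<forall>x'\<in>UNIV. dist x' x < d \<longrightarrow> dist (\<psi> x') (\<psi> x) \<le> e"
  proof (intro exI[of _ "e / (R + 1)"] conjI ballI impI)
    show "0 < e / (R + 1)" using \<open>e > 0\<close> R_nonneg by simp
    fix x' assume "dist x' x < e / (R + 1)"
    then have "(R + 1) * \<bar>x' - x\<bar> \<le> e" using R_nonneg by (simp add: dist_real_def field_simps)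
    moreover have "R * \<bar>x' - x\<bar> \<le> (R + 1) * \<bar>x' - x\<bar>" by (intro mult_right_mono) auto
    ultimately show "dist (\<psi> x') (\<psi> x) \<le> e" using psi_Lipschitz[of x' x] by (simp add: dist_real_def)
  qed
qed

definition psi_mean :: "nat \<Rightarrow> real" where "psi_mean k = (\<integral>x. \<psi> (compT \<beta> k x) \<partial>U)"

definition psi_c :: "nat \<Rightarrow> real \<Rightarrow> real" where "psi_c k x = \<psi> x - psi_mean k"

lemma U_integrable_bounded:
  fixes g :: "real \<Rightarrow> real"
  assumes "g \<in> borel_measurable borel" "\<And>x. \<bar>g x\<bar> \<le> b"
  shows "integrable U g"
proof -
  interpret prob_space U by (rule prob_space_U)
  show ?thesis using bounded_times_integrable[OF _ assms, of "\<lambda>_. 1"] by simp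
qed

lemma U_integral_bounded:
  fixes g :: "real \<Rightarrow> real"
  assumes "g \<in> borel_measurable borel" "\<And>x. \<bar>g x\<bar> \<le> b"
  shows "\<bar>\<integral>x. g x \<partial>U\<bar> \<le> b"
proof -
  interpret prob_space U by (rule prob_space_U)
  have "\<bar>\<integral>x. g x \<partial>U\<bar> \<le> (\<integral>x. \<bar>g x\<bar> \<partial>U)" by (rule integral_abs_bound)
  also have "\<dots> \<le> (\<integral>x. b \<partial>U)"
    using U_integrable_bounded[OF assms] assms(2) by (intro integral_mono) auto
  finally show ?thesis using prob_space by simp
qed

lemma psi_c_measurable [measurable]: "psi_c k \<in> borel_measurable borel"
  unfolding psi_c_def by measurable

lemma psi_c_bound: "\<bar>psi_c k x\<bar> \<le> 2 * R"
proof -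
  have "(\<lambda>x. \<psi> (compT \<beta> k x)) \<in> borel_measurable borel" by measurable
  from U_integral_bounded[OF this psi_bound] psi_bound[of x] show ?thesis
    unfolding psi_c_def psi_mean_def by linarith
qed

lemma psi_c_Lipschitz: "\<bar>psi_c k x - psi_c k y\<bar> \<le> 2 * R * \<bar>x - y\<bar>"
proof -
  have "R * \<bar>x - y\<bar> \<le> 2 * R * \<bar>x - y\<bar>" using R_nonneg by (intro mult_right_mono) auto
  then show ?thesis using psi_Lipschitz[of x y] unfolding psi_c_def by simp
qed

lemma psi_c_mean: "(\<integral>x. psi_c k (compT \<beta> k x) \<partial>U) = 0"
proof -
  interpret prob_space U by (rule prob_space_U)
  have "integrable U (\<lambda>x. \<psi> (compT \<beta> k x))" using psi_bound by (intro U_integrable_bounded[of _ R]) auto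
  then show ?thesis unfolding psi_c_def using prob_space by (simp add: psi_mean_def)
qed

text \<open>Density of the law of \<open>compT \<beta> k\<close> under Lebesgue measure.\<close>

definition \<rho> :: "nat \<Rightarrow> real \<Rightarrow> real" where "\<rho> k = transfers \<beta> k (\<lambda>_. 1)"

lemma one_integrable: "integrable U (\<lambda>_. 1 :: real)"
  by (rule U_integrable_bounded[of _ 1]) auto

lemma dcone_rho: "dcone A (\<rho> k)"
proof -
  interpret p: prob_space U by (rule prob_space_U)
  have "1 \<le> A * x powr - \<alpha>" if "x \<in> {0<..1}" for x
  proof -
    have "1 powr - \<alpha> \<le> x powr - \<alpha>" using that alpha by (intro powr_mono2') auto
    then have "1 * 1 \<le> A * x powr - \<alpha>" using A_ge(1) by (intro mult_mono) auto
    then show ?thesis by simp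
  qed
  then have "cone A (\<lambda>_. 1)" unfolding cone_def decr_def by auto
  then have "cone A (\<rho> k)" unfolding \<rho>_def using p.prob_space by (intro cone_transfers) (auto simp: mass_def)
  moreover have "cone A (\<lambda>_. 0)" using A_ge(1) unfolding cone_def decr_def by auto
  ultimately show ?thesis unfolding dcone_def by force
qed

lemma integral_rho:
  assumes "g \<in> borel_measurable borel" "\<And>x. \<bar>g x\<bar> \<le> b"
  shows "(\<integral>x. \<rho> k x * g x \<partial>U) = (\<integral>x. g (compT \<beta> k x) \<partial>U)"
  unfolding \<rho>_def using transfers_duality(2)[OF one_integrable assms] by simp

definition B1 :: real where "B1 = 5 * (2 * R) * A"

text \<open>First summand: a second multiplication by a centred observable, after the density of
  constant \<open>B1\<close> has been transported. Second summand: the correlation times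
  \<open>\<rho> k\<close>, with the correlation regarded as a constant observable of size at most 4
  * R^2.\<close>

definition B2 :: real where "B2 = 5 * (2 * R) * (A * B1 / (1 - \<alpha>)) + 5 * (4 * R^2) * A"

lemma dcone_psi_rho: "dcone B1 (\<lambda>x. psi_c k x * \<rho> k x)"
  unfolding B1_def by (rule dcone_mult[OF dcone_rho psi_c_bound psi_c_Lipschitz])

lemma abs_mult_bound:
  fixes a b :: real
  assumes "\<bar>a\<bar> \<le> u" "\<bar>b\<bar> \<le> v"
  shows "\<bar>a * b\<bar> \<le> u * v"
  unfolding abs_mult using assms by (intro mult_mono) auto

text \<open>Seen from time k, this tests the signed density psi_c k * \<rho> k, of mean zero, after
  l further steps.\<close>

lemma mixing1:
  assumes [measurable]: "S \<in> sets borel"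
  shows "\<bar>\<integral>x. psi_c k (compT \<beta> k x) * indicator S (compT \<beta> (k + l) x) \<partial>U\<bar> \<le> A * B1 / (1 - \<alpha>) * C * rate l"
proof -
  interpret s: lsv_sequence \<alpha> "\<lambda>i. \<beta> (k + i)" by (rule shift)
  have i: "\<bar>indicator T y :: real\<bar> \<le> 1" for T and y :: real by (simp add: indicator_def)
  have "(\<integral>x. psi_c k (compT \<beta> k x) * indicator S (compT \<beta> (k + l) x) \<partial>U)
      = (\<integral>x. \<rho> k x * (psi_c k x * indicator S (compT (\<lambda>i. \<beta> (k + i)) l x)) \<partial>U)"
    unfolding compT_add by (rule integral_rho[symmetric, OF _ abs_mult_bound[OF psi_c_bound i]]) measurable
  also have "\<dots> = (\<integral>x. (psi_c k x * \<rho> k x) * indicator S (compT (\<lambda>i. \<beta> (k + i)) l x) \<partial>U)"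
    by (simp add: ac_simps)
  also have "\<bar>\<dots>\<bar> \<le> A * B1 / (1 - \<alpha>) * C * rate l"
  proof (rule s.decay_dcone[OF dcone_psi_rho _ assms])
    show "(\<integral>x. psi_c k x * \<rho> k x \<partial>U) = 0"
      using integral_rho[OF psi_c_measurable psi_c_bound, of k] psi_c_mean by (simp add: mult.commute)
  qed
  finally show ?thesis .
qed

definition corr :: "nat \<Rightarrow> nat \<Rightarrow> real" where
  "corr i k = (\<integral>x. psi_c i (compT \<beta> i x) * psi_c k (compT \<beta> k x) \<partial>U)"

lemma corr_bound: "\<bar>corr i k\<bar> \<le> 4 * R^2"
  unfolding corr_def using abs_mult_bound[OF psi_c_bound psi_c_bound]
  by (intro U_integral_bounded) (auto simp: power2_eq_square)

text \<open>The signed density at time k is built in stages: psi_c i * \<rho> i is transported from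
  i to k, multiplied by \<open>psi_c k\<close>, and corr i k * \<rho> k is subtracted. The result is
  a difference of cone elements of mean zero, so \<open>decay_dcone\<close> applies from time k
  on.\<close>

lemma mixing2:
  assumes S: "S \<in> sets borel" and ik: "i \<le> k"
  shows "\<bar>\<integral>x. (psi_c i (compT \<beta> i x) * psi_c k (compT \<beta> k x) - corr i k) * indicator S (compT \<beta> (k + l) x) \<partial>U\<bar>
      \<le> A * B2 / (1 - \<alpha>) * C * rate l"
proof -
  obtain d where k: "k = i + d" using ik le_Suc_ex by blast
  interpret s: lsv_sequence \<alpha> "\<lambda>j. \<beta> (k + j)" by (rule shift)
  interpret r: lsv_sequence \<alpha> "\<lambda>j. \<beta> (i + j)" by (rule shift)
  let ?F = "transfers (\<lambda>j. \<beta> (i + j)) d (\<lambda>x. psi_c i x * \<rho> i x)"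
  define h where "h x = psi_c k x * ?F x - corr i k * \<rho> k x" for x
  have ib: "\<bar>indicator T y :: real\<bar> \<le> 1" for T and y :: real by (simp add: indicator_def)
  have dF: "dcone (A * B1 / (1 - \<alpha>)) ?F" by (rule r.dcone_transfers[OF dcone_psi_rho])
  have dh: "dcone B2 h"
    unfolding h_def B2_def
    by (intro dcone_diff dcone_mult[OF dF psi_c_bound psi_c_Lipschitz] dcone_mult[OF dcone_rho corr_bound]) simp
  have key: "(\<integral>x. (psi_c i (compT \<beta> i x) * psi_c k (compT \<beta> k x) - corr i k) * indicator T (compT \<beta> (k + l) x) \<partial>U)
      = (\<integral>x. h x * indicator T (compT (\<lambda>j. \<beta> (k + j)) l x) \<partial>U)" if T: "T \<in> sets borel" for T
  proof -
    have [measurable]: "T \<in> sets borel" by fact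
    define G :: "real \<Rightarrow> real" where "G x = indicator T (compT (\<lambda>j. \<beta> (k + j)) l x)" for x
    have G: "G \<in> borel_measurable borel" "\<And>x. \<bar>G x\<bar> \<le> (1 :: real)" unfolding G_def by (auto simp: indicator_def)
    have [measurable]: "G \<in> borel_measurable borel" by fact
    note pG = abs_mult_bound[OF psi_c_bound G(2)]
    have 1: "(\<integral>x. psi_c i (compT \<beta> i x) * (psi_c k (compT \<beta> k x) * G (compT \<beta> k x)) \<partial>U)
        = (\<integral>x. psi_c k x * ?F x * G x \<partial>U)"
    proof -
      have "(\<integral>x. psi_c i (compT \<beta> i x) * (psi_c k (compT \<beta> k x) * G (compT \<beta> k x)) \<partial>U) =
        (\<integral>x. \<rho> i x * (psi_c i x * (psi_c k (compT (\<lambda>j. \<beta> (i + j)) d x) * G (compT (\<lambda>j. \<beta> (i + j)) d x))) \<partial>U)"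
        unfolding k compT_add
        by (rule integral_rho[symmetric, OF _ abs_mult_bound[OF psi_c_bound pG]]) measurable
      also have "\<dots> = (\<integral>x. (psi_c i x * \<rho> i x) * (psi_c k (compT (\<lambda>j. \<beta> (i + j)) d x) * G (compT (\<lambda>j. \<beta> (i + j)) d x)) \<partial>U)"
        by (simp add: ac_simps)
      also have "\<dots> = (\<integral>x. ?F x * (psi_c k x * G x) \<partial>U)"
        by (rule r.transfers_duality(2)[symmetric, OF dcone_integrable[OF dcone_psi_rho] _ pG]) measurable
      finally show ?thesis by (simp add: ac_simps)
    qed
    have 2: "(\<integral>x. G (compT \<beta> k x) \<partial>U) = (\<integral>x. \<rho> k x * G x \<partial>U)"
      by (rule integral_rho[symmetric, OF G])
    have i1: "integrable U (\<lambda>x. psi_c i (compT \<beta> i x) * (psi_c k (compT \<beta> k x) * G (compT \<beta> k x)))"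
      by (rule U_integrable_bounded[OF _ abs_mult_bound[OF psi_c_bound pG]]) measurable
    have i2: "integrable U (\<lambda>x. G (compT \<beta> k x))"
      by (rule U_integrable_bounded[OF _ G(2)]) measurable
    have i3: "integrable U (\<lambda>x. psi_c k x * ?F x * G x)"
      by (rule bounded_times_integrable[OF dcone_integrable[OF dcone_mult[OF dF psi_c_bound psi_c_Lipschitz]] G])
    have i4: "integrable U (\<lambda>x. \<rho> k x * G x)"
      by (rule bounded_times_integrable[OF dcone_integrable[OF dcone_rho] G])
    have "(\<integral>x. (psi_c i (compT \<beta> i x) * psi_c k (compT \<beta> k x) - corr i k) * indicator T (compT \<beta> (k + l) x) \<partial>U)
        = (\<integral>x. psi_c i (compT \<beta> i x) * (psi_c k (compT \<beta> k x) * G (compT \<beta> k x)) - corr i k * G (compT \<beta> k x) \<partial>U)"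
      unfolding G_def compT_add by (simp add: algebra_simps)
    also have "\<dots> = (\<integral>x. psi_c k x * ?F x * G x \<partial>U) - corr i k * (\<integral>x. \<rho> k x * G x \<partial>U)"
      using i1 i2 1 2 by simp
    also have "\<dots> = (\<integral>x. psi_c k x * ?F x * G x - corr i k * (\<rho> k x * G x) \<partial>U)"
      using i3 i4 by simp
    also have "\<dots> = (\<integral>x. h x * G x \<partial>U)" unfolding h_def by (simp add: algebra_simps)
    finally show ?thesis unfolding G_def .
  qed
  have "(\<integral>x. h x \<partial>U) = 0"
  proof -
    interpret p: prob_space U by (rule prob_space_U)
    have "integrable U (\<lambda>x. psi_c i (compT \<beta> i x) * psi_c k (compT \<beta> k x))"
      by (rule U_integrable_bounded[OF _ abs_mult_bound[OF psi_c_bound psi_c_bound]]) measurable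
    \<comment> \<open>With the full line as test set the transport identity computes the mean of
      \<open>h\<close>, and \<open>corr i k\<close> is just the value that makes it 0.\<close>
    then show ?thesis using key[of UNIV] p.prob_space by (simp add: corr_def)
  qed
  then show ?thesis unfolding key[OF S] by (rule s.decay_dcone[OF dh _ S])
qed

end

section \<open>Passage to the closed unit interval and the normal law\<close>

lemma integral_unitm:
  fixes g h :: "real \<Rightarrow> real"
  assumes [measurable]: "h \<in> borel_measurable borel" and eq: "\<And>x. x \<in> {0..1} \<Longrightarrow> g x = h x"
  shows "(\<integral>x. g x \<partial>unitm) = (\<integral>x. h x \<partial>U)"
proof -
  have h: "h \<in> borel_measurable lebesgue" by (simp add: measurable_completion)
  have "(\<integral>x. g x \<partial>unitm) = (\<integral>x. h x \<partial>unitm)"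
    using eq by (intro bochner_cong) auto
  also have "\<dots> = (\<integral>x. indicator {0..1} x *\<^sub>R h x \<partial>lebesgue)" by (subst integral_restrict_space) auto
  also have "\<dots> = (\<integral>x. indicator {0<..1} x *\<^sub>R h x \<partial>lebesgue)"
  proof (rule integral_cong_AE)
    show "AE x in lebesgue. indicator {0..1} x *\<^sub>R h x = indicator {0<..1} x *\<^sub>R h x"
      using AE_completion[OF AE_lborel_singleton[of 0]] by eventually_elim (auto simp: indicator_def)
  qed (use h in \<open>auto intro!: borel_measurable_times borel_measurable_indicator\<close>)
  also have "\<dots> = (\<integral>x. h x \<partial>U)" by (subst integral_restrict_space) auto
  finally show ?thesis .
qed

lemma prob_space_unitm: "prob_space unitm"
  by (rule prob_spaceI) (simp add: emeasure_restrict_space)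

lemma compT_unit:
  assumes "\<And>k. 0 < k \<Longrightarrow> 0 < \<beta> k" "x \<in> {0..1}"
  shows "compT \<beta> n x \<in> {0..1}"
proof (induction n)
  case (Suc n)
  show ?case
  proof (cases "compT \<beta> n x = 0")
    case True
    then show ?thesis by (simp add: LSV_def)
  next
    case False
    with Suc LSV_unit[of "compT \<beta> n x" "\<beta> (Suc n)"] assms(1)[of "Suc n"] show ?thesis by simp
  qed
qed (use assms in simp)

lemma measure_std_normal:
  assumes "B \<in> sets borel"
  shows "measure std_normal_distribution B = (LBINT x:B. exp (- x\<^sup>2 / 2)) / sqrt (2 * pi)"
proof -
  interpret real_distribution std_normal_distribution by (rule real_dist_normal_dist)
  have "measure std_normal_distribution B = (\<integral>x. indicator B x \<partial>std_normal_distribution)"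
    using assms by simp
  also have "\<dots> = (\<integral>x. std_normal_density x * indicator B x \<partial>lborel)"
    using assms by (subst integral_density) (auto simp: normal_density_nonneg)
  also have "\<dots> = (\<integral>x. (indicator B x *\<^sub>R exp (- x\<^sup>2 / 2)) / sqrt (2 * pi) \<partial>lborel)"
    by (intro bochner_cong) (auto simp: std_normal_density_def)
  finally show ?thesis by (simp add: set_lebesgue_integral_def)
qed

lemma cdf_std_normal: "cdf std_normal_distribution t = Phi t"
  unfolding cdf_def Phi_def by (simp add: measure_std_normal)

text \<open>The normal law has no atoms, so weak convergence yields convergence of distribution
  functions at every point.\<close>

lemma isCont_cdf_std_normal: "isCont (cdf std_normal_distribution) t"
proof -
  interpret real_distribution std_normal_distribution by (rule real_dist_normal_dist)
  have "AE x in lborel. indicator {t} x *\<^sub>R exp (- x\<^sup>2 / 2) = (0 :: real)"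
    using AE_lborel_singleton[of t] by eventually_elim (simp add: indicator_def)
  then have "measure std_normal_distribution {t} = 0"
    by (simp add: measure_std_normal set_lebesgue_integral_def integral_eq_zero_AE)
  then show ?thesis by (simp add: isCont_cdf)
qed

context lsv_observable
begin

text \<open>Shifted by one: the abstract sums run over k < n, the sums of the theorem from 1 to
  n.\<close>

definition obs :: "nat \<Rightarrow> real \<Rightarrow> real" where "obs k x = psi_c (Suc k) (compT \<beta> (Suc k) x)"

text \<open>Generated by the position at time k + 1. Later positions are functions of it, so these
  algebras decrease in k.\<close>

definition past :: "nat \<Rightarrow> real measure" where "past k = vimage_algebra {0..1} (compT \<beta> (Suc k)) borel"

definition mix_const :: real where
  "mix_const = \<bar>A * B1 / (1 - \<alpha>) * C\<bar> + \<bar>A * B2 / (1 - \<alpha>) * C\<bar> + 1"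

text \<open>The fourth root of mix_const * rate m, as the abstract mixing conditions are stated with
  fourth powers; the exponent \<kappa> / 2 becomes \<kappa> / 8.\<close>

definition mix_rate :: "nat \<Rightarrow> real" where
  "mix_rate m = mix_const powr (1/4) * (m + 1) powr - (\<kappa> / 8)"

lemma mix_const_ge: "A * B1 / (1 - \<alpha>) * C \<le> mix_const" "A * B2 / (1 - \<alpha>) * C \<le> mix_const" "mix_const > 0"
proof -
  have "a \<le> \<bar>a\<bar> + \<bar>b\<bar> + 1" "b \<le> \<bar>a\<bar> + \<bar>b\<bar> + 1" "0 < \<bar>a\<bar> + \<bar>b\<bar> + 1" for a b :: real by linarith+
  then show "A * B1 / (1 - \<alpha>) * C \<le> mix_const" "A * B2 / (1 - \<alpha>) * C \<le> mix_const" "mix_const > 0"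
    unfolding mix_const_def by blast+
qed

lemma mix_rate_power4: "mix_rate m ^ 4 = mix_const * rate m"
proof -
  have "(y powr z) ^ 4 = y powr (4 * z)" if "y > 0" for y z :: real
  proof -
    have "(y powr z) ^ 4 = (y powr z) powr real 4" using that by (intro powr_realpow[symmetric]) simp
    then show ?thesis by (simp only: powr_powr) (simp add: mult.commute)
  qed
  then show ?thesis using mix_const_ge(3) unfolding mix_rate_def rate_def by (simp add: power_mult_distrib)
qed

lemma le_mix_rate:
  assumes "\<bar>y\<bar> \<le> a * rate m" "a \<le> mix_const"
  shows "\<bar>y\<bar> \<le> mix_rate m ^ 4"
  using assms mult_right_mono[OF assms(2) rate_nonneg[of m]] unfolding mix_rate_power4 by linarith

lemma sets_past: "sets (past k) = {compT \<beta> (Suc k) -` T \<inter> {0..1} |T. T \<in> sets borel}"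
  unfolding past_def by (rule sets_vimage_algebra2) auto

lemma space_past: "space (past k) = {0..1}"
  unfolding past_def by simp

lemma integral_past:
  fixes f h :: "real \<Rightarrow> real"
  assumes "T \<in> sets borel" "k < j" and [measurable]: "h \<in> borel_measurable borel"
    and f: "\<And>x. x \<in> {0..1} \<Longrightarrow> f x = h x"
  shows "(\<integral>x. indicator (compT \<beta> (Suc j) -` T \<inter> {0..1}) x * f x \<partial>unitm)
    = (\<integral>x. h x * indicator T (compT \<beta> (Suc k + (j - k)) x) \<partial>U)"
proof (rule integral_unitm)
  have [measurable]: "T \<in> sets borel" by fact
  show "(\<lambda>x. h x * indicator T (compT \<beta> (Suc k + (j - k)) x)) \<in> borel_measurable borel" by measurable
  have "Suc k + (j - k) = Suc j" using assms by simp
  then show "indicator (compT \<beta> (Suc j) -` T \<inter> {0..1}) x * f x = h x * indicator T (compT \<beta> (Suc k + (j - k)) x)"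
    if "x \<in> {0..1}" for x using that f by (simp only:) (simp add: indicator_def)
qed

lemma reverse_mixing_obs:
  assumes \<alpha>: "\<alpha> < 1/9"
  shows "reverse_mixing unitm past obs (max 1 (2 * R)) mix_rate"
proof (intro reverse_mixing.intro reverse_mixing_axioms.intro prob_space_unitm)
  fix k j i :: nat
  have k8: "\<kappa> / 8 > 1" unfolding \<kappa>_def using \<alpha> alpha by (simp add: field_simps)
  show "subalgebra unitm (past k)"
  proof -
    have "compT \<beta> (Suc k) -` T \<inter> {0..1} \<in> sets unitm" if "T \<in> sets borel" for T
    proof -
      have "compT \<beta> (Suc k) -` T \<in> sets borel" using measurable_sets[OF borel_measurable_compT that] by (simp del: compT.simps)
      then have "compT \<beta> (Suc k) -` T \<in> sets lebesgue" by simp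
      then show ?thesis by (auto simp: sets_restrict_space simp del: compT.simps)
    qed
    then show ?thesis unfolding subalgebra_def sets_past by (auto simp: past_def simp del: compT.simps)
  qed
  show "subalgebra (past k) (past (Suc k))"
  proof -
    have "compT \<beta> (Suc (Suc k)) -` T \<inter> {0..1} \<in> sets (past k)" if "T \<in> sets borel" for T
    proof -
      have "LSV (\<beta> (Suc (Suc k))) -` T \<in> sets borel" using measurable_sets[OF borel_measurable_LSV that] by simp
      moreover have "compT \<beta> (Suc (Suc k)) -` T \<inter> {0..1} = compT \<beta> (Suc k) -` (LSV (\<beta> (Suc (Suc k))) -` T) \<inter> {0..1}"
        by auto
      ultimately show ?thesis unfolding sets_past by blast
    qed
    then have "sets (past (Suc k)) \<subseteq> sets (past k)" unfolding sets_past[of "Suc k"] by blast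
    then show ?thesis unfolding subalgebra_def by (simp add: space_past)
  qed
  show "obs k \<in> borel_measurable (past k)"
    unfolding obs_def past_def
    by (rule measurable_compose[OF measurable_vimage_algebra1 psi_c_measurable]) auto
  show "\<bar>obs k x\<bar> \<le> max 1 (2 * R)" for x
    unfolding obs_def using psi_c_bound[of "Suc k" "compT \<beta> (Suc k) x"] by linarith
  show "1 \<le> max 1 (2 * R)" by simp
  show "0 < mix_rate k" unfolding mix_rate_def using mix_const_ge(3) by simp
  show "decseq mix_rate" unfolding decseq_def mix_rate_def
    using k8 by (intro allI impI mult_left_mono powr_mono2') auto
  show "summable mix_rate"
  proof -
    have "summable (\<lambda>n. real n powr - (\<kappa> / 8))" using k8 by (subst summable_real_powr_iff) simp
    then have "summable (\<lambda>n. real (Suc n) powr - (\<kappa> / 8))" by (subst summable_Suc_iff)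
    then show ?thesis unfolding mix_rate_def by (intro summable_mult) (simp add: add.commute)
  qed
  fix D assume D: "D \<in> sets (past j)"
  then obtain T where T: "T \<in> sets borel" "D = compT \<beta> (Suc j) -` T \<inter> {0..1}" unfolding sets_past by blast
  have obs_meas [measurable]: "obs k \<in> borel_measurable borel" for k
    unfolding obs_def by measurable
  show "\<bar>\<integral>x. indicator D x * obs k x \<partial>unitm\<bar> \<le> mix_rate (j - k) ^ 4" if kj: "k < j"
  proof (rule le_mix_rate)
    show "\<bar>\<integral>x. indicator D x * obs k x \<partial>unitm\<bar> \<le> A * B1 / (1 - \<alpha>) * C * rate (j - k)"
      unfolding T(2) integral_past[OF T(1) kj obs_meas refl] unfolding obs_def by (rule mixing1[OF T(1)])
    show "A * B1 / (1 - \<alpha>) * C \<le> mix_const" by (rule mix_const_ge)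
  qed
  assume ik: "i \<le> k" and kj: "k < j"
  have corr: "(\<integral>y. obs i y * obs k y \<partial>unitm) = corr (Suc i) (Suc k)"
    unfolding corr_def by (rule integral_unitm) (auto simp: obs_def simp del: compT.simps)
  show "\<bar>\<integral>x. indicator D x * (obs i x * obs k x - (\<integral>y. obs i y * obs k y \<partial>unitm)) \<partial>unitm\<bar> \<le> mix_rate (j - k) ^ 4"
  proof (rule le_mix_rate)
    have m: "(\<lambda>x. obs i x * obs k x - corr (Suc i) (Suc k)) \<in> borel_measurable borel" by measurable
    show "\<bar>\<integral>x. indicator D x * (obs i x * obs k x - (\<integral>y. obs i y * obs k y \<partial>unitm)) \<partial>unitm\<bar>
        \<le> A * B2 / (1 - \<alpha>) * C * rate (j - k)"
      unfolding corr T(2) integral_past[OF T(1) kj m refl] unfolding obs_def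
      using ik by (intro mixing2[OF T(1)]) simp
    show "A * B2 / (1 - \<alpha>) * C \<le> mix_const" by (rule mix_const_ge)
  qed
qed

end

theorem mainTheorem9:
  fixes \<alpha> :: real and \<beta>s :: "nat \<Rightarrow> real" and \<phi> :: "real \<Rightarrow> real"
    and c \<beta> :: real
  assumes "0 < \<alpha>" and "\<alpha> < 1/9"
    and "\<forall>k\<ge>1. 0 < \<beta>s k \<and> \<beta>s k \<le> \<alpha>"
    and "C1_on_unit \<phi>"
    and "c > 0" and "\<beta> > 1 / (2 * (1 - 2 * \<alpha>))"
    and "eventually (\<lambda>n. sigma2 \<beta>s \<phi> n \<ge> c * real n powr \<beta>) sequentially"
  shows "\<forall>t::real. (\<lambda>n. measure unitm
            {x\<in>{0..1}. birkS \<beta>s \<phi> n x / sqrt (sigma2 \<beta>s \<phi> n) \<le> t})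
          \<longlonglongrightarrow> Phi t"
proof -
  obtain R where R: "\<And>x. x \<in> {0..1} \<Longrightarrow> \<bar>\<phi> x\<bar> \<le> R"
    "\<And>x y. x \<in> {0..1} \<Longrightarrow> y \<in> {0..1} \<Longrightarrow> \<bar>\<phi> x - \<phi> y\<bar> \<le> R * \<bar>x - y\<bar>"
    using C1_on_unit_Lipschitz[OF assms(4)] by blast
  \<comment> \<open>Clamping the argument to the unit interval extends \<phi> to the line with the
    same bound and Lipschitz constant.\<close>
  define \<psi> where "\<psi> x = \<phi> (max 0 (min 1 x))" for x
  have R0: "R \<ge> 0" using R(1)[of 0] by simp
  interpret lsv_observable \<alpha> \<beta>s \<psi> R
  proof
    show "0 < \<alpha>" "\<alpha> < 1" using assms by auto
    show "0 < \<beta>s k \<and> \<beta>s k \<le> \<alpha>" if "0 < k" for k using assms(3) that by simp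
    show "\<bar>\<psi> x\<bar> \<le> R" for x unfolding \<psi>_def by (rule R(1)) simp
    show "\<bar>\<psi> x - \<psi> y\<bar> \<le> R * \<bar>x - y\<bar>" for x y
    proof -
      have "\<bar>\<psi> x - \<psi> y\<bar> \<le> R * \<bar>max 0 (min 1 x) - max 0 (min 1 y)\<bar>" unfolding \<psi>_def by (rule R(2)) auto
      also have "\<dots> \<le> R * \<bar>x - y\<bar>" using R0 by (intro mult_left_mono) linarith+
      finally show ?thesis .
    qed
  qed
  interpret rm: reverse_mixing unitm past obs "max 1 (2 * R)" mix_rate
    by (rule reverse_mixing_obs[OF assms(2)])
  have unit: "compT \<beta>s n x \<in> {0..1}" if "x \<in> {0..1}" for n x
    using beta that by (intro compT_unit) auto
  have \<psi>: "\<psi> x = \<phi> x" if "x \<in> {0..1}" for x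
  proof -
    have "max 0 (min 1 x) = x" using that by auto
    then show ?thesis unfolding \<psi>_def by simp
  qed
  have cen: "centered \<beta>s \<phi> k (compT \<beta>s k x) = psi_c k (compT \<beta>s k x)" if "x \<in> {0..1}" for k x
  proof -
    have "(\<integral>y. \<phi> (compT \<beta>s k y) \<partial>unitm) = psi_mean k"
      unfolding psi_mean_def using \<psi>[OF unit] by (intro integral_unitm) auto
    then show ?thesis unfolding centered_def psi_c_def using \<psi>[OF unit[OF that]] by simp
  qed
  have birk: "birkS \<beta>s \<phi> n x = rm.S n x" if "x \<in> {0..1}" for n x
    unfolding birkS_def rm.S_def obs_def using cen[OF that] by (simp add: sum.atLeast1_atMost_eq del: compT.simps)
  have sig: "sigma2 \<beta>s \<phi> n = (rm.\<sigma> n)\<^sup>2" "sqrt (sigma2 \<beta>s \<phi> n) = rm.\<sigma> n" for n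
  proof -
    have "sigma2 \<beta>s \<phi> n = (\<integral>x. (rm.S n x)\<^sup>2 \<partial>unitm)"
      unfolding sigma2_def using birk by (intro bochner_cong) auto
    then show "sigma2 \<beta>s \<phi> n = (rm.\<sigma> n)\<^sup>2" "sqrt (sigma2 \<beta>s \<phi> n) = rm.\<sigma> n" unfolding rm.\<sigma>_def by auto
  qed
  have "filterlim (\<lambda>n. (rm.\<sigma> n)\<^sup>2 / sqrt n) at_top sequentially"
  proof (rule filterlim_at_top_mono)
    \<comment> \<open>As 0 < 1 - 2 \<alpha> < 1, the exponent hypothesis gives \<beta> > 1/2, and
      the variance exceeds sqrt n by at least the factor c n^(\<beta> - 1/2).\<close>
    have "1 / 2 \<le> 1 / (2 * (1 - 2 * \<alpha>))" using assms(1,2) by (intro divide_left_mono) auto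
    then have b: "\<beta> - 1/2 > 0" using assms(6) by linarith
    have "filterlim (\<lambda>n. exp ((\<beta> - 1/2) * ln (real n))) at_top sequentially"
      by (intro filterlim_compose[OF exp_at_top] filterlim_tendsto_pos_mult_at_top[OF tendsto_const b]
          filterlim_compose[OF ln_at_top filterlim_real_sequentially])
    then have "filterlim (\<lambda>n. real n powr (\<beta> - 1/2)) at_top sequentially"
    proof (rule filterlim_at_top_mono)
      show "eventually (\<lambda>n. exp ((\<beta> - 1/2) * ln (real n)) \<le> real n powr (\<beta> - 1/2)) sequentially"
        using eventually_gt_at_top[of 0] by eventually_elim (simp add: powr_def)
    qed
    then show "filterlim (\<lambda>n. c * real n powr (\<beta> - 1/2)) at_top sequentially"
      by (rule filterlim_tendsto_pos_mult_at_top[OF tendsto_const assms(5)])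
    show "eventually (\<lambda>n. c * real n powr (\<beta> - 1/2) \<le> (rm.\<sigma> n)\<^sup>2 / sqrt n) sequentially"
      using assms(7) eventually_gt_at_top[of 0]
    proof eventually_elim
      case (elim n)
      then have "c * real n powr (\<beta> - 1/2) = c * real n powr \<beta> / sqrt n"
        by (simp add: powr_diff powr_half_sqrt)
      also have "\<dots> \<le> (rm.\<sigma> n)\<^sup>2 / sqrt n" using elim unfolding sig(1) by (intro divide_right_mono) auto
      finally show ?case .
    qed
  qed
  then have conv: "weak_conv_m (\<lambda>n. distr unitm borel (\<lambda>x. rm.S n x / rm.\<sigma> n)) std_normal_distribution"
    by (rule rm.central_limit)
  show ?thesis
  proof
    fix t :: real
    have "(\<lambda>n. cdf (distr unitm borel (\<lambda>x. rm.S n x / rm.\<sigma> n)) t) \<longlonglongrightarrow> Phi t"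
      using conv isCont_cdf_std_normal unfolding weak_conv_m_def weak_conv_def cdf_std_normal[symmetric] by blast
    moreover have "cdf (distr unitm borel (\<lambda>x. rm.S n x / rm.\<sigma> n)) t
        = measure unitm {x\<in>{0..1}. birkS \<beta>s \<phi> n x / sqrt (sigma2 \<beta>s \<phi> n) \<le> t}" for n
    proof -
      have "rm.S n \<in> borel_measurable unitm" using rm.bm_S unfolding bdd_meas_def by simp
      then have "cdf (distr unitm borel (\<lambda>x. rm.S n x / rm.\<sigma> n)) t
          = measure unitm ((\<lambda>x. rm.S n x / rm.\<sigma> n) -` {..t} \<inter> space unitm)"
        unfolding cdf_def by (subst measure_distr) auto
      also have "(\<lambda>x. rm.S n x / rm.\<sigma> n) -` {..t} \<inter> space unitm
          = {x\<in>{0..1}. birkS \<beta>s \<phi> n x / sqrt (sigma2 \<beta>s \<phi> n) \<le> t}"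
        using birk sig(2) by auto
      finally show ?thesis .
    qed
    ultimately show "(\<lambda>n. measure unitm {x\<in>{0..1}. birkS \<beta>s \<phi> n x / sqrt (sigma2 \<beta>s \<phi> n) \<le> t}) \<longlonglongrightarrow> Phi t"
      by simp
  qed
qed

end
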